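(* Let $N\ge 1$ and let $\phi_1,\dots,\phi_N$ be (non-constant) finite Blaschke products having a common fixed point $w\in\mathbb{D}$, i.e. $\phi_j(w)=w$ for all $1\le j\le N$. Let $\tau$ be the action of the free semigroup $\mathbb{F}_N^+$ on $\mathbb{S}^1$ generated by $\phi_1,\dots,\phi_N$, with correlation functions computed with respect to the harmonic measure $\nu_w$ with pole at $w$. Fix $\alpha\in(0,1]$. Then: (1) $\tau$ is not mixing if and only if $|\phi_j'(w)|=1$ for some $1\le j\le N$; (2) $\tau$ is exponentially mixing on $C^\alpha$ if and only if $|\phi_j'(w)|<1$ for all $1\le j\le N$; (3) $\tau$ is mixing at a double exponential rate if and only if $\phi_j'(w)=0$ for all $1\le j\le N$.
   Context: $\mathbb{D}$ is the open unit disk, $\mathbb{S}^1=\{|z|=1\}$, $d\mu(z)=\frac{1}{2\pi i}\frac{dz}{z}$ is normalized Lebesgue measure on $\mathbb{S}^1$. A finite Blaschke product is a map $\phi(z)=e^{i\psi}\prod_{i=1}^q\frac{z-\lambda_i}{1-\overline{\lambda_i}z}$ with $\psi\in[0,2\pi)$, $|\lambda_i|<1$, $q\ge1$. The harmonic measure with pole at $w\in\mathbb{D}$ is $d\nu_w(z)=\frac{1-|w|^2}{|z-w|^2}\,d\mu(z)$ on $\mathbb{S}^1$; it is preserved by a finite Blaschke product fixing $w$. $\mathbb{F}_N^+$ is the free semigroup of words $a=i_1i_2\dots i_n$ in the letters $1,\dots,N$, with word length $|a|=n$, acting by $\tau(a)z=\phi_{i_n}\circ\phi_{i_{n-1}}\circ\dots\circ\phi_{i_1}(z)$,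 $z\in\mathbb{S}^1$. The correlation function is $\mathcal{C}_{f,g}(a)=\left|\int_{\mathbb{S}^1}(f\circ\tau(a))\,\overline{g}\,d\nu_w-\int_{\mathbb{S}^1}f\,d\nu_w\int_{\mathbb{S}^1}\overline{g}\,d\nu_w\right|$. - $\tau$ is (strongly) mixing if $\mathcal{C}_{f,g}(a)\to0$ as $|a|\to\infty$ for all $f,g\in L_2(\mathbb{S}^1,\nu_w)$. - $C^\alpha$, $\alpha\in(0,1]$, is the space of $\alpha$-H\"older continuous functions on $\mathbb{S}^1$ with the usual H\"older norm. $\tau$ is exponentially mixing on $C^\alpha$ if there exist $\kappa>0$, $C>0$ such that $\mathcal{C}_{f,g}(a)\le Ce^{-\kappa|a|}\|f\|_{C^\alpha}\|g\|_{C^\alpha}$ for all $f,g\in C^\alpha$ and all $a\in\mathbb{F}_N^+$. - For $0<\theta<1$, $\mathcal{H}_\theta$ is the closure of the linear combinations of $z^k$, $k\in\mathbb{Z}$, with respect to the norm $\|f\|_\theta=\sqrt{\sum_{k\in\mathbb{Z}}|f_k|^2\theta^{-2|k|}}$, where $f_k$ are the Fourier coefficients of $f$. $\tau$ is mixing at a double exponential rate if for some $0<\theta<1$ there exist $\beta,\gamma,C>0$ such that $\mathcal{C}_{f,g}(a)\le Ce^{-\beta e^{\gamma|a|}}\|f\|_\theta\|g\|_\theta$ for all $f,g\in\mathcal{H}_\theta$ and all $a\in\mathbb{F}_N^+$. *)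

theory Defs
  imports "HOL-Analysis.Analysis"
begin

definition finite_blaschke :: "(complex \<Rightarrow> complex) \<Rightarrow> bool" where
  "finite_blaschke \<phi> \<longleftrightarrow>
     (\<exists>\<psi> q (l :: nat \<Rightarrow> complex). 0 \<le> \<psi> \<and> \<psi> < 2 * pi \<and> 1 \<le> q \<and> (\<forall>i\<in>{1..q}. norm (l i) < 1) \<and>
        (\<forall>z\<in>cball 0 1. \<phi> z = cis \<psi> * (\<Prod>i=1..q. (z - l i) / (1 - cnj (l i) * z))))"

text \<open>With \<open>z = cis t\<close> one has \<open>dz / (2 \<pi> i z) = dt / (2 \<pi>)\<close>. The underlying space
  of the measure is the unit circle with its Borel sets, so that functions of type
  \<open>complex \<Rightarrow> complex\<close> only matter on the circle.\<close>

definition circle_measure :: "complex measure" where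
  "circle_measure =
     distr (uniform_measure lborel {0..<2 * pi}) (restrict_space borel (sphere 0 1)) cis"

definition harmonic_measure :: "complex \<Rightarrow> complex measure" where
  "harmonic_measure w =
     density circle_measure (\<lambda>z. ennreal ((1 - (norm w)\<^sup>2) / (norm (z - w))\<^sup>2))"

definition L2_functions :: "complex measure \<Rightarrow> (complex \<Rightarrow> complex) set" where
  "L2_functions M = {f \<in> borel_measurable M. integrable M (\<lambda>z. (norm (f z))\<^sup>2)}"

definition free_semigroup :: "nat \<Rightarrow> nat list set" where
  "free_semigroup N = {a. a \<noteq> [] \<and> set a \<subseteq> {1..N}}"

text \<open>The first letter of the word acts first:
  \<open>semigroup_action \<phi> [i1, i2, i3] z = \<phi> i3 (\<phi> i2 (\<phi> i1 z))\<close>.\<close>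

definition semigroup_action :: "(nat \<Rightarrow> complex \<Rightarrow> complex) \<Rightarrow> nat list \<Rightarrow> complex \<Rightarrow> complex" where
  "semigroup_action \<phi> a z = fold \<phi> a z"

definition correlation ::
  "(nat \<Rightarrow> complex \<Rightarrow> complex) \<Rightarrow> complex \<Rightarrow> (complex \<Rightarrow> complex) \<Rightarrow> (complex \<Rightarrow> complex) \<Rightarrow> nat list \<Rightarrow> real"
where
  "correlation \<phi> w f g a =
     norm ((LINT z|harmonic_measure w. f (semigroup_action \<phi> a z) * cnj (g z)) -
           (LINT z|harmonic_measure w. f z) * (LINT z|harmonic_measure w. cnj (g z)))"

definition mixing :: "nat \<Rightarrow> (nat \<Rightarrow> complex \<Rightarrow> complex) \<Rightarrow> complex \<Rightarrow> bool" where
  "mixing N \<phi> w \<longleftrightarrow>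
     (\<forall>f\<in>L2_functions (harmonic_measure w). \<forall>g\<in>L2_functions (harmonic_measure w).
        \<forall>\<epsilon>>0. \<exists>n. \<forall>a\<in>free_semigroup N. n \<le> length a \<longrightarrow> correlation \<phi> w f g a < \<epsilon>)"

definition holder_space :: "real \<Rightarrow> (complex \<Rightarrow> complex) set" where
  "holder_space \<alpha> =
     {f. \<exists>M. \<forall>x\<in>sphere 0 1. \<forall>y\<in>sphere 0 1. norm (f x - f y) \<le> M * dist x y powr \<alpha>}"

text \<open>Both suprema are over sets that are nonempty and, for \<open>f \<in> holder_space \<alpha>\<close>,
  bounded above.\<close>

definition holder_norm :: "real \<Rightarrow> (complex \<Rightarrow> complex) \<Rightarrow> real" where
  "holder_norm \<alpha> f =
     (SUP x\<in>sphere 0 1. norm (f x)) +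
     (SUP (x, y)\<in>{(x, y). x \<in> sphere 0 1 \<and> y \<in> sphere 0 1 \<and> x \<noteq> y}.
        norm (f x - f y) / dist x y powr \<alpha>)"

definition exponentially_mixing ::
  "real \<Rightarrow> nat \<Rightarrow> (nat \<Rightarrow> complex \<Rightarrow> complex) \<Rightarrow> complex \<Rightarrow> bool" where
  "exponentially_mixing \<alpha> N \<phi> w \<longleftrightarrow>
     (\<exists>\<kappa>>0. \<exists>C>0. \<forall>f\<in>holder_space \<alpha>. \<forall>g\<in>holder_space \<alpha>. \<forall>a\<in>free_semigroup N.
        correlation \<phi> w f g a
          \<le> C * exp (- \<kappa> * real (length a)) * holder_norm \<alpha> f * holder_norm \<alpha> g)"

definition fourier_coeff :: "(complex \<Rightarrow> complex) \<Rightarrow> int \<Rightarrow> complex" where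
  "fourier_coeff f k = (LINT z|circle_measure. f z * z powi (- k))"

definition theta_term :: "real \<Rightarrow> (complex \<Rightarrow> complex) \<Rightarrow> int \<Rightarrow> real" where
  "theta_term \<theta> f k = (norm (fourier_coeff f k))\<^sup>2 * \<theta> powi (- 2 * \<bar>k\<bar>)"

definition theta_norm :: "real \<Rightarrow> (complex \<Rightarrow> complex) \<Rightarrow> real" where
  "theta_norm \<theta> f = sqrt (\<Sum>\<^sub>\<infinity>k. theta_term \<theta> f k)"

definition laurent_polynomials :: "(complex \<Rightarrow> complex) set" where
  "laurent_polynomials = {\<lambda>z. \<Sum>k\<in>K. c k * z powi k |c K. finite (K :: int set)}"

text \<open>The closure is taken among the square-integrable functions on the circle. The
  summability condition says that the distance of \<open>f\<close> and \<open>p\<close> is finite; without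
  it \<^const>\<open>infsum\<close> would return the default value 0.\<close>

definition theta_space :: "real \<Rightarrow> (complex \<Rightarrow> complex) set" where
  "theta_space \<theta> =
     {f \<in> L2_functions circle_measure.
        \<forall>\<epsilon>>0. \<exists>p\<in>laurent_polynomials.
          theta_term \<theta> (\<lambda>z. f z - p z) summable_on UNIV \<and> theta_norm \<theta> (\<lambda>z. f z - p z) < \<epsilon>}"

definition double_exponentially_mixing ::
  "nat \<Rightarrow> (nat \<Rightarrow> complex \<Rightarrow> complex) \<Rightarrow> complex \<Rightarrow> bool" where
  "double_exponentially_mixing N \<phi> w \<longleftrightarrow>
     (\<exists>\<theta>>0. \<theta> < 1 \<and> (\<exists>\<beta>>0. \<exists>\<gamma>>0. \<exists>C>0.
        \<forall>f\<in>theta_space \<theta>. \<forall>g\<in>theta_space \<theta>. \<forall>a\<in>free_semigroup N.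
          correlation \<phi> w f g a
            \<le> C * exp (- \<beta> * exp (\<gamma> * real (length a))) * theta_norm \<theta> f * theta_norm \<theta> g))"

end

theory Submission
  imports Defs "HOL-Complex_Analysis.Complex_Analysis" "HOL-Real_Asymp.Real_Asymp"
begin

text \<open>
  Write \<open>b(z) = (z - w) / (1 - cnj w * z)\<close> for the Blaschke factor of the fixed point, and let
  \<open>F(z)\<close> be the harmonic extension of a function \<open>f\<close> on the circle, that is, the integral of \<open>f\<close>
  against the harmonic measure with pole \<open>z\<close>. Everything rests on two facts. A holomorphic self-map
  of the disc preserving the circle carries the harmonic measure with pole \<open>z\<close> to the one with
  pole \<open>\<phi>(z)\<close> (\<open>distr_harmonic_measure\<close>), so composition with \<open>\<phi>\<close> on the circle becomes composition
  of harmonic extensions, \<open>F \<circ> \<phi>\<close>, inside the disc. And by the Schwarz-Pick lemma at the fixed point,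
  \<open>t = \<bar>b(z)\<bar>\<close> is mapped to at most \<open>t (t + \<lambda>) / (1 + \<lambda> t)\<close> with \<open>\<lambda> = \<bar>\<phi>'(w)\<bar>\<close>
  (\<open>schwarz_pick_fixed_point\<close>).

  If all multipliers are at most \<open>\<Lambda> < 1\<close>, the quantity \<open>t / (1 - t)\<close> shrinks by the factor
  \<open>(1 + \<Lambda>) / 2\<close> under each generator, uniformly up to the boundary, and Harnack's inequality
  bounds \<open>\<bar>F(z) - F(w)\<bar>\<close> by \<open>2 sup \<bar>f\<bar> t / (1 - t)\<close>. To evaluate a correlation, the density times the
  second function is replaced by its Poisson average of radius \<open>r\<close>. For a Hoelder function this costs
  a power of \<open>1 - r\<close>; and since the Poisson average is self-adjoint, what remains is an integral of
  \<open>F(\<phi>_a(r z)) - F(w)\<close>, which is \<open>O(((1 + \<Lambda>) / 2)^n / (1 - r))\<close> for words of length \<open>n\<close>. Letting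
  \<open>1 - r\<close> decay at half the exponential rate gives exponential mixing
  (\<open>exponentially_mixing_if_contracting\<close>), and density of Laurent polynomials in \<open>L2\<close> together with
  invariance of the measure turns this into mixing. If some multiplier has modulus \<open>1\<close>, then
  \<open>b \<circ> \<phi>_j = c b\<close> with \<open>\<bar>c\<bar> = 1\<close>, and the autocorrelation of the Lipschitz function \<open>b\<close> along the
  iterates of \<open>\<phi>_j\<close> is constantly \<open>1\<close> (\<open>correlation_rotation\<close>). The first two equivalences follow,
  because multipliers never exceed \<open>1\<close>.

  If all multipliers vanish, then \<open>\<bar>b(\<phi>_a(z))\<bar> \<le> \<bar>b(z)\<bar>^(2^n)\<close>. The correlation of two monomials is
  zero or, up to conjugation, a Taylor coefficient at \<open>0\<close> of a function of this size on a circle inside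
  the disc, and Cauchy's estimate makes it \<open>O(2^\<bar>j\<bar> 2^\<bar>k\<bar> s^(2^n))\<close> with
  \<open>s < 1\<close>. The weights of the space with \<open>\<theta> = 1/4\<close> dominate the factors \<open>2^\<bar>j\<bar>\<close>, so that the bound passes to Laurent polynomials and then to their closure
  (\<open>double_exponentially_mixing_if_superattracting\<close>). Conversely, the geometric series of \<open>b\<close> bounds
  the \<open>n\<close>-th power of the multiplier by the sum over \<open>k\<close> of \<open>\<bar>w\<bar>^k\<close> times the correlation of \<open>z\<close> with
  \<open>z^(k+1)\<close> along \<open>\<phi>_j\<close> iterated \<open>n\<close> times (\<open>multiplier_le_correlation_series\<close>). The norms of
  \<open>z^(k+1)\<close> grow like \<open>\<theta>^(-k)\<close>, possibly faster than \<open>\<bar>w\<bar>^(-k)\<close>; interpolating the double exponential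
  bound with the trivial bound \<open>2\<close> restores convergence while keeping the double exponential decay in
  \<open>n\<close>, which no nonzero multiplier allows.
\<close>

section \<open>The circle measure and the Poisson integral\<close>

definition poisson :: "complex \<Rightarrow> complex \<Rightarrow> real" where
  "poisson w z = (1 - (norm w)\<^sup>2) / (norm (z - w))\<^sup>2"

lemma space_circle: "space circle_measure = sphere 0 1"
  by (simp add: circle_measure_def space_restrict_space)

lemma sets_circle: "sets circle_measure = sets (restrict_space borel (sphere 0 1))"
  by (simp add: circle_measure_def)

lemma space_harmonic: "space (harmonic_measure w) = sphere 0 1"
  by (simp add: harmonic_measure_def space_circle)

lemma sets_harmonic: "sets (harmonic_measure w) = sets circle_measure"
  by (simp add: harmonic_measure_def)

lemma measurable_harmonic: "borel_measurable (harmonic_measure w) = borel_measurable circle_measure"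
  by (rule measurable_cong_sets) (simp_all add: sets_harmonic)

lemma measurable_circle_continuous:
  fixes f :: "complex \<Rightarrow> 'a::topological_space"
  assumes "continuous_on (sphere 0 1) f"
  shows "f \<in> borel_measurable circle_measure"
proof -
  have "f \<in> borel_measurable (restrict_space borel (sphere 0 1))"
    by (rule borel_measurable_continuous_on_restrict[OF assms])
  then show ?thesis
    using measurable_cong_sets[OF sets_circle refl] by blast
qed

lemma cis_measurable_circle:
  "cis \<in> measurable (uniform_measure lborel {0..<2 * pi}) (restrict_space borel (sphere 0 1))"
proof -
  have "cis \<in> borel_measurable borel"
    by (intro borel_measurable_continuous_onI continuous_intros)
  then have "cis \<in> measurable borel (restrict_space borel (sphere 0 1))"
    by (intro measurable_restrict_space2) auto
  moreover have "sets (uniform_measure lborel {0..<2 * pi}) = sets borel"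
    by simp
  ultimately show ?thesis
    using measurable_cong_sets[OF _ refl] by blast
qed

lemma emeasure_circle: "emeasure circle_measure (sphere 0 1) = 1"
proof -
  have "emeasure circle_measure (sphere 0 1) =
      emeasure (uniform_measure lborel {0..<2 * pi}) (cis -` sphere 0 1 \<inter> space (uniform_measure lborel {0..<2 * pi}))"
    unfolding circle_measure_def
    by (rule emeasure_distr[OF cis_measurable_circle]) (simp add: sets_restrict_space_iff)
  also have "cis -` sphere 0 1 \<inter> space (uniform_measure lborel {0..<2 * pi}) = space (uniform_measure lborel {0..<2 * pi})"
    by auto
  also have "emeasure (uniform_measure lborel {0..<2 * pi}) \<dots> = 1"
    by (simp add: emeasure_uniform_measure ennreal_divide_self)
  finally show ?thesis .
qed

interpretation circle: finite_measure circle_measure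
  by (rule finite_measureI) (simp add: space_circle emeasure_circle)

lemma measure_circle: "measure circle_measure (sphere 0 1) = 1"
  by (simp add: measure_def emeasure_circle)

lemma space_eq_circle: "sets M = sets circle_measure \<Longrightarrow> space M = sphere 0 1"
  using sets_eq_imp_space_eq space_circle by metis

lemma borel_measurable_on_circle:
  fixes f :: "complex \<Rightarrow> 'a::topological_space"
  assumes "sets M = sets circle_measure" "continuous_on (sphere 0 1) f"
  shows "f \<in> borel_measurable M"
  using measurable_circle_continuous[OF assms(2)] measurable_cong_sets[OF assms(1) refl] by blast

lemma continuous_circle_bounded:
  fixes f :: "complex \<Rightarrow> 'a::real_normed_vector"
  assumes "continuous_on (sphere 0 1) f"
  obtains B where "\<And>z::complex. norm z = 1 \<Longrightarrow> norm (f z) \<le> B"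
proof -
  have "compact (f ` sphere 0 1)"
    by (intro compact_continuous_image assms) auto
  then obtain B where "\<And>y. y \<in> f ` sphere 0 1 \<Longrightarrow> norm y \<le> B"
    by (meson bounded_iff compact_imp_bounded)
  then have "norm (f z) \<le> B" if "norm z = 1" for z :: complex using that by simp
  then show thesis by (rule that)
qed

lemma integrable_continuous_on_circle:
  fixes f :: "complex \<Rightarrow> 'a::{banach, second_countable_topology}"
  assumes "finite_measure M" "sets M = sets circle_measure" "continuous_on (sphere 0 1) f"
  shows "integrable M f"
proof -
  interpret finite_measure M by fact
  obtain B where "\<And>z. norm z = 1 \<Longrightarrow> norm (f z) \<le> B"
    using continuous_circle_bounded[OF assms(3)] by blast
  then show ?thesis
    by (intro integrable_const_bound[of _ B])
       (use borel_measurable_on_circle[OF assms(2,3)] space_eq_circle[OF assms(2)] in \<open>auto intro!: AE_I2\<close>)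
qed

lemmas integrable_circle_continuous =
  integrable_continuous_on_circle[OF circle.finite_measure_axioms refl]

lemma integral_circle_has_integral:
  fixes f :: "complex \<Rightarrow> complex"
  assumes f: "continuous_on (sphere 0 1) f"
    and I: "((\<lambda>t. f (cis t)) has_integral I) {0..2 * pi}"
  shows "(LINT z|circle_measure. f z) = I / (2 * pi)"
proof -
  let ?S = "{0..<2 * pi}"
  have fm: "f \<in> borel_measurable (restrict_space borel (sphere 0 1))"
    by (rule borel_measurable_continuous_on_restrict[OF f])
  have "(LINT z|circle_measure. f z) = (LINT t|uniform_measure lborel ?S. f (cis t))"
    unfolding circle_measure_def by (rule integral_distr[OF cis_measurable_circle fm])
  also have "\<dots> = (LINT t|density lborel (\<lambda>t. ennreal (indicator ?S t / (2 * pi))). f (cis t))"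
  proof -
    have "indicator ?S t / ennreal (2 * pi) = ennreal (indicator ?S t / (2 * pi))" for t :: real
      by (auto simp: indicator_def divide_ennreal[symmetric])
    then show ?thesis by (simp add: uniform_measure_def)
  qed
  also have "\<dots> = (LINT t|lborel. (indicator ?S t / (2 * pi)) *\<^sub>R f (cis t))"
  proof (rule integral_density)
    have "continuous_on UNIV (\<lambda>t. f (cis t))"
      by (rule continuous_on_compose2[OF f]) (auto intro!: continuous_intros)
    then show "(\<lambda>t. f (cis t)) \<in> borel_measurable lborel"
      by (simp add: borel_measurable_continuous_onI)
  qed auto
  \<comment> \<open>The half-open and the closed interval differ by a null set.\<close>
  also have "\<dots> = (LINT t|lborel. (1 / (2 * pi)) *\<^sub>R (indicator {0..2*pi} t *\<^sub>R f (cis t)))"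
  proof (rule integral_cong_AE)
    have c: "continuous_on UNIV (\<lambda>t. f (cis t))"
      by (rule continuous_on_compose2[OF f]) (auto intro!: continuous_intros)
    then have [measurable]: "(\<lambda>t. f (cis t)) \<in> borel_measurable borel"
      by (simp add: borel_measurable_continuous_onI)
    show "(\<lambda>t. (indicator ?S t / (2 * pi)) *\<^sub>R f (cis t)) \<in> borel_measurable lborel"
      by measurable
    show "(\<lambda>t. (1 / (2 * pi)) *\<^sub>R (indicator {0..2*pi} t *\<^sub>R f (cis t))) \<in> borel_measurable lborel"
      by measurable
    show "AE t in lborel. (indicator ?S t / (2 * pi)) *\<^sub>R f (cis t) =
            (1 / (2 * pi)) *\<^sub>R (indicator {0..2*pi} t *\<^sub>R f (cis t))"
      using AE_lborel_singleton[of "2*pi"]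
      by eventually_elim (auto simp: indicator_def)
  qed
  also have "\<dots> = (1 / (2 * pi)) *\<^sub>R (LINT t:{0..2*pi}|lborel. f (cis t))"
    unfolding set_lebesgue_integral_def by (rule integral_scaleR_right)
  also have "(LINT t:{0..2*pi}|lborel. f (cis t)) = I"
  proof -
    have "continuous_on {0..2*pi} (\<lambda>t. f (cis t))"
      by (rule continuous_on_compose2[OF f]) (auto intro!: continuous_intros)
    then have "set_integrable lborel {0..2*pi} (\<lambda>t. f (cis t))"
      by (rule borel_integrable_atLeastAtMost')
    then show ?thesis
      using set_borel_integral_eq_integral(2) I integral_unique by metis
  qed
  finally show ?thesis by (simp add: scaleR_conv_of_real)
qed

text \<open>
  With \<open>z = cis t\<close> one has \<open>dt = dz / (\<i> z)\<close>, so Cauchy's formulas become statements about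
  the circle measure.
\<close>

lemma integral_circle_contour:
  fixes f :: "complex \<Rightarrow> complex"
  assumes f: "continuous_on (sphere 0 1) f"
    and I: "((\<lambda>z. f z / z) has_contour_integral I) (circlepath 0 1)"
  shows "(LINT z|circle_measure. f z) = I / (2 * pi * \<i>)"
proof -
  have "((\<lambda>t. f (0 + 1 * cis t) / (0 + 1 * cis t) * 1 * \<i> * cis t) has_integral I) {0..2*pi}"
    using I unfolding circlepath_def
    by (subst (asm) has_contour_integral_part_circlepath_iff) auto
  then have "((\<lambda>t. f (cis t) * \<i>) has_integral I) {0..2*pi}"
    by (simp add: field_simps)
  then have "((\<lambda>t. f (cis t) * \<i> * (-\<i>)) has_integral I * (-\<i>)) {0..2*pi}"
    by (rule has_integral_mult_left)
  then have "((\<lambda>t. f (cis t)) has_integral - (I * \<i>)) {0..2*pi}"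
    by (simp add: algebra_simps)
  from integral_circle_has_integral[OF f this] show ?thesis
    by (simp add: field_simps)
qed

lemma cauchy_circle:
  assumes c: "continuous_on (cball 0 1) U" and h: "U holomorphic_on ball 0 1" and w: "norm w < 1"
  shows "(LINT z|circle_measure. U z * (z / (z - w))) = U w"
proof -
  have cU: "continuous_on (sphere 0 1) U"
    by (rule continuous_on_subset[OF c]) auto
  have "((\<lambda>u. U u / (u - w)) has_contour_integral (2 * pi * \<i>) * U w) (circlepath 0 1)"
    using Cauchy_has_contour_integral_higher_derivative_circlepath[OF c h, of w 0] w by simp
  then have "((\<lambda>z. (U z * (z / (z - w))) / z) has_contour_integral (2 * pi * \<i>) * U w) (circlepath 0 1)"
    by (rule has_contour_integral_eq) auto
  moreover have "continuous_on (sphere 0 1) (\<lambda>z. U z * (z / (z - w)))"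
    using w by (intro continuous_intros cU) auto
  ultimately show ?thesis
    by (subst integral_circle_contour) (auto simp: field_simps)
qed

lemma taylor_coeff_circle:
  assumes c: "continuous_on (cball 0 1) U" and h: "U holomorphic_on ball 0 1"
  shows "(LINT z|circle_measure. U z / z ^ k) = (deriv ^^ k) U 0 / fact k"
proof -
  have cU: "continuous_on (sphere 0 1) U"
    by (rule continuous_on_subset[OF c]) auto
  have "((\<lambda>u. U u / (u - 0) ^ Suc k) has_contour_integral (2 * pi * \<i>) / fact k * (deriv ^^ k) U 0) (circlepath 0 1)"
    by (rule Cauchy_has_contour_integral_higher_derivative_circlepath[OF c h]) auto
  then have "((\<lambda>z. (U z / z ^ k) / z) has_contour_integral (2 * pi * \<i>) / fact k * (deriv ^^ k) U 0) (circlepath 0 1)"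
    by (simp add: field_simps)
  moreover have "continuous_on (sphere 0 1) (\<lambda>z. U z / z ^ k)"
    by (intro continuous_intros cU) auto
  ultimately show ?thesis
    by (subst integral_circle_contour) (auto simp: field_simps)
qed

text \<open>
  On the circle \<open>cnj z = 1 / z\<close>, so the kernel is the restriction of a rational function. The
  first form is the Cauchy kernel plus a function that vanishes at \<open>0\<close>; the second one shows the pole
  at \<open>w\<close> that Cauchy's estimate for monomials has to cancel.
\<close>

lemma poisson_circle_eq:
  fixes w z :: complex
  assumes "norm w < 1" "z \<in> sphere 0 1"
  shows "complex_of_real (poisson w z) = z / (z - w) + cnj w * z / (1 - cnj w * z)"
    and "complex_of_real (poisson w z) = (1 - (norm w)\<^sup>2) * z / ((z - w) * (1 - cnj w * z))"
proof -
  have zw: "z \<noteq> w" using assms by auto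
  have nz: "z * cnj z = 1" using assms by (simp add: complex_norm_square[symmetric])
  have d: "1 - cnj w * z = z * cnj (z - w)" using nz by (simp add: algebra_simps)
  have z0: "z \<noteq> 0" using assms by auto
  have "cnj z \<noteq> 0" "z - w \<noteq> 0" "cnj (z - w) \<noteq> 0" using zw z0 by (auto simp del: complex_cnj_diff)
  have "complex_of_real (poisson w z) = (1 - (norm w)\<^sup>2) / ((z - w) * cnj (z - w))"
    by (simp add: poisson_def complex_norm_square[symmetric] del: complex_cnj_diff)
  also have "\<dots> = (1 - (norm w)\<^sup>2) * z / ((z - w) * (1 - cnj w * z))"
    unfolding d using z0 \<open>z - w \<noteq> 0\<close> \<open>cnj (z - w) \<noteq> 0\<close> by (simp add: divide_simps del: complex_cnj_diff)
  finally show 2: "complex_of_real (poisson w z) = (1 - (norm w)\<^sup>2) * z / ((z - w) * (1 - cnj w * z))" .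
  have nw: "complex_of_real ((norm w)\<^sup>2) = w * cnj w" by (rule complex_norm_square)
  have d0: "1 - cnj w * z \<noteq> 0" unfolding d using z0 \<open>cnj (z - w) \<noteq> 0\<close> by simp
  have "z / (z - w) + cnj w * z / (1 - cnj w * z) = (1 - w * cnj w) * z / ((z - w) * (1 - cnj w * z))"
    using \<open>z - w \<noteq> 0\<close> d0 by (simp add: divide_simps) (simp add: algebra_simps)
  then show "complex_of_real (poisson w z) = z / (z - w) + cnj w * z / (1 - cnj w * z)"
    using 2 nw by (simp)
qed

lemma poisson_pos: fixes z :: complex shows "norm w < 1 \<Longrightarrow> z \<in> sphere 0 1 \<Longrightarrow> poisson w z > 0"
  unfolding poisson_def by (rule divide_pos_pos) (auto simp: abs_square_less_1)

lemma continuous_poisson: "norm w < 1 \<Longrightarrow> continuous_on (sphere 0 1) (poisson w)"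
  unfolding poisson_def[abs_def] by (intro continuous_intros) auto

lemma integral_harmonic:
  fixes f :: "complex \<Rightarrow> complex"
  assumes "norm w < 1" "f \<in> borel_measurable circle_measure"
  shows "(LINT z|harmonic_measure w. f z) = (LINT z|circle_measure. poisson w z * f z)"
proof -
  have "AE z in circle_measure. 0 \<le> poisson w z"
    using poisson_pos[OF assms(1)] by (intro AE_I2) (simp add: space_circle less_imp_le)
  from integral_density[OF assms(2) measurable_circle_continuous[OF continuous_poisson[OF assms(1)]] this]
  show ?thesis
    by (simp add: harmonic_measure_def poisson_def[symmetric] scaleR_conv_of_real)
qed

text \<open>
  In the partial fraction form of the kernel the first summand reproduces \<open>U w\<close> by Cauchy's
  formula and the second one contributes the value at \<open>0\<close> of a function vanishing there.
\<close>

lemma poisson_integral_holomorphic: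
  assumes c: "continuous_on (cball 0 1) U" and h: "U holomorphic_on ball 0 1" and w: "norm w < 1"
  shows "(LINT z|harmonic_measure w. U z) = U w"
proof -
  have cU: "continuous_on (sphere 0 1) U"
    by (rule continuous_on_subset[OF c]) auto
  have nz: "1 - cnj w * z \<noteq> 0" if "norm z \<le> 1" for z
  proof
    assume "1 - cnj w * z = 0"
    then have "norm (cnj w * z) = 1" by (metis eq_iff_diff_eq_0 norm_one)
    then have "1 \<le> norm w * 1" using mult_left_mono[OF that, of "norm w"] by (simp add: norm_mult)
    with w show False by simp
  qed
  let ?V = "\<lambda>z. U z * (cnj w * z / (1 - cnj w * z))"
  have cV: "continuous_on (cball 0 1) ?V"
    using nz by (intro continuous_intros c) auto
  have hV: "?V holomorphic_on ball 0 1"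
    using nz by (intro holomorphic_intros h) auto
  have "(LINT z|harmonic_measure w. U z) = (LINT z|circle_measure. poisson w z * U z)"
    by (rule integral_harmonic[OF w measurable_circle_continuous[OF cU]])
  also have "\<dots> = (LINT z|circle_measure. U z * (z / (z - w)) + ?V z)"
    by (rule Bochner_Integration.integral_cong[OF refl])
       (use poisson_circle_eq(1)[OF w] in \<open>auto simp: space_circle algebra_simps\<close>)
  also have "\<dots> = (LINT z|circle_measure. U z * (z / (z - w))) + (LINT z|circle_measure. ?V z)"
    by (rule Bochner_Integration.integral_add; rule integrable_circle_continuous)
       (use w nz in \<open>auto intro!: continuous_intros cU\<close>)
  also have "(LINT z|circle_measure. ?V z) = ?V 0"
    using taylor_coeff_circle[OF cV hV, of 0] by simp
  finally show ?thesis using cauchy_circle[OF c h w] by simp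
qed

lemma integral_poisson:
  assumes w: "norm w < 1"
  shows "(LINT z|circle_measure. poisson w z) = 1"
proof -
  have "complex_of_real (LINT z|circle_measure. poisson w z) = (LINT z|circle_measure. complex_of_real (poisson w z) * 1)"
    by simp
  also have "\<dots> = (LINT z|harmonic_measure w. 1)"
    by (rule integral_harmonic[symmetric, OF w]) simp
  also have "\<dots> = 1" using poisson_integral_holomorphic[of "\<lambda>_. 1" w] w by simp
  finally show ?thesis by (metis of_real_eq_1_iff)
qed

lemma emeasure_harmonic:
  assumes w: "norm w < 1"
  shows "emeasure (harmonic_measure w) (sphere 0 1) = 1"
proof -
  have P: "integrable circle_measure (poisson w)"
    by (rule integrable_circle_continuous[OF continuous_poisson[OF w]])
  have "emeasure (harmonic_measure w) (sphere 0 1) = (\<integral>\<^sup>+ z. ennreal (poisson w z) * indicator (sphere 0 1) z \<partial>circle_measure)"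
    unfolding harmonic_measure_def poisson_def[symmetric]
    using measurable_circle_continuous[OF continuous_poisson[OF w]]
    by (intro emeasure_density) (auto simp: sets_circle sets_restrict_space_iff)
  also have "\<dots> = (\<integral>\<^sup>+ z. ennreal (poisson w z) \<partial>circle_measure)"
    by (rule nn_integral_cong) (auto simp: space_circle)
  also have "\<dots> = ennreal (LINT z|circle_measure. poisson w z)"
    using poisson_pos[OF w] by (intro nn_integral_eq_integral P AE_I2) (auto simp: space_circle less_imp_le)
  finally show ?thesis by (simp add: integral_poisson[OF w])
qed

lemma finite_measure_harmonic: "norm w < 1 \<Longrightarrow> finite_measure (harmonic_measure w)"
  by (rule finite_measureI) (simp add: space_harmonic emeasure_harmonic)

lemma measure_harmonic: "norm w < 1 \<Longrightarrow> measure (harmonic_measure w) (sphere 0 1) = 1"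
  by (simp add: measure_def emeasure_harmonic)

lemma circle_eq_harmonic: "circle_measure = harmonic_measure 0"
proof -
  have "harmonic_measure 0 = density circle_measure (\<lambda>_. 1)"
    unfolding harmonic_measure_def
    by (rule density_cong) (auto intro!: AE_I2 measurable_circle_continuous continuous_intros simp: space_circle)
  then show ?thesis by (simp add: density_1)
qed

section \<open>Uniform approximation by Laurent polynomials\<close>

lemma laurent_monomial: "(\<lambda>z. c * z powi k) \<in> laurent_polynomials"
  unfolding laurent_polynomials_def
  by (rule CollectI, intro exI[of _ "\<lambda>_. c"] exI[of _ "{k}"]) auto

lemma laurent_const: "(\<lambda>z. c) \<in> laurent_polynomials"
  using laurent_monomial[of c 0] by simp

lemma laurent_add:
  assumes "p \<in> laurent_polynomials" "q \<in> laurent_polynomials"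
  shows "(\<lambda>z. p z + q z) \<in> laurent_polynomials"
proof -
  obtain c K d L where p: "p = (\<lambda>z. \<Sum>k\<in>K. c k * z powi k)" "finite (K :: int set)"
    and q: "q = (\<lambda>z. \<Sum>k\<in>L. d k * z powi k)" "finite (L :: int set)"
    using assms unfolding laurent_polynomials_def by blast
  define e where "e k = (if k \<in> K then c k else 0) + (if k \<in> L then d k else 0)" for k
  have "p z + q z = (\<Sum>k\<in>K \<union> L. e k * z powi k)" for z
  proof -
    have "(\<Sum>k\<in>K. c k * z powi k) = (\<Sum>k\<in>K \<union> L. (if k \<in> K then c k else 0) * z powi k)"
      using p(2) q(2) by (intro sum.mono_neutral_cong_left) auto
    moreover have "(\<Sum>k\<in>L. d k * z powi k) = (\<Sum>k\<in>K \<union> L. (if k \<in> L then d k else 0) * z powi k)"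
      using p(2) q(2) by (intro sum.mono_neutral_cong_left) auto
    ultimately show ?thesis
      by (simp add: p(1) q(1) e_def sum.distrib distrib_right)
  qed
  then show ?thesis
    unfolding laurent_polynomials_def using p(2) q(2)
    by (intro CollectI exI[of _ e] exI[of _ "K \<union> L"]) auto
qed

lemma laurent_sum:
  "(\<And>i. i \<in> I \<Longrightarrow> f i \<in> laurent_polynomials) \<Longrightarrow> (\<lambda>z. \<Sum>i\<in>I. f i z) \<in> laurent_polynomials"
proof (induction I rule: infinite_finite_induct)
  case (insert x F)
  then show ?case using laurent_add[of "f x" "\<lambda>z. \<Sum>i\<in>F. f i z"] by simp
qed (auto intro: laurent_const)

lemma laurent_cmult:
  assumes "p \<in> laurent_polynomials"
  shows "(\<lambda>z. c * p z) \<in> laurent_polynomials"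
proof -
  obtain d K where p: "p = (\<lambda>z. \<Sum>k\<in>K. d k * z powi k)"
    using assms unfolding laurent_polynomials_def by blast
  have "(\<lambda>z. \<Sum>k\<in>K. (c * d k) * z powi k) \<in> laurent_polynomials"
    by (intro laurent_sum laurent_monomial)
  then show ?thesis by (simp add: p sum_distrib_left mult.assoc)
qed

text \<open>
  The product is a Laurent polynomial only away from \<open>0\<close>, where exponents add. This
  is harmless because only values on the circle matter.
\<close>

lemma laurent_mult_circle:
  assumes "p \<in> laurent_polynomials" "q \<in> laurent_polynomials"
  shows "\<exists>r\<in>laurent_polynomials. \<forall>z\<in>sphere 0 1. p z * q z = r z"
proof -
  obtain c K d L where p: "p = (\<lambda>z. \<Sum>k\<in>K. c k * z powi k)"
    and q: "q = (\<lambda>z. \<Sum>k\<in>L. d k * z powi k)"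
    using assms unfolding laurent_polynomials_def by blast
  show ?thesis
  proof (intro bexI ballI)
    show "(\<lambda>z. \<Sum>k\<in>K. \<Sum>l\<in>L. (c k * d l) * z powi (k + l)) \<in> laurent_polynomials"
      by (intro laurent_sum laurent_monomial)
    fix z :: complex assume "z \<in> sphere 0 1"
    then have "z \<noteq> 0" by auto
    then show "p z * q z = (\<Sum>k\<in>K. \<Sum>l\<in>L. (c k * d l) * z powi (k + l))"
      by (simp add: p q sum_product power_int_add algebra_simps)
  qed
qed

lemma continuous_powi:
  "continuous_on (sphere 0 1) (\<lambda>z::complex. z powi k)"
  by (intro continuous_intros) auto

lemma laurent_continuous:
  assumes "p \<in> laurent_polynomials"
  shows "continuous_on (sphere 0 1) p"
proof -
  obtain d K where p: "p = (\<lambda>z. \<Sum>k\<in>K. d k * z powi k)"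
    using assms unfolding laurent_polynomials_def by blast
  show ?thesis unfolding p by (intro continuous_intros continuous_powi) auto
qed

lemma cnj_circle:
  assumes "z \<in> sphere 0 (1::real)"
  shows "cnj z = inverse z"
proof -
  have "z * cnj z = 1" using assms by (simp add: complex_norm_square[symmetric])
  then show ?thesis by (metis inverse_unique)
qed

lemma cnj_powi_circle:
  assumes "z \<in> sphere 0 (1::real)"
  shows "cnj (z powi k) = z powi (- k)"
proof -
  have "cnj (z powi k) = cnj z powi k" by (simp add: power_int_def)
  then show ?thesis by (simp add: cnj_circle[OF assms] power_int_inverse power_int_minus)
qed

lemma real_linear_form_cnj:
  "(of_real a / 2 - \<i> * of_real b / 2) * z + (of_real a / 2 + \<i> * of_real b / 2) * cnj z
     = complex_of_real (Re z * a + Im z * b)"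
  by (cases z) (auto simp: complex_eq_iff field_simps)

text \<open>
  On the circle the real and imaginary parts are combinations of \<open>z\<close> and \<open>1 / z\<close>, so every
  polynomial in them is a Laurent polynomial. This reduces the density of Laurent polynomials to
  the Stone-Weierstrass theorem for real polynomials in the plane.
\<close>

lemma real_polynomial_circle:
  assumes "real_polynomial_function (g :: complex \<Rightarrow> real)"
  shows "\<exists>r\<in>laurent_polynomials. \<forall>z\<in>sphere 0 1. complex_of_real (g z) = r z"
  using assms
proof induction
  case (linear f)
  interpret bounded_linear f by fact
  have e: "f z = Re z * f 1 + Im z * f \<i>" for z
  proof -
    have "f z = f (Re z *\<^sub>R 1 + Im z *\<^sub>R \<i>)"
      by (rule arg_cong[where f = f]) (simp add: complex_eq_iff)
    then show ?thesis by (simp only: add scaleR real_scaleR_def)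
  qed
  let ?r = "\<lambda>z::complex. (f 1 / 2 - \<i> * f \<i> / 2) * z powi 1 + (f 1 / 2 + \<i> * f \<i> / 2) * z powi (-1)"
  have "complex_of_real (f z) = ?r z" if z: "z \<in> sphere 0 1" for z
  proof -
    have "z powi (-1) = cnj z" using cnj_circle[OF z] by (simp add: power_int_minus)
    then have "?r z = (f 1 / 2 - \<i> * f \<i> / 2) * z + (f 1 / 2 + \<i> * f \<i> / 2) * cnj z"
      by (simp only: power_int_1_right)
    also have "\<dots> = complex_of_real (Re z * f 1 + Im z * f \<i>)"
      using real_linear_form_cnj[of "f 1" "f \<i>" z] by (simp only: of_real_divide of_real_numeral)
    finally have "?r z = complex_of_real (Re z * f 1 + Im z * f \<i>)" .
    then show ?thesis by (simp only: e[of z])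
  qed
  moreover have "?r \<in> laurent_polynomials"
    by (intro laurent_add laurent_monomial)
  ultimately show ?case by (intro bexI[of _ ?r] ballI)
next
  case (const c)
  show ?case
    by (rule bexI[of _ "\<lambda>z. complex_of_real c"]) (simp_all add: laurent_const)
next
  case (add f g)
  then obtain p q where "p \<in> laurent_polynomials" "\<forall>z\<in>sphere 0 1. complex_of_real (f z) = p z"
    "q \<in> laurent_polynomials" "\<forall>z\<in>sphere 0 1. complex_of_real (g z) = q z" by blast
  then show ?case by (intro bexI[of _ "\<lambda>z. p z + q z"] laurent_add) auto
next
  case (mult f g)
  then obtain p q where *: "p \<in> laurent_polynomials" "\<forall>z\<in>sphere 0 1. complex_of_real (f z) = p z"
    "q \<in> laurent_polynomials" "\<forall>z\<in>sphere 0 1. complex_of_real (g z) = q z" by blast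
  from laurent_mult_circle[OF *(1,3)] * show ?case by simp
qed

lemma laurent_uniformly_dense:
  fixes f :: "complex \<Rightarrow> complex"
  assumes f: "continuous_on (sphere 0 1) f" and e: "0 < e"
  shows "\<exists>p\<in>laurent_polynomials. \<forall>z\<in>sphere 0 1. norm (f z - p z) < e"
proof -
  have cR: "continuous_on (sphere 0 1) (\<lambda>z. Re (f z))" and cI: "continuous_on (sphere 0 1) (\<lambda>z. Im (f z))"
    by (intro continuous_intros f)+
  obtain g where g: "real_polynomial_function g" "\<And>z. z \<in> sphere 0 1 \<Longrightarrow> \<bar>Re (f z) - g z\<bar> < e / 2"
    using Stone_Weierstrass_real_polynomial_function[OF compact_sphere cR, of "e/2"] e by auto
  obtain h where h: "real_polynomial_function h" "\<And>z. z \<in> sphere 0 1 \<Longrightarrow> \<bar>Im (f z) - h z\<bar> < e / 2"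
    using Stone_Weierstrass_real_polynomial_function[OF compact_sphere cI, of "e/2"] e by auto
  obtain p where p: "p \<in> laurent_polynomials" "\<And>z. z \<in> sphere 0 1 \<Longrightarrow> complex_of_real (g z) = p z"
    using real_polynomial_circle[OF g(1)] by blast
  obtain q where q: "q \<in> laurent_polynomials" "\<And>z. z \<in> sphere 0 1 \<Longrightarrow> complex_of_real (h z) = q z"
    using real_polynomial_circle[OF h(1)] by blast
  have "norm (f z - (p z + \<i> * q z)) < e" if z: "z \<in> sphere 0 1" for z
  proof -
    have "norm (f z - (p z + \<i> * q z)) \<le> \<bar>Re (f z - (p z + \<i> * q z))\<bar> + \<bar>Im (f z - (p z + \<i> * q z))\<bar>"
      by (rule cmod_le)
    also have "\<dots> = \<bar>Re (f z) - g z\<bar> + \<bar>Im (f z) - h z\<bar>"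
      by (simp add: p(2)[OF z, symmetric] q(2)[OF z, symmetric])
    also have "\<dots> < e" using g(2)[OF z] h(2)[OF z] by linarith
    finally show ?thesis .
  qed
  then show ?thesis
    by (intro bexI[of _ "\<lambda>z. p z + \<i> * q z"] laurent_add laurent_cmult p q) auto
qed

section \<open>Measures on the circle with equal Fourier coefficients\<close>

lemma circle_sets_borel:
  assumes "sets M = sets circle_measure" "A \<in> sets M"
  shows "A \<in> sets borel" "A \<subseteq> sphere 0 1"
  using assms by (auto simp: sets_circle sets_restrict_space_iff)

lemma id_measurable_plane:
  assumes "sets M = sets circle_measure"
  shows "(\<lambda>z. z) \<in> measurable M borel"
  by (rule borel_measurable_on_circle[OF assms]) (intro continuous_intros)

text \<open>
  A measure on the circle is moved to the plane, where finite Borel measures are regular: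
  Borel sets are approximated from inside by compact and from outside by open sets.
\<close>

lemma emeasure_plane:
  assumes M: "sets M = sets circle_measure" and B: "B \<in> sets borel"
  shows "emeasure (distr M borel (\<lambda>z. z)) B = emeasure M (B \<inter> sphere 0 1)"
  using emeasure_distr[OF id_measurable_plane[OF M] B] by (simp add: space_eq_circle[OF M])

lemma plane_finite:
  assumes M: "finite_measure M" "sets M = sets circle_measure"
  shows "emeasure (distr M borel (\<lambda>z. z)) (space (distr M borel (\<lambda>z. z))) \<noteq> \<infinity>"
proof -
  interpret finite_measure M by fact
  show ?thesis using emeasure_finite[of "UNIV \<inter> sphere 0 1"]
    by (simp add: emeasure_plane[OF M(2)])
qed

lemma urysohn_bump:
  fixes K U :: "complex set"
  assumes "compact K" "open U" "K \<subseteq> U"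
  obtains h :: "complex \<Rightarrow> real" where "continuous_on UNIV h" "\<And>z. 0 \<le> h z" "\<And>z. h z \<le> 1"
    "\<And>z. z \<in> K \<Longrightarrow> h z = 1" "\<And>z. z \<notin> U \<Longrightarrow> h z = 0"
proof -
  have "closed K" "closed (-U)" "K \<inter> -U = {}" using assms by (auto intro: compact_imp_closed)
  then obtain h :: "complex \<Rightarrow> real" where h: "continuous_on UNIV h" "\<And>x. h x \<in> closed_segment 1 0"
      "\<And>x. x \<in> K \<Longrightarrow> h x = 1" "\<And>x. x \<in> -U \<Longrightarrow> h x = 0"
    by (rule Urysohn[of K "-U" 1 0]) blast
  show thesis
    by (rule that[of h]) (use h in \<open>auto simp: closed_segment_eq_real_ivl\<close>)
qed

text \<open>
  By uniform approximation the two measures give the same integral to every continuous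
  function. A bump function between a compact set and an open set then shows that each measure of an
  open set is at most the other one, and outer regularity extends the equality to all Borel sets.
\<close>

lemma measure_eq_if_laurent_integrals_eq:
  assumes M: "finite_measure M" "sets M = sets circle_measure"
    and N: "finite_measure N" "sets N = sets circle_measure"
    and eq: "\<And>k. (LINT z|M. z powi k) = (LINT z|N. z powi k)"
  shows "M = N"
proof -
  interpret M: finite_measure M by fact
  interpret N: finite_measure N by fact
  have lau: "(LINT z|M. p z) = (LINT z|N. p z)" if p: "p \<in> laurent_polynomials" for p
  proof -
    obtain c K where p: "p = (\<lambda>z. \<Sum>k\<in>K. c k * z powi k)"
      using p unfolding laurent_polynomials_def by blast
    have "integrable M (\<lambda>z. c k * z powi k)" "integrable N (\<lambda>z. c k * z powi k)" for k
      by (intro integrable_mult_right integrable_continuous_on_circle continuous_powi M N)+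
    then show ?thesis unfolding p by (simp add: eq)
  qed
  have spM: "space M = sphere 0 1" and spN: "space N = sphere 0 1"
    by (rule space_eq_circle[OF M(2)]) (rule space_eq_circle[OF N(2)])
  have cont: "(LINT z|M. f z) = (LINT z|N. f z)" if f: "continuous_on (sphere 0 1) f" for f :: "complex \<Rightarrow> complex"
  proof -
    define m where "m = measure M (space M) + measure N (space N) + 1"
    have m: "m > 0" unfolding m_def by (simp add: add_nonneg_pos)
    have "norm ((LINT z|M. f z) - (LINT z|N. f z)) \<le> 0 + e" if e: "e > 0" for e
    proof -
      obtain p where p: "p \<in> laurent_polynomials" "\<And>z. z \<in> sphere 0 1 \<Longrightarrow> norm (f z - p z) < e / m"
        using laurent_uniformly_dense[OF f, of "e / m"] e m by auto
      have cp: "continuous_on (sphere 0 1) p" by (rule laurent_continuous[OF p(1)])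
      have i: "integrable M f" "integrable N f" "integrable M p" "integrable N p"
        by (intro integrable_continuous_on_circle M N f cp)+
      have 1: "norm ((LINT z|M. f z - p z)) \<le> (LINT z|M. e / m)"
        by (rule Bochner_Integration.integral_norm_bound_integral) (use i p(2) in \<open>auto simp: spM less_imp_le\<close>)
      have 2: "norm ((LINT z|N. f z - p z)) \<le> (LINT z|N. e / m)"
        by (rule Bochner_Integration.integral_norm_bound_integral) (use i p(2) in \<open>auto simp: spN less_imp_le\<close>)
      have "(LINT z|M. f z) - (LINT z|N. f z) = (LINT z|M. f z - p z) - (LINT z|N. f z - p z)"
        using lau[OF p(1)] i by simp
      also have "norm \<dots> \<le> norm (LINT z|M. f z - p z) + norm (LINT z|N. f z - p z)"
        by (rule norm_triangle_ineq4)
      also have "\<dots> \<le> (LINT z|M. e / m) + (LINT z|N. e / m)"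
        using 1 2 by linarith
      also have "\<dots> = (m - 1) * (e / m)" by (simp add: m_def distrib_right add_divide_distrib)
      also have "\<dots> \<le> e" using m e by (simp add: field_simps)
      finally show ?thesis by simp
    qed
    then have "norm ((LINT z|M. f z) - (LINT z|N. f z)) \<le> 0"
      by (rule field_le_epsilon)
    then show ?thesis by simp
  qed
  \<comment> \<open>Stated for an arbitrary pair of measures so that it can be used in both directions.\<close>
  have open_le: "emeasure M' (U \<inter> sphere 0 1) \<le> emeasure N' (U \<inter> sphere 0 1)"
    if U: "open U" and M': "finite_measure M'" "sets M' = sets circle_measure"
      and N': "finite_measure N'" "sets N' = sets circle_measure"
      and cont: "\<And>f :: complex \<Rightarrow> complex. continuous_on (sphere 0 1) f \<Longrightarrow> (LINT z|M'. f z) = (LINT z|N'. f z)"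
    for U M' N'
  proof -
    interpret M': finite_measure M' by fact
    interpret N': finite_measure N' by fact
    have "emeasure M' (U \<inter> sphere 0 1) = emeasure (distr M' borel (\<lambda>z. z)) U"
      using U by (simp add: emeasure_plane[OF M'(2)])
    also have "\<dots> = (SUP K \<in> {K. K \<subseteq> U \<and> compact K}. emeasure (distr M' borel (\<lambda>z. z)) K)"
      using U by (intro inner_regular plane_finite M') auto
    also have "\<dots> \<le> emeasure N' (U \<inter> sphere 0 1)"
    proof (rule SUP_least, clarify)
      fix K assume K: "K \<subseteq> U" "compact K"
      obtain h :: "complex \<Rightarrow> real" where h: "continuous_on UNIV h" "\<And>z. 0 \<le> h z" "\<And>z. h z \<le> 1"
        "\<And>z. z \<in> K \<Longrightarrow> h z = 1" "\<And>z. z \<notin> U \<Longrightarrow> h z = 0"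
        using urysohn_bump[OF K(2) U K(1)] by blast
      have ch: "continuous_on (sphere 0 1) h" using h(1) continuous_on_subset by blast
      have KB: "K \<in> sets borel" using K(2) by (simp add: compact_imp_closed)
      have KM: "K \<inter> sphere 0 1 \<in> sets M'" and UM: "U \<inter> sphere 0 1 \<in> sets N'"
        using KB U by (auto simp: M'(2) N'(2) sets_circle sets_restrict_space_iff)
      have iM: "integrable M' h" and iN: "integrable N' h"
        by (intro integrable_continuous_on_circle M' N' ch)+
      have iK: "integrable M' (indicat_real (K \<inter> sphere 0 1))"
        by (rule integrable_real_indicator[OF KM]) (simp add: less_top[symmetric])
      have iU: "integrable N' (indicat_real (U \<inter> sphere 0 1))"
        by (rule integrable_real_indicator[OF UM]) (simp add: less_top[symmetric])
      have "complex_of_real (LINT z|M'. h z) = complex_of_real (LINT z|N'. h z)"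
      proof -
        have "(LINT z|M'. complex_of_real (h z)) = (LINT z|N'. complex_of_real (h z))"
          by (rule cont) (intro continuous_intros ch)
        then show ?thesis by simp
      qed
      then have eqh: "(LINT z|M'. h z) = (LINT z|N'. h z)" by (simp only: of_real_eq_iff)
      have "measure M' (K \<inter> sphere 0 1) = (LINT z|M'. indicator (K \<inter> sphere 0 1) z)"
        using KM sets.sets_into_space by (simp add: Int_absorb1 Int_absorb2 inf.absorb1)
      also have "\<dots> \<le> (LINT z|M'. h z)"
        by (rule integral_mono[OF iK iM]) (use h in \<open>auto simp: indicator_def\<close>)
      also have "\<dots> = (LINT z|N'. h z)" by (rule eqh)
      also have "\<dots> \<le> (LINT z|N'. indicator (U \<inter> sphere 0 1) z)"
        by (rule integral_mono[OF iN iU]) (use h space_eq_circle[OF N'(2)] in \<open>auto simp: indicator_def\<close>)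
      also have "\<dots> = measure N' (U \<inter> sphere 0 1)"
        using UM sets.sets_into_space by (simp add: inf.absorb1)
      finally show "emeasure (distr M' borel (\<lambda>z. z)) K \<le> emeasure N' (U \<inter> sphere 0 1)"
        by (simp add: emeasure_plane[OF M'(2) KB] M'.emeasure_eq_measure N'.emeasure_eq_measure)
    qed
    finally show ?thesis .
  qed
  have op: "emeasure M (U \<inter> sphere 0 1) = emeasure N (U \<inter> sphere 0 1)" if "open U" for U
    by (intro antisym open_le that M N cont cont[symmetric])
  show ?thesis
  proof (rule measure_eqI)
    show "sets M = sets N" using M N by simp
    fix A assume A: "A \<in> sets M"
    note AB = circle_sets_borel[OF M(2) A]
    have out: "emeasure L A = (INF U \<in> {U. A \<subseteq> U \<and> open U}. emeasure L (U \<inter> sphere 0 1))"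
      if L: "finite_measure L" "sets L = sets circle_measure" for L
    proof -
      have "emeasure L A = emeasure (distr L borel (\<lambda>z. z)) A"
        using AB by (simp add: emeasure_plane[OF L(2)] inf.absorb1)
      also have "\<dots> = (INF U \<in> {U. A \<subseteq> U \<and> open U}. emeasure (distr L borel (\<lambda>z. z)) U)"
        by (intro outer_regular plane_finite L AB) auto
      also have "\<dots> = (INF U \<in> {U. A \<subseteq> U \<and> open U}. emeasure L (U \<inter> sphere 0 1))"
        by (intro INF_cong refl emeasure_plane[OF L(2)]) auto
      finally show ?thesis .
    qed
    show "emeasure M A = emeasure N A"
      unfolding out[OF M] out[OF N] by (intro INF_cong refl op) auto
  qed
qed

section \<open>Density of Laurent polynomials in the square-integrable functions\<close>

lemma norm_add_square_le:
  fixes a b :: "'a::real_normed_vector"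
  shows "(norm (a + b))\<^sup>2 \<le> 2 * (norm a)\<^sup>2 + 2 * (norm b)\<^sup>2"
proof -
  have "(norm (a + b))\<^sup>2 \<le> (norm a + norm b)\<^sup>2"
    by (intro power_mono norm_triangle_ineq) auto
  also have "\<dots> \<le> 2 * (norm a)\<^sup>2 + 2 * (norm b)\<^sup>2"
    using sum_squares_bound[of "norm a" "norm b"] by (simp add: power2_sum)
  finally show ?thesis .
qed

lemma L2_borel: "f \<in> L2_functions M \<Longrightarrow> f \<in> borel_measurable M"
  by (simp add: L2_functions_def)

lemma L2_integrable: "f \<in> L2_functions M \<Longrightarrow> integrable M (\<lambda>z. (norm (f z))\<^sup>2)"
  by (simp add: L2_functions_def)

lemma L2_I:
  assumes "f \<in> borel_measurable M" "integrable M g" "\<And>z. z \<in> space M \<Longrightarrow> (norm (f z))\<^sup>2 \<le> g z"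
  shows "f \<in> L2_functions M"
proof -
  have [measurable]: "f \<in> borel_measurable M" by fact
  have "integrable M (\<lambda>z. (norm (f z))\<^sup>2)"
    by (rule Bochner_Integration.integrable_bound[OF assms(2)])
       (use assms(3) in \<open>auto intro!: AE_I2 intro: order_trans[OF _ abs_ge_self]\<close>)
  then show ?thesis using assms(1) by (simp add: L2_functions_def)
qed

lemma L2_add:
  assumes "f \<in> L2_functions M" "g \<in> L2_functions M"
  shows "(\<lambda>z. f z + g z) \<in> L2_functions M"
  using assms by (intro L2_I[where g = "\<lambda>z. 2 * (norm (f z))\<^sup>2 + 2 * (norm (g z))\<^sup>2"])
    (auto intro!: norm_add_square_le simp: L2_functions_def)

lemma L2_cmult:
  assumes "f \<in> L2_functions M"
  shows "(\<lambda>z. c * f z) \<in> L2_functions M"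
  using assms by (intro L2_I[where g = "\<lambda>z. (norm c)\<^sup>2 * (norm (f z))\<^sup>2"])
    (auto simp: L2_functions_def norm_mult power_mult_distrib)

lemma L2_diff:
  assumes "f \<in> L2_functions M" "g \<in> L2_functions M"
  shows "(\<lambda>z. f z - g z) \<in> L2_functions M"
  using L2_add[OF assms(1) L2_cmult[OF assms(2), of "-1"]] by simp

lemma L2_cnj:
  assumes "f \<in> L2_functions M"
  shows "(\<lambda>z. cnj (f z)) \<in> L2_functions M"
proof -
  have "(\<lambda>z. cnj (f z)) \<in> borel_measurable M"
    using assms by (intro borel_measurable_continuous_on[of cnj] L2_borel continuous_intros)
  then show ?thesis using assms by (simp add: L2_functions_def)
qed

lemma L2_bounded:
  assumes "finite_measure M" "f \<in> borel_measurable M" "\<And>z. z \<in> space M \<Longrightarrow> norm (f z) \<le> B"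
  shows "f \<in> L2_functions M"
proof -
  interpret finite_measure M by fact
  show ?thesis
    using assms by (intro L2_I[where g = "\<lambda>z. B\<^sup>2"]) (auto intro!: power_mono)
qed

lemma L2_continuous:
  assumes "finite_measure M" "sets M = sets circle_measure" "continuous_on (sphere 0 1) f"
  shows "f \<in> L2_functions M"
proof -
  interpret finite_measure M by fact
  have "integrable M (\<lambda>z. (norm (f z))\<^sup>2)"
    by (intro integrable_continuous_on_circle assms continuous_intros)
  then show ?thesis
    using borel_measurable_on_circle[OF assms(2,3)] by (simp add: L2_functions_def)
qed

lemma laurent_L2:
  assumes "finite_measure M" "sets M = sets circle_measure" "p \<in> laurent_polynomials"
  shows "p \<in> L2_functions M"
  by (rule L2_continuous[OF assms(1,2) laurent_continuous[OF assms(3)]])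

lemma L2_mult_integrable:
  assumes "f \<in> L2_functions M" "g \<in> L2_functions M"
  shows "integrable M (\<lambda>z. f z * g z)"
proof (rule Bochner_Integration.integrable_bound)
  show "integrable M (\<lambda>z. (norm (f z))\<^sup>2 + (norm (g z))\<^sup>2)"
    using assms by (auto simp: L2_functions_def)
  show "(\<lambda>z. f z * g z) \<in> borel_measurable M"
    using assms by (auto simp: L2_functions_def)
  have "norm (a * b) \<le> (norm a)\<^sup>2 + (norm b)\<^sup>2" for a b :: complex
  proof -
    have "2 * (norm a * norm b) \<le> (norm a)\<^sup>2 + (norm b)\<^sup>2"
      using sum_squares_bound[of "norm a" "norm b"] by (simp add: mult.assoc)
    moreover have "0 \<le> norm a * norm b" by simp
    ultimately show ?thesis unfolding norm_mult by linarith
  qed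
  then show "AE z in M. norm (f z * g z) \<le> norm ((norm (f z))\<^sup>2 + (norm (g z))\<^sup>2)"
    by (auto intro!: AE_I2 intro: order_trans[OF _ abs_ge_self])
qed

lemma L2_imp_integrable:
  assumes "finite_measure M" "f \<in> L2_functions M"
  shows "integrable M f"
  using L2_mult_integrable[OF assms(2), of "\<lambda>_. 1"] L2_bounded[OF assms(1), of "\<lambda>_. 1" 1] by simp

text \<open>
  The infimum over \<open>t\<close> of the right-hand side is the product of the square roots, attained
  at \<open>t = sqrt (B / A)\<close>; adding a small \<open>e\<close> to both \<open>A\<close> and \<open>B\<close> avoids the degenerate cases.
\<close>

lemma le_sqrt_mult_if_weighted:
  assumes "0 \<le> A" "0 \<le> B" "\<And>t::real. 0 < t \<Longrightarrow> x \<le> t * A / 2 + B / (2 * t)"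
  shows "x \<le> sqrt A * sqrt B"
proof (rule tendsto_lowerbound)
  show "((\<lambda>e. sqrt (A + e) * sqrt (B + e)) \<longlongrightarrow> sqrt A * sqrt B) (at_right 0)"
    by (auto intro!: tendsto_eq_intros)
  show "\<forall>\<^sub>F e in at_right 0. x \<le> sqrt (A + e) * sqrt (B + e)"
  proof (rule eventually_at_rightI[of 0 1])
    fix e :: real assume "e \<in> {0<..<1}"
    then have e: "e > 0" by simp
    define a b where "a = sqrt (A + e)" and "b = sqrt (B + e)"
    have ab: "a > 0" "b > 0" "A \<le> a\<^sup>2" "B \<le> b\<^sup>2" using assms e by (auto simp: a_def b_def)
    have "x \<le> (b / a) * A / 2 + B / (2 * (b / a))" using ab by (intro assms) auto
    also have "\<dots> \<le> (b / a) * a\<^sup>2 / 2 + b\<^sup>2 / (2 * (b / a))"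
      using ab by (intro add_mono divide_right_mono mult_left_mono) auto
    also have "\<dots> = a * b" using ab by (simp add: power2_eq_square field_simps)
    finally show "x \<le> sqrt (A + e) * sqrt (B + e)" by (simp add: a_def b_def)
  qed simp
qed simp

lemma L2_Cauchy_Schwarz:
  assumes "f \<in> L2_functions M" "g \<in> L2_functions M"
  shows "norm (LINT z|M. f z * g z) \<le> sqrt (LINT z|M. (norm (f z))\<^sup>2) * sqrt (LINT z|M. (norm (g z))\<^sup>2)"
proof (rule le_sqrt_mult_if_weighted)
  fix t :: real assume t: "0 < t"
  have *: "norm (a * b) \<le> t * (norm a)\<^sup>2 / 2 + (norm b)\<^sup>2 / (2 * t)" for a b :: complex
  proof -
    have "0 \<le> (t * norm a - norm b)\<^sup>2 / (2 * t)" using t by simp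
    also have "\<dots> = t * (norm a)\<^sup>2 / 2 + (norm b)\<^sup>2 / (2 * t) - norm a * norm b"
      using t by (simp add: power2_eq_square field_simps)
    finally show ?thesis by (simp add: norm_mult)
  qed
  have "norm (LINT z|M. f z * g z) \<le> (LINT z|M. t * (norm (f z))\<^sup>2 / 2 + (norm (g z))\<^sup>2 / (2 * t))"
    by (rule Bochner_Integration.integral_norm_bound_integral[OF L2_mult_integrable[OF assms]])
       (use assms * in \<open>simp_all add: L2_integrable\<close>)
  also have "\<dots> = t * (LINT z|M. (norm (f z))\<^sup>2) / 2 + (LINT z|M. (norm (g z))\<^sup>2) / (2 * t)"
    using assms by (simp add: L2_integrable)
  finally show "norm (LINT z|M. f z * g z) \<le> \<dots>" .
qed (auto intro!: integral_nonneg_AE)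

lemma L2_add_norm_le:
  assumes "f \<in> L2_functions M" "g \<in> L2_functions M"
  shows "(LINT z|M. (norm (f z + g z))\<^sup>2) \<le> 2 * (LINT z|M. (norm (f z))\<^sup>2) + 2 * (LINT z|M. (norm (g z))\<^sup>2)"
proof -
  have "(LINT z|M. (norm (f z + g z))\<^sup>2) \<le> (LINT z|M. 2 * (norm (f z))\<^sup>2 + 2 * (norm (g z))\<^sup>2)"
    by (rule integral_mono) (use assms L2_add[OF assms] in \<open>auto intro!: L2_integrable norm_add_square_le\<close>)
  then show ?thesis using assms by (simp add: L2_integrable)
qed

lemma L2_limit_of_approximable:
  fixes f :: "complex \<Rightarrow> complex"
  assumes M: "finite_measure M" "sets M = sets circle_measure"
    and f: "f \<in> L2_functions M" and s: "\<And>i. s i \<in> L2_functions M"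
    and lim: "(\<lambda>i. LINT z|M. (norm (f z - s i z))\<^sup>2) \<longlonglongrightarrow> 0"
    and ap: "\<And>i e. e > 0 \<Longrightarrow> \<exists>p\<in>laurent_polynomials. (LINT z|M. (norm (s i z - p z))\<^sup>2) < e"
    and e: "e > 0"
  shows "\<exists>p\<in>laurent_polynomials. (LINT z|M. (norm (f z - p z))\<^sup>2) < e"
proof -
  have "eventually (\<lambda>i. (LINT z|M. (norm (f z - s i z))\<^sup>2) < e / 4) sequentially"
    using lim e by (intro order_tendstoD) auto
  then obtain i where i: "(LINT z|M. (norm (f z - s i z))\<^sup>2) < e / 4"
    by (meson eventually_sequentially order_refl)
  obtain p where p: "p \<in> laurent_polynomials" "(LINT z|M. (norm (s i z - p z))\<^sup>2) < e / 4"
    using ap[of "e/4" i] e by auto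
  have pL: "p \<in> L2_functions M" by (rule laurent_L2[OF M p(1)])
  have "(LINT z|M. (norm (f z - p z))\<^sup>2) = (LINT z|M. (norm ((f z - s i z) + (s i z - p z)))\<^sup>2)" by simp
  also have "\<dots> \<le> 2 * (LINT z|M. (norm (f z - s i z))\<^sup>2) + 2 * (LINT z|M. (norm (s i z - p z))\<^sup>2)"
    by (intro L2_add_norm_le L2_diff f s pL)
  also have "\<dots> < e" using i p(2) by linarith
  finally show ?thesis using p(1) by blast
qed

text \<open>
  Regularity places the set between a compact \<open>K\<close> and an open \<open>U\<close> of nearly equal measure. A
  bump function between them is close to the indicator in mean square, and a Laurent
  polynomial is uniformly close to the bump function.
\<close>

lemma indicator_approximable:
  assumes M: "finite_measure M" "sets M = sets circle_measure"
    and A: "A \<in> sets M" and e: "e > 0"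
  shows "\<exists>p\<in>laurent_polynomials. (LINT z|M. (norm (indicator A z - p z))\<^sup>2) < e"
proof -
  interpret M: finite_measure M by fact
  let ?D = "distr M borel (\<lambda>z. z)"
  note AB = circle_sets_borel[OF M(2) A]
  have eA: "emeasure M A = emeasure ?D A" using AB by (simp add: emeasure_plane[OF M(2)] inf.absorb1)
  have D: "measure ?D B = measure M (B \<inter> sphere 0 1)" if "B \<in> sets borel" for B
    by (simp add: measure_def emeasure_plane[OF M(2) that])
  have ein: "emeasure M A = (SUP K \<in> {K. K \<subseteq> A \<and> compact K}. emeasure ?D K)"
    unfolding eA by (intro inner_regular plane_finite M AB) auto
  have eout: "emeasure M A = (INF U \<in> {U. A \<subseteq> U \<and> open U}. emeasure ?D U)"
    unfolding eA by (intro outer_regular plane_finite M AB) auto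
  have "\<exists>K. K \<subseteq> A \<and> compact K \<and> measure M A < measure M (K \<inter> sphere 0 1) + e / 16"
  proof (cases "measure M A = 0")
    case True
    then show ?thesis using e by (intro exI[of _ "{}"]) auto
  next
    case False
    define r where "r = max 0 (measure M A - e / 16)"
    have r: "0 \<le> r" "r < measure M A" "measure M A - e / 16 \<le> r"
      using e False measure_nonneg[of M A] by (auto simp: r_def less_le)
    then have "ennreal r < emeasure M A"
      by (simp add: M.emeasure_eq_measure ennreal_less_iff)
    then obtain K where K: "K \<subseteq> A" "compact K" "ennreal r < emeasure ?D K"
      unfolding ein less_SUP_iff by blast
    have KB: "K \<in> sets borel" using K(2) by (simp add: compact_imp_closed)
    have "r < measure M (K \<inter> sphere 0 1)"
      using K(3) r(1) by (simp add: emeasure_plane[OF M(2) KB] M.emeasure_eq_measure ennreal_less_iff)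
    then show ?thesis using K r by (intro exI[of _ K]) auto
  qed
  then obtain K where K: "K \<subseteq> A" "compact K" "measure M A < measure M (K \<inter> sphere 0 1) + e / 16" by blast
  have "emeasure M A < ennreal (measure M A + e / 16)"
    using e by (simp add: M.emeasure_eq_measure ennreal_less_iff)
  then obtain U where U: "A \<subseteq> U" "open U" "emeasure ?D U < ennreal (measure M A + e / 16)"
    unfolding eout INF_less_iff by blast
  have mU: "measure M (U \<inter> sphere 0 1) < measure M A + e / 16"
    using U(3) U(2) by (simp add: emeasure_plane[OF M(2)] M.emeasure_eq_measure ennreal_less_iff)
  obtain h :: "complex \<Rightarrow> real" where h: "continuous_on UNIV h" "\<And>z. 0 \<le> h z" "\<And>z. h z \<le> 1"
    "\<And>z. z \<in> K \<Longrightarrow> h z = 1" "\<And>z. z \<notin> U \<Longrightarrow> h z = 0"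
    using urysohn_bump[OF K(2) U(2)] K(1) U(1) by blast
  have ch: "continuous_on (sphere 0 1) (\<lambda>z. complex_of_real (h z))"
    using h(1) by (intro continuous_intros) (auto intro: continuous_on_subset)
  define m where "m = measure M (space M) + 1"
  \<comment> \<open>The \<open>+ 1\<close> in \<open>m\<close> keeps the division legitimate when the measure is zero.\<close>
  define d where "d = sqrt (e / (8 * m))"
  have m1: "m > 0" by (simp add: m_def add_nonneg_pos)
  have d: "d > 0" using e m1 by (simp add: d_def)
  obtain p where p: "p \<in> laurent_polynomials" "\<And>z. z \<in> sphere 0 1 \<Longrightarrow> norm (complex_of_real (h z) - p z) < d"
    using laurent_uniformly_dense[OF ch d] by blast
  have pL: "p \<in> L2_functions M" by (rule laurent_L2[OF M p(1)])
  have hL: "(\<lambda>z. complex_of_real (h z)) \<in> L2_functions M" by (rule L2_continuous[OF M ch])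
  have iL: "(\<lambda>z. indicator A z) \<in> L2_functions M"
    using A by (intro L2_bounded[OF M(1), where B = 1]) (auto simp: indicator_def)
  have KM: "K \<inter> sphere 0 1 \<in> sets M" and UM: "U \<inter> sphere 0 1 \<in> sets M"
    using U K by (auto simp: M(2) sets_circle sets_restrict_space_iff compact_imp_closed)
  have 1: "(LINT z|M. (norm (indicator A z - complex_of_real (h z)))\<^sup>2) \<le> e / 8"
  proof -
    have "(LINT z|M. (norm (indicator A z - complex_of_real (h z)))\<^sup>2)
        \<le> (LINT z|M. indicator (U \<inter> sphere 0 1 - K \<inter> sphere 0 1) z)"
    proof (rule integral_mono)
      show "integrable M (\<lambda>z. (norm (indicator A z - complex_of_real (h z)))\<^sup>2)"
        by (intro L2_integrable L2_diff iL hL)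
      show "integrable M (indicat_real (U \<inter> sphere 0 1 - K \<inter> sphere 0 1))"
        using UM KM by (intro integrable_real_indicator) (auto simp: less_top[symmetric])
      fix z assume z: "z \<in> space M"
      have "norm (1 - complex_of_real (h z)) = 1 - h z"
        using h(3)[of z] by (metis abs_of_nonneg diff_ge_0_iff_ge norm_of_real of_real_1 of_real_diff)
      moreover have "(1 - h z)\<^sup>2 \<le> 1" "(h z)\<^sup>2 \<le> 1" using h(2,3)[of z] by (auto simp: abs_square_le_1)
      ultimately show "(norm (indicator A z - complex_of_real (h z)))\<^sup>2 \<le> indicator (U \<inter> sphere 0 1 - K \<inter> sphere 0 1) z"
        using z h(4,5)[of z] K(1) U(1) space_eq_circle[OF M(2)] by (auto simp: indicator_def)
    qed
    also have "\<dots> = measure M (U \<inter> sphere 0 1 - K \<inter> sphere 0 1)"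
      using UM KM sets.sets_into_space[of "U \<inter> sphere 0 1 - K \<inter> sphere 0 1" M] by (simp add: inf.absorb1)
    also have "\<dots> = measure M (U \<inter> sphere 0 1) - measure M (K \<inter> sphere 0 1)"
      using UM KM K(1) U(1) by (intro M.finite_measure_Diff) auto
    also have "\<dots> \<le> e / 8" using K(3) mU by linarith
    finally show ?thesis .
  qed
  have 2: "(LINT z|M. (norm (complex_of_real (h z) - p z))\<^sup>2) \<le> e / 8"
  proof -
    have "(LINT z|M. (norm (complex_of_real (h z) - p z))\<^sup>2) \<le> (LINT z|M. d\<^sup>2)"
    proof (rule integral_mono)
      fix z assume "z \<in> space M"
      then show "(norm (complex_of_real (h z) - p z))\<^sup>2 \<le> d\<^sup>2"
        using p(2)[of z] space_eq_circle[OF M(2)] by (intro power_mono) auto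
    qed (auto intro!: L2_integrable L2_diff hL pL)
    also have "\<dots> = measure M (space M) * d\<^sup>2" by simp
    also have "\<dots> \<le> m * d\<^sup>2" by (simp add: m_def distrib_right)
    also have "\<dots> = e / 8" using m1 e by (simp add: d_def)
    finally show ?thesis .
  qed
  have "(LINT z|M. (norm (indicator A z - p z))\<^sup>2)
      = (LINT z|M. (norm ((indicator A z - complex_of_real (h z)) + (complex_of_real (h z) - p z)))\<^sup>2)" by simp
  also have "\<dots> \<le> 2 * (LINT z|M. (norm (indicator A z - complex_of_real (h z)))\<^sup>2)
      + 2 * (LINT z|M. (norm (complex_of_real (h z) - p z))\<^sup>2)"
    by (intro L2_add_norm_le L2_diff iL hL pL)
  also have "\<dots> < e" using 1 2 e by linarith
  finally show ?thesis using p(1) by blast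
qed

lemma simple_function_approximable:
  fixes s :: "complex \<Rightarrow> complex"
  assumes M: "finite_measure M" "sets M = sets circle_measure"
    and s: "simple_function M s" and e: "e > 0"
  shows "\<exists>p\<in>laurent_polynomials. (LINT z|M. (norm (s z - p z))\<^sup>2) < e"
proof -
  interpret M: finite_measure M by fact
  define A where "A y = s -` {y} \<inter> space M" for y
  have A: "A y \<in> sets M" for y unfolding A_def by (rule simple_functionD(2)[OF s])
  have iL: "(\<lambda>z. indicator (A y) z) \<in> L2_functions M" for y
    using A by (intro L2_bounded[OF M(1), where B = 1]) (auto simp: indicator_def)
  have *: "(\<lambda>z. \<Sum>y\<in>Y. y * indicator (A y) z) \<in> L2_functions M \<and>
     (\<forall>e>0. \<exists>p\<in>laurent_polynomials. (LINT z|M. (norm ((\<Sum>y\<in>Y. y * indicator (A y) z) - p z))\<^sup>2) < e)"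
    if "finite Y" for Y :: "complex set"
    using that
  proof induction
    case empty
    have "(\<lambda>z. 0) \<in> L2_functions M" by (intro L2_bounded[OF M(1), where B = 0]) auto
    then show ?case using laurent_const[of 0] by (auto intro!: bexI[of _ "\<lambda>z. 0"])
  next
    case (insert y Y)
    let ?S = "\<lambda>z. \<Sum>y\<in>Y. y * indicator (A y) z"
    have SL: "?S \<in> L2_functions M" using insert by blast
    have yL: "(\<lambda>z. y * indicator (A y) z) \<in> L2_functions M" by (rule L2_cmult[OF iL])
    have "\<exists>p\<in>laurent_polynomials. (LINT z|M. (norm ((y * indicator (A y) z + ?S z) - p z))\<^sup>2) < e"
      if e: "e > 0" for e
    proof -
      obtain p where p: "p \<in> laurent_polynomials" "(LINT z|M. (norm (?S z - p z))\<^sup>2) < e / 4"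
        using insert.IH e by (meson divide_pos_pos zero_less_numeral)
      define c where "c = (norm y)\<^sup>2 + 1"
      have c: "c > 0" by (simp add: c_def add_nonneg_pos)
      obtain q where q: "q \<in> laurent_polynomials" "(LINT z|M. (norm (indicator (A y) z - q z))\<^sup>2) < e / (4 * c)"
        using indicator_approximable[OF M A, of "e / (4 * c)" y] e c by auto
      have pL: "p \<in> L2_functions M" by (rule laurent_L2[OF M p(1)])
      have qL: "q \<in> L2_functions M" by (rule laurent_L2[OF M q(1)])
      have "(LINT z|M. (norm (y * (indicator (A y) z - q z)))\<^sup>2) = (norm y)\<^sup>2 * (LINT z|M. (norm (indicator (A y) z - q z))\<^sup>2)"
        by (simp add: norm_mult power_mult_distrib)
      also have "\<dots> \<le> c * (LINT z|M. (norm (indicator (A y) z - q z))\<^sup>2)"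
        by (intro mult_right_mono) (auto simp: c_def)
      also have "\<dots> < c * (e / (4 * c))" using q(2) c by (intro mult_strict_left_mono) auto
      also have "\<dots> = e / 4" using c by simp
      finally have 1: "(LINT z|M. (norm (y * (indicator (A y) z - q z)))\<^sup>2) < e / 4" .
      have "(LINT z|M. (norm ((y * indicator (A y) z + ?S z) - (y * q z + p z)))\<^sup>2)
          = (LINT z|M. (norm (y * (indicator (A y) z - q z) + (?S z - p z)))\<^sup>2)"
        by (simp add: algebra_simps)
      also have "\<dots> \<le> 2 * (LINT z|M. (norm (y * (indicator (A y) z - q z)))\<^sup>2) + 2 * (LINT z|M. (norm (?S z - p z))\<^sup>2)"
        by (intro L2_add_norm_le L2_diff L2_cmult iL SL pL qL)
      also have "\<dots> < e" using 1 p(2) by linarith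
      finally show ?thesis
        using laurent_add[OF laurent_cmult[OF q(1), of y] p(1)] by (intro bexI)
    qed
    then show ?case unfolding sum.insert[OF insert.hyps]
      by (intro conjI allI impI L2_add[OF yL SL])
  qed
  have eq: "s z = (\<Sum>y\<in>s ` space M. y * indicator (A y) z)" if "z \<in> space M" for z
  proof -
    have "(\<Sum>y\<in>s ` space M. y * indicator (A y) z) = (\<Sum>y\<in>s ` space M. if y = s z then y else 0)"
      using that by (intro sum.cong) (auto simp: A_def indicator_def)
    also have "\<dots> = s z" using that simple_functionD(1)[OF s] by (simp add: sum.delta)
    finally show ?thesis by simp
  qed
  obtain p where p: "p \<in> laurent_polynomials"
      "(LINT z|M. (norm ((\<Sum>y\<in>s ` space M. y * indicator (A y) z) - p z))\<^sup>2) < e"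
    using *[OF simple_functionD(1)[OF s]] e by blast
  have "(LINT z|M. (norm (s z - p z))\<^sup>2) = (LINT z|M. (norm ((\<Sum>y\<in>s ` space M. y * indicator (A y) z) - p z))\<^sup>2)"
  proof (rule Bochner_Integration.integral_cong[OF refl])
    fix z assume "z \<in> space M"
    from arg_cong[where f = "\<lambda>u. (norm (u - p z))\<^sup>2", OF eq[OF this]]
    show "(norm (s z - p z))\<^sup>2 = (norm ((\<Sum>y\<in>s ` space M. y * indicator (A y) z) - p z))\<^sup>2" .
  qed
  then have "(LINT z|M. (norm (s z - p z))\<^sup>2) < e" using p(2) by (rule ord_eq_less_trans)
  then show ?thesis by (rule bexI[OF _ p(1)])
qed

text \<open>
  A square-integrable function is a pointwise limit of simple functions bounded by twice its
  modulus, hence, by dominated convergence, also a limit in mean square.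
\<close>

lemma laurent_L2_dense:
  assumes M: "finite_measure M" "sets M = sets circle_measure"
    and f: "f \<in> L2_functions M" and e: "e > 0"
  shows "\<exists>p\<in>laurent_polynomials. (LINT z|M. (norm (f z - p z))\<^sup>2) < e"
proof -
  interpret M: finite_measure M by fact
  have fm: "f \<in> borel_measurable M" by (rule L2_borel[OF f])
  obtain s where s: "\<And>i. simple_function M (s i)" "\<And>z. z \<in> space M \<Longrightarrow> (\<lambda>i. s i z) \<longlonglongrightarrow> f z"
    "\<And>i z. z \<in> space M \<Longrightarrow> norm (s i z) \<le> 2 * norm (f z)"
    using borel_measurable_implies_sequence_metric[OF fm, of 0] unfolding dist_0_norm dist_norm diff_zero by metis
  have sm: "s i \<in> borel_measurable M" for i by (rule borel_measurable_simple_function[OF s(1)])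
  have sL: "s i \<in> L2_functions M" for i
  proof (rule L2_I[OF sm, where g = "\<lambda>z. 4 * (norm (f z))\<^sup>2"])
    show "integrable M (\<lambda>z. 4 * (norm (f z))\<^sup>2)" using f by (simp add: L2_integrable)
    fix z assume "z \<in> space M"
    then show "(norm (s i z))\<^sup>2 \<le> 4 * (norm (f z))\<^sup>2"
      using power_mono[OF s(3), of z i 2] by (simp add: power_mult_distrib)
  qed
  have lim: "(\<lambda>i. LINT z|M. (norm (f z - s i z))\<^sup>2) \<longlonglongrightarrow> (LINT z|M. 0)"
  proof (rule integral_dominated_convergence[where w = "\<lambda>z. 9 * (norm (f z))\<^sup>2"])
    show "integrable M (\<lambda>z. 9 * (norm (f z))\<^sup>2)" using f by (simp add: L2_integrable)
    show "(\<lambda>z. (norm (f z - s i z))\<^sup>2) \<in> borel_measurable M" for i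
      using fm sm by simp
    show "AE z in M. (\<lambda>i. (norm (f z - s i z))\<^sup>2) \<longlonglongrightarrow> 0"
    proof (rule AE_I2)
      fix z assume "z \<in> space M"
      then have "(\<lambda>i. (norm (f z - s i z))\<^sup>2) \<longlonglongrightarrow> (norm (f z - f z))\<^sup>2"
        by (intro tendsto_intros s)
      then show "(\<lambda>i. (norm (f z - s i z))\<^sup>2) \<longlonglongrightarrow> 0" by simp
    qed
    show "AE z in M. norm ((norm (f z - s i z))\<^sup>2) \<le> 9 * (norm (f z))\<^sup>2" for i
    proof (rule AE_I2)
      fix z assume z: "z \<in> space M"
      have "norm (f z - s i z) \<le> 3 * norm (f z)"
        using norm_triangle_ineq4[of "f z" "s i z"] s(3)[OF z, of i] by linarith
      from power_mono[OF this, of 2] show "norm ((norm (f z - s i z))\<^sup>2) \<le> 9 * (norm (f z))\<^sup>2"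
        by (simp add: power_mult_distrib)
    qed
  qed simp
  show ?thesis
    by (rule L2_limit_of_approximable[OF M f sL _ simple_function_approximable[OF M s(1)] e])
       (use lim in simp)
qed

section \<open>Blaschke factors and self-maps of the disc\<close>

definition blaschke :: "complex \<Rightarrow> complex \<Rightarrow> complex" where
  "blaschke w z = (z - w) / (1 - cnj w * z)"

lemma blaschke_denominator:
  assumes "norm w < 1" "norm z \<le> 1"
  shows "1 - norm w \<le> norm (1 - cnj w * z)" and "1 - cnj w * z \<noteq> 0"
proof -
  have "norm (cnj w * z) \<le> norm w" using assms by (simp add: norm_mult mult_left_le)
  then show *: "1 - norm w \<le> norm (1 - cnj w * z)"
    using norm_triangle_ineq2[of 1 "cnj w * z"] by simp
  show "1 - cnj w * z \<noteq> 0" using * assms(1) by auto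
qed

text \<open>
  This identity contains all the mapping properties of a Blaschke factor: the sign of the
  right-hand side says whether \<open>z\<close> lies inside or on the circle.
\<close>

lemma norm_blaschke:
  assumes "norm w < 1" "norm z \<le> 1"
  shows "1 - (norm (blaschke w z))\<^sup>2 = (1 - (norm w)\<^sup>2) * (1 - (norm z)\<^sup>2) / (norm (1 - cnj w * z))\<^sup>2"
proof -
  have d: "norm (1 - cnj w * z) \<noteq> 0" using blaschke_denominator[OF assms] by simp
  have "complex_of_real ((norm (1 - cnj w * z))\<^sup>2 - (norm (z - w))\<^sup>2) =
        complex_of_real ((1 - (norm w)\<^sup>2) * (1 - (norm z)\<^sup>2))"
    by (simp only: of_real_diff of_real_mult complex_norm_square of_real_1) (simp add: algebra_simps)
  then have "(norm (1 - cnj w * z))\<^sup>2 - (norm (z - w))\<^sup>2 = (1 - (norm w)\<^sup>2) * (1 - (norm z)\<^sup>2)"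
    by (simp only: of_real_eq_iff)
  then show ?thesis
    using d by (simp add: blaschke_def norm_divide power_divide field_simps)
qed

lemma blaschke_ball:
  assumes "norm w < 1" "norm z < 1" shows "norm (blaschke w z) < 1"
proof -
  have "0 < (1 - (norm w)\<^sup>2) * (1 - (norm z)\<^sup>2) / (norm (1 - cnj w * z))\<^sup>2"
    using assms blaschke_denominator(2)[of w z]
    by (intro divide_pos_pos mult_pos_pos) (auto simp: abs_square_less_1)
  then have "(norm (blaschke w z))\<^sup>2 < 1" using norm_blaschke[of w z] assms by simp
  then show ?thesis by (simp add: abs_square_less_1)
qed

lemma blaschke_sphere:
  assumes "norm w < 1" "norm z = 1" shows "norm (blaschke w z) = 1"
proof -
  have "(norm (blaschke w z))\<^sup>2 = 1" using norm_blaschke[of w z] assms by simp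
  then show ?thesis by (simp add: power2_eq_1_iff) (smt (verit) norm_ge_zero)
qed

lemma blaschke_self [simp]: "blaschke w w = 0"
  by (simp add: blaschke_def)

lemma blaschke_continuous: "norm w < 1 \<Longrightarrow> continuous_on (cball 0 1) (blaschke w)"
  unfolding blaschke_def[abs_def] using blaschke_denominator(2)[of w]
  by (intro continuous_intros) auto

lemma blaschke_holomorphic: "norm w < 1 \<Longrightarrow> blaschke w holomorphic_on ball 0 1"
  unfolding blaschke_def[abs_def] using blaschke_denominator(2)[of w]
  by (intro holomorphic_intros) auto

lemma blaschke_inverse:
  assumes "norm w < 1" "norm z \<le> 1"
  shows "blaschke w (blaschke (- w) z) = z"
proof -
  have d: "1 + cnj w * z \<noteq> 0" using blaschke_denominator(2)[of "-w" z] assms by simp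
  have d2: "1 - cnj w * w \<noteq> 0" using blaschke_denominator(2)[of "w" w] assms by simp
  have e: "1 - cnj w * ((z + w) / (1 + cnj w * z)) = (1 - cnj w * w) / (1 + cnj w * z)"
    using d by (simp add: field_simps)
  have e2: "(z + w) / (1 + cnj w * z) - w = z * (1 - cnj w * w) / (1 + cnj w * z)"
    using d by (simp add: field_simps)
  have "blaschke w (blaschke (- w) z) = ((z + w) / (1 + cnj w * z) - w) / (1 - cnj w * ((z + w) / (1 + cnj w * z)))"
    by (simp add: blaschke_def)
  also have "\<dots> = z" unfolding e e2 using d d2 by simp
  finally show ?thesis .
qed

lemma norm_blaschke_le:
  assumes "norm w < 1" "norm z \<le> 1"
  shows "norm (blaschke w z) \<le> (norm z + norm w) / (1 + norm w * norm z)"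
proof (rule power2_le_imp_le)
  let ?a = "norm w" and ?t = "norm z"
  have p: "1 + ?a * ?t > 0" by (simp add: add_pos_nonneg)
  have d: "norm (1 - cnj w * z) > 0" using blaschke_denominator[OF assms] by simp
  have le: "norm (1 - cnj w * z) \<le> 1 + ?a * ?t"
    using norm_triangle_ineq4[of 1 "cnj w * z"] by (simp add: norm_mult)
  have "1 - ((?t + ?a) / (1 + ?a * ?t))\<^sup>2 = (1 - ?a\<^sup>2) * (1 - ?t\<^sup>2) / (1 + ?a * ?t)\<^sup>2"
  proof -
    have "1 - ((?t + ?a) / (1 + ?a * ?t))\<^sup>2 = ((1 + ?a * ?t)\<^sup>2 - (?t + ?a)\<^sup>2) / (1 + ?a * ?t)\<^sup>2"
      using p by (simp add: power_divide diff_divide_distrib)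
    also have "(1 + ?a * ?t)\<^sup>2 - (?t + ?a)\<^sup>2 = (1 - ?a\<^sup>2) * (1 - ?t\<^sup>2)"
      by (simp add: algebra_simps power2_eq_square)
    finally show ?thesis .
  qed
  also have "\<dots> \<le> (1 - ?a\<^sup>2) * (1 - ?t\<^sup>2) / (norm (1 - cnj w * z))\<^sup>2"
    using assms d le p
    by (intro divide_left_mono power_mono mult_nonneg_nonneg mult_pos_pos zero_less_power)
       (auto simp: abs_square_le_1)
  finally show "(norm (blaschke w z))\<^sup>2 \<le> ((?t + ?a) / (1 + ?a * ?t))\<^sup>2"
    using norm_blaschke[OF assms] by linarith
qed auto

lemma norm_blaschke_diff:
  assumes w: "norm w < 1" and x: "norm x \<le> 1" and y: "norm y \<le> 1"
  shows "norm (blaschke w x - blaschke w y) =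
    norm (x - y) * (1 - (norm w)\<^sup>2) / (norm (1 - cnj w * x) * norm (1 - cnj w * y))"
proof -
  have d: "1 - cnj w * x \<noteq> 0" "1 - cnj w * y \<noteq> 0" using blaschke_denominator(2)[OF w] x y by auto
  have p: "0 < 1 - (norm w)\<^sup>2" using w by (simp add: abs_square_less_1)
  have "blaschke w x - blaschke w y =
      ((x - w) * (1 - cnj w * y) - (y - w) * (1 - cnj w * x)) / ((1 - cnj w * x) * (1 - cnj w * y))"
    unfolding blaschke_def using d by (rule diff_frac_eq)
  also have "(x - w) * (1 - cnj w * y) - (y - w) * (1 - cnj w * x) = (x - y) * complex_of_real (1 - (norm w)\<^sup>2)"
    unfolding of_real_diff of_real_1 complex_norm_square by (simp add: algebra_simps)
  finally show ?thesis using p by (simp only: norm_divide norm_mult norm_of_real abs_of_pos)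
qed

text \<open>
  The class of maps with which the proof works: unlike a product of Blaschke factors, these
  properties pass to compositions without computation.
\<close>

definition disc_map :: "(complex \<Rightarrow> complex) \<Rightarrow> bool" where
  "disc_map \<phi> \<longleftrightarrow> continuous_on (cball 0 1) \<phi> \<and> \<phi> holomorphic_on ball 0 1 \<and>
     (\<forall>z. norm z < 1 \<longrightarrow> norm (\<phi> z) < 1) \<and> (\<forall>z. norm z = 1 \<longrightarrow> norm (\<phi> z) = 1)"

lemma disc_mapD:
  assumes "disc_map \<phi>"
  shows "continuous_on (cball 0 1) \<phi>" "\<phi> holomorphic_on ball 0 1"
    "\<And>z. norm z < 1 \<Longrightarrow> norm (\<phi> z) < 1" "\<And>z. norm z = 1 \<Longrightarrow> norm (\<phi> z) = 1"
    "\<And>z. norm z \<le> 1 \<Longrightarrow> norm (\<phi> z) \<le> 1"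
  using assms by (auto simp: disc_map_def le_less)

lemma disc_map_blaschke: "norm w < 1 \<Longrightarrow> disc_map (blaschke w)"
  by (simp add: disc_map_def blaschke_continuous blaschke_holomorphic blaschke_ball blaschke_sphere)

lemma disc_map_id: "disc_map (\<lambda>z. z)"
  by (auto simp: disc_map_def)

lemma disc_map_compose:
  assumes "disc_map f" "disc_map g"
  shows "disc_map (\<lambda>z. g (f z))"
proof -
  have "(g \<circ> f) holomorphic_on ball 0 1"
    by (rule holomorphic_on_compose_gen[OF disc_mapD(2)[OF assms(1)] disc_mapD(2)[OF assms(2)]])
       (use disc_mapD[OF assms(1)] in auto)
  moreover have "continuous_on (cball 0 1) (\<lambda>z. g (f z))"
    by (rule continuous_on_compose2[OF disc_mapD(1)[OF assms(2)] disc_mapD(1)[OF assms(1)]])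
       (use disc_mapD[OF assms(1)] in auto)
  ultimately show ?thesis
    using disc_mapD[OF assms(1)] disc_mapD[OF assms(2)] by (auto simp: disc_map_def o_def)
qed

lemma disc_map_finite_blaschke:
  assumes "finite_blaschke \<phi>"
  shows "disc_map \<phi>"
proof -
  obtain \<psi> q and l :: "nat \<Rightarrow> complex" where q: "1 \<le> q" and l: "\<And>i. i \<in> {1..q} \<Longrightarrow> norm (l i) < 1"
    and \<phi>: "\<And>z. z \<in> cball 0 1 \<Longrightarrow> \<phi> z = cis \<psi> * (\<Prod>i=1..q. (z - l i) / (1 - cnj (l i) * z))"
    using assms unfolding finite_blaschke_def by blast
  let ?B = "\<lambda>z. cis \<psi> * (\<Prod>i=1..q. blaschke (l i) z)"
  have \<phi>B: "\<phi> z = ?B z" if "z \<in> cball 0 1" for z using \<phi>[OF that] by (simp add: blaschke_def)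
  have c: "continuous_on (cball 0 1) ?B"
    by (intro continuous_intros blaschke_continuous l) auto
  have h: "?B holomorphic_on ball 0 1"
    by (intro holomorphic_intros blaschke_holomorphic l) auto
  have n: "norm (?B z) = (\<Prod>i=1..q. norm (blaschke (l i) z))" for z
    by (simp add: norm_mult prod_norm)
  have "norm (?B z) < 1" if "norm z < 1" for z
  proof -
    have "(\<Prod>i=1..q. norm (blaschke (l i) z)) < (\<Prod>i=1..q. 1)"
    proof (rule prod_mono_strict[of 1])
    qed (use q l that blaschke_ball in \<open>auto intro: less_imp_le\<close>)
    then show ?thesis unfolding n by simp
  qed
  moreover have "norm (?B z) = 1" if "norm z = 1" for z
    unfolding n using l that by (intro prod.neutral) (auto intro: blaschke_sphere)
  moreover have "continuous_on (cball 0 1) \<phi>"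
    using c \<phi>B continuous_on_cong[OF refl, of "cball 0 1" \<phi> ?B] by blast
  moreover have "\<phi> holomorphic_on ball 0 1"
    using h by (rule holomorphic_transform) (simp add: \<phi>B)
  ultimately show ?thesis using \<phi>B by (auto simp: disc_map_def)
qed

lemma semigroup_action_simps [simp]:
  "semigroup_action \<phi> [] = (\<lambda>z. z)"
  "semigroup_action \<phi> (j # a) = (\<lambda>z. semigroup_action \<phi> a (\<phi> j z))"
  by (auto simp: semigroup_action_def fun_eq_iff)

lemma disc_map_semigroup_action:
  "(\<And>j. j \<in> set a \<Longrightarrow> disc_map (\<phi> j)) \<Longrightarrow> disc_map (semigroup_action \<phi> a)"
proof (induction a)
  case (Cons j a)
  then show ?case using disc_map_compose[of "\<phi> j" "semigroup_action \<phi> a"] by simp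
qed (simp add: disc_map_id)

lemma semigroup_action_fixes:
  "(\<And>j. j \<in> set a \<Longrightarrow> \<phi> j w = w) \<Longrightarrow> semigroup_action \<phi> a w = w"
  by (induction a) auto

section \<open>Transport of harmonic measures\<close>

lemma disc_map_measurable:
  assumes "disc_map \<phi>" "sets M = sets circle_measure"
  shows "\<phi> \<in> measurable M circle_measure"
proof -
  have "continuous_on (sphere 0 1) \<phi>"
    by (rule continuous_on_subset[OF disc_mapD(1)[OF assms(1)]]) auto
  then have "\<phi> \<in> borel_measurable M" by (rule borel_measurable_on_circle[OF assms(2)])
  then have "\<phi> \<in> measurable M (restrict_space borel (sphere 0 1))"
    using disc_mapD(4)[OF assms(1)] space_eq_circle[OF assms(2)] by (intro measurable_restrict_space2) auto
  then show ?thesis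
    using measurable_cong_sets[OF refl sets_circle] by blast
qed

text \<open>
  Powers of \<open>\<phi>\<close> are holomorphic, and negative powers are conjugates of positive ones on the
  circle. The value depends only on \<open>\<phi> z\<close>, which identifies the image of the harmonic measure.
\<close>

lemma integral_powi_disc_map:
  assumes \<phi>: "disc_map \<phi>" and z: "norm z < 1"
  shows "(LINT \<eta>|harmonic_measure z. \<phi> \<eta> powi k) = (if 0 \<le> k then \<phi> z ^ nat k else cnj (\<phi> z ^ nat (- k)))"
proof -
  have pos: "(LINT \<eta>|harmonic_measure z. \<phi> \<eta> ^ n) = \<phi> z ^ n" for n
    by (rule poisson_integral_holomorphic[OF _ _ z])
       (intro continuous_intros holomorphic_intros disc_mapD[OF \<phi>])+
  show ?thesis
  proof (cases "0 \<le> k")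
    case True
    then show ?thesis using pos by (simp add: power_int_def)
  next
    case False
    have "(LINT \<eta>|harmonic_measure z. \<phi> \<eta> powi k) = (LINT \<eta>|harmonic_measure z. cnj (\<phi> \<eta> ^ nat (- k)))"
    proof (rule Bochner_Integration.integral_cong[OF refl])
      fix \<eta> assume "\<eta> \<in> space (harmonic_measure z)"
      then have "\<phi> \<eta> \<in> sphere 0 1" using disc_mapD(4)[OF \<phi>] by (simp add: space_harmonic)
      from cnj_powi_circle[OF this, of "- k"] False
      show "\<phi> \<eta> powi k = cnj (\<phi> \<eta> ^ nat (- k))" by (simp add: power_int_def)
    qed
    also have "\<dots> = cnj (\<phi> z ^ nat (- k))"
      unfolding Bochner_Integration.integral_cnj pos ..
    finally show ?thesis using False by simp
  qed
qed

text \<open>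
  Both measures have the Fourier coefficients of the harmonic measure with pole \<open>\<phi> z\<close>. If
  \<open>z\<close> is a fixed point, this is the invariance of its harmonic measure.
\<close>

lemma distr_harmonic_measure:
  assumes \<phi>: "disc_map \<phi>" and z: "norm z < 1"
  shows "distr (harmonic_measure z) circle_measure \<phi> = harmonic_measure (\<phi> z)"
proof (rule measure_eq_if_laurent_integrals_eq)
  have m: "\<phi> \<in> measurable (harmonic_measure z) circle_measure"
    by (rule disc_map_measurable[OF \<phi> sets_harmonic])
  show "finite_measure (distr (harmonic_measure z) circle_measure \<phi>)"
    by (rule finite_measure.finite_measure_distr[OF finite_measure_harmonic[OF z] m])
  show "finite_measure (harmonic_measure (\<phi> z))"
    by (rule finite_measure_harmonic[OF disc_mapD(3)[OF \<phi> z]])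
  show "sets (distr (harmonic_measure z) circle_measure \<phi>) = sets circle_measure" by simp
  show "sets (harmonic_measure (\<phi> z)) = sets circle_measure" by (rule sets_harmonic)
  fix k
  have "(LINT \<eta>|distr (harmonic_measure z) circle_measure \<phi>. \<eta> powi k) = (LINT \<eta>|harmonic_measure z. \<phi> \<eta> powi k)"
    by (rule integral_distr[OF m measurable_circle_continuous[OF continuous_powi]])
  also have "\<dots> = (LINT \<eta>|harmonic_measure (\<phi> z). \<eta> powi k)"
    using integral_powi_disc_map[OF \<phi> z, of k] integral_powi_disc_map[OF disc_map_id disc_mapD(3)[OF \<phi> z], of k] by simp
  finally show "(LINT \<eta>|distr (harmonic_measure z) circle_measure \<phi>. \<eta> powi k) = \<dots>" .
qed

lemma integral_disc_map:
  fixes f :: "complex \<Rightarrow> 'a::{banach, second_countable_topology}"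
  assumes \<phi>: "disc_map \<phi>" and z: "norm z < 1" and f: "f \<in> borel_measurable circle_measure"
  shows "(LINT \<eta>|harmonic_measure z. f (\<phi> \<eta>)) = (LINT \<eta>|harmonic_measure (\<phi> z). f \<eta>)"
  using integral_distr[OF disc_map_measurable[OF \<phi> sets_harmonic] f, of z]
  by (simp add: distr_harmonic_measure[OF \<phi> z])

lemma L2_disc_map:
  assumes \<phi>: "disc_map \<phi>" and w: "norm w < 1" "\<phi> w = w" and f: "f \<in> L2_functions (harmonic_measure w)"
  shows "(\<lambda>z. f (\<phi> z)) \<in> L2_functions (harmonic_measure w)"
    and "(LINT z|harmonic_measure w. (norm (f (\<phi> z)))\<^sup>2) = (LINT z|harmonic_measure w. (norm (f z))\<^sup>2)"
proof -
  have fm: "f \<in> borel_measurable circle_measure" using L2_borel[OF f] by (simp add: measurable_harmonic)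
  have m: "\<phi> \<in> measurable (harmonic_measure w) circle_measure"
    by (rule disc_map_measurable[OF \<phi> sets_harmonic])
  have fm2: "(\<lambda>z. (norm (f z))\<^sup>2) \<in> borel_measurable circle_measure" using fm by measurable
  show "(LINT z|harmonic_measure w. (norm (f (\<phi> z)))\<^sup>2) = (LINT z|harmonic_measure w. (norm (f z))\<^sup>2)"
    using integral_disc_map[OF \<phi> w(1) fm2] w(2) by simp
  have "integrable (distr (harmonic_measure w) circle_measure \<phi>) (\<lambda>z. (norm (f z))\<^sup>2)"
    using L2_integrable[OF f] by (simp add: distr_harmonic_measure[OF \<phi> w(1)] w(2))
  then have "integrable (harmonic_measure w) (\<lambda>z. (norm (f (\<phi> z)))\<^sup>2)"
    by (rule integrable_distr[OF m])
  moreover have "(\<lambda>z. f (\<phi> z)) \<in> borel_measurable (harmonic_measure w)"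
    using m fm by (rule measurable_compose)
  ultimately show "(\<lambda>z. f (\<phi> z)) \<in> L2_functions (harmonic_measure w)"
    by (simp add: L2_functions_def)
qed

section \<open>The Schwarz-Pick lemma at a fixed point\<close>

text \<open>
  Conjugation by the Blaschke factor moves the fixed point to the origin and preserves the
  multiplier.
\<close>

lemma deriv_blaschke_conjugate:
  assumes h: "\<phi> holomorphic_on ball 0 1" and w: "norm w < 1" "\<phi> w = w"
  shows "deriv (\<lambda>y. blaschke w (\<phi> (blaschke (- w) y))) 0 = deriv \<phi> w"
proof -
  have n: "1 - cnj w * w \<noteq> 0" using blaschke_denominator(2)[of w w] w by simp
  have 1: "(blaschke (- w) has_field_derivative (1 - cnj w * w)) (at 0)"
    unfolding blaschke_def[abs_def] by (auto intro!: derivative_eq_intros)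
  have 2: "(blaschke w has_field_derivative (1 / (1 - cnj w * w))) (at w)"
  proof -
    have "((\<lambda>z. (z - w) / (1 - cnj w * z)) has_field_derivative
        ((1 - 0) * (1 - cnj w * w) - (w - w) * (0 - cnj w * 1)) / ((1 - cnj w * w) * (1 - cnj w * w))) (at w)"
      using n by (intro DERIV_divide DERIV_diff DERIV_cmult DERIV_ident DERIV_const)
    then show ?thesis using n by (simp add: blaschke_def[abs_def])
  qed
  have 3: "(\<phi> has_field_derivative deriv \<phi> w) (at w)"
    by (rule holomorphic_derivI[OF h]) (use w in auto)
  have m0: "blaschke (- w) 0 = w" by (simp add: blaschke_def)
  have 4: "((\<phi> \<circ> blaschke (- w)) has_field_derivative deriv \<phi> w * (1 - cnj w * w)) (at 0)"
    by (rule DERIV_chain) (use 1 3 m0 in auto)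
  have "((blaschke w \<circ> (\<phi> \<circ> blaschke (- w))) has_field_derivative
      1 / (1 - cnj w * w) * (deriv \<phi> w * (1 - cnj w * w))) (at 0)"
    by (rule DERIV_chain[OF _ 4]) (use 2 m0 w in auto)
  then show ?thesis using n by (simp add: DERIV_imp_deriv o_def)
qed

text \<open>
  Write \<open>f z = z * g z\<close>. Unless \<open>f\<close> is a rotation, \<open>g\<close> maps the disc into itself with
  \<open>\<bar>g 0\<bar> = \<bar>f' 0\<bar>\<close>, and the Schwarz lemma applied to \<open>g\<close> followed by the Blaschke factor of \<open>g 0\<close>
  bounds \<open>\<bar>g z\<bar>\<close>.
\<close>

lemma schwarz_fixed_origin:
  assumes h: "f holomorphic_on ball 0 1" and f0: "f 0 = 0" and no: "\<And>z. norm z < 1 \<Longrightarrow> norm (f z) < 1"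
    and z: "norm z < 1"
  shows "norm (f z) \<le> norm z * (norm z + norm (deriv f 0)) / (1 + norm (deriv f 0) * norm z)"
proof (cases "z = 0")
  case True
  then show ?thesis using f0 by simp
next
  case z0: False
  define l where "l = norm (deriv f 0)"
  have l: "0 \<le> l" "l \<le> 1" using Schwarz_Lemma(2)[OF h f0 no z] by (auto simp: l_def)
  show ?thesis
  proof (cases "l = 1")
    case True
    then have "norm z * (norm z + l) / (1 + l * norm z) = norm z"
      by (simp add: add.commute add_pos_nonneg less_imp_neq[symmetric] nonzero_eq_divide_eq)
    then show ?thesis using Schwarz_Lemma(1)[OF h f0 no z] by (simp add: l_def)
  next
    case False
    obtain g where g: "g holomorphic_on ball 0 1" "\<And>z. norm z < 1 \<Longrightarrow> f z = z * g z" "deriv f 0 = g 0"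
      by (rule Schwarz3[OF h f0]) blast
    \<comment> \<open>A rotation would have multiplier of modulus \<open>1\<close>, which this case excludes.\<close>
    have rot: False if rotation: "\<exists>\<alpha>. (\<forall>z. norm z < 1 \<longrightarrow> f z = \<alpha> * z) \<and> norm \<alpha> = 1"
    proof -
      obtain \<alpha> where \<alpha>: "\<And>z. norm z < 1 \<Longrightarrow> f z = \<alpha> * z" "norm \<alpha> = 1" using rotation by blast
      have "((\<lambda>z. \<alpha> * z) has_field_derivative \<alpha>) (at 0)" by (auto intro!: derivative_eq_intros)
      then have "(f has_field_derivative \<alpha>) (at 0)"
        by (rule has_field_derivative_transform_within_open[of _ _ _ "ball 0 1"]) (auto simp: \<alpha>)
      then have "l = 1" using \<alpha>(2) DERIV_imp_deriv by (auto simp: l_def)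
      with False show False by simp
    qed
    have gn: "norm (g u) < 1" if u: "norm u < 1" for u
    proof (cases "u = 0")
      case True
      then show ?thesis using False l g(3) by (simp add: l_def)
    next
      case u0: False
      have "norm (f u) \<le> norm u" by (rule Schwarz_Lemma(1)[OF h f0 no u])
      moreover have "norm (f u) \<noteq> norm u"
        using Schwarz_Lemma(3)[OF h f0 no z] u u0 rot by blast
      ultimately have "norm u * norm (g u) < norm u * 1" using g(2)[OF u] by (simp add: norm_mult)
      then show ?thesis using u0 mult_less_cancel_left_pos[of "norm u" "norm (g u)" 1] by simp
    qed
    have g0: "norm (g 0) < 1" using gn by simp
    have hk: "(blaschke (g 0) \<circ> g) holomorphic_on ball 0 1"
      by (rule holomorphic_on_compose_gen[OF g(1) blaschke_holomorphic[OF g0]]) (use gn in auto)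
    have k: "norm ((blaschke (g 0) \<circ> g) z) \<le> norm z"
      by (rule Schwarz_Lemma(1)[OF hk _ _ z]) (use gn g0 blaschke_ball in auto)
    define u where "u = blaschke (g 0) (g z)"
    have u: "norm u \<le> norm z" using k by (simp add: u_def)
    have gz: "g z = blaschke (- g 0) u"
      using blaschke_inverse[of "- g 0" "g z"] g0 gn[OF z] by (simp add: u_def less_imp_le)
    have "norm (g z) \<le> (norm u + l) / (1 + l * norm u)"
      unfolding gz using norm_blaschke_le[of "- g 0" u] g0 u z g(3) by (simp add: l_def)
    also have "\<dots> \<le> (norm z + l) / (1 + l * norm z)"
    proof -
      have p: "1 + l * norm u > 0" "1 + l * norm z > 0" using l by (auto intro: add_pos_nonneg)
      have "(1 - l * l) * norm u \<le> (1 - l * l) * norm z"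
        using u l by (intro mult_left_mono) (auto simp: mult_le_one)
      then have "(norm u + l) * (1 + l * norm z) \<le> (norm z + l) * (1 + l * norm u)"
        by (simp add: algebra_simps)
      then show ?thesis using p by (simp add: divide_le_eq le_divide_eq pos_divide_le_eq field_simps)
    qed
    finally have "norm z * norm (g z) \<le> norm z * ((norm z + l) / (1 + l * norm z))"
      by (intro mult_left_mono) auto
    then show ?thesis by (simp add: g(2)[OF z] norm_mult l_def)
  qed
qed

lemma schwarz_pick_fixed_point:
  assumes \<phi>: "disc_map \<phi>" and w: "norm w < 1" "\<phi> w = w"
  shows "norm (deriv \<phi> w) \<le> 1"
    and "\<And>z. norm z < 1 \<Longrightarrow> norm (blaschke w (\<phi> z)) \<le>
      norm (blaschke w z) * (norm (blaschke w z) + norm (deriv \<phi> w)) / (1 + norm (deriv \<phi> w) * norm (blaschke w z))"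
    and "norm (deriv \<phi> w) = 1 \<Longrightarrow>
      \<exists>c. norm c = 1 \<and> (\<forall>z. norm z < 1 \<longrightarrow> blaschke w (\<phi> z) = c * blaschke w z)"
proof -
  define f where "f = (\<lambda>y. blaschke w (\<phi> (blaschke (- w) y)))"
  have w': "norm (- w) < 1" using w by simp
  have "disc_map f" unfolding f_def
    by (rule disc_map_compose[OF disc_map_compose[OF disc_map_blaschke[OF w'] \<phi>] disc_map_blaschke[OF w(1)]])
  then have h: "f holomorphic_on ball 0 1" and no: "\<And>z. norm z < 1 \<Longrightarrow> norm (f z) < 1"
    by (auto dest: disc_mapD)
  have f0: "f 0 = 0" by (simp add: f_def blaschke_def w(2))
  have d: "deriv f 0 = deriv \<phi> w" unfolding f_def by (rule deriv_blaschke_conjugate[OF disc_mapD(2)[OF \<phi>] w])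
  have fm: "f (blaschke w z) = blaschke w (\<phi> z)" if "norm z < 1" for z
    using blaschke_inverse[of "- w" z] that w by (simp add: f_def less_imp_le)
  show "norm (deriv \<phi> w) \<le> 1" using Schwarz_Lemma(2)[OF h f0 no, of 0] by (simp add: d)
  show "norm (blaschke w (\<phi> z)) \<le>
      norm (blaschke w z) * (norm (blaschke w z) + norm (deriv \<phi> w)) / (1 + norm (deriv \<phi> w) * norm (blaschke w z))"
    if "norm z < 1" for z
    using schwarz_fixed_origin[OF h f0 no blaschke_ball[OF w(1) that]] by (simp add: d fm[OF that])
  show "\<exists>c. norm c = 1 \<and> (\<forall>z. norm z < 1 \<longrightarrow> blaschke w (\<phi> z) = c * blaschke w z)"
    if rotation: "norm (deriv \<phi> w) = 1"
  proof -
    obtain c where "norm c = 1" "\<And>y. norm y < 1 \<Longrightarrow> f y = c * y"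
      using Schwarz_Lemma(3)[OF h f0 no, of 0] rotation d by auto
    then show ?thesis using fm blaschke_ball[OF w(1)] by metis
  qed
qed

section \<open>Harnack inequality and hyperbolic contraction\<close>

lemma norm_one_minus_cnj_circle:
  assumes "norm \<eta> = 1"
  shows "norm (1 - cnj w * \<eta>) = norm (\<eta> - w)"
proof -
  have "\<eta> * cnj \<eta> = 1" using assms by (simp add: complex_norm_square[symmetric])
  then have "1 - cnj w * \<eta> = \<eta> * cnj (\<eta> - w)" by (simp add: algebra_simps)
  then show ?thesis using assms by (simp add: norm_mult del: complex_cnj_diff)
qed

text \<open>
  The density of one harmonic measure with respect to another is the Poisson kernel read in
  the coordinate \<open>blaschke w\<close>, in which \<open>w\<close> is the origin.
\<close>

lemma poisson_ratio:
  assumes z: "norm z < 1" and w: "norm w < 1" and \<eta>: "norm \<eta> = 1"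
  shows "poisson z \<eta> = poisson w \<eta> *
    ((1 - (norm (blaschke w z))\<^sup>2) / (norm (blaschke w \<eta> - blaschke w z))\<^sup>2)"
proof -
  have d: "1 - cnj w * z \<noteq> 0" using blaschke_denominator(2)[OF w] z by auto
  have p: "1 - (norm w)\<^sup>2 > 0" using w by (simp add: abs_square_less_1)
  have "norm (blaschke w \<eta> - blaschke w z) = norm (\<eta> - z) * (1 - (norm w)\<^sup>2) / (norm (\<eta> - w) * norm (1 - cnj w * z))"
    using norm_blaschke_diff[OF w, of \<eta> z] z \<eta> by (simp add: norm_one_minus_cnj_circle[OF \<eta>])
  moreover have "norm (\<eta> - z) > 0" "norm (\<eta> - w) > 0" "norm (1 - cnj w * z) > 0"
    using z w \<eta> d by auto
  moreover have "q / A\<^sup>2 = p / W\<^sup>2 * ((p * q / D\<^sup>2) / (A * p / (W * D))\<^sup>2)"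
    if "0 < A" "0 < W" "0 < D" "0 < p" for A W D p q :: real
    using that by (simp add: field_simps power2_eq_square)
  ultimately show ?thesis
    unfolding norm_blaschke[OF w less_imp_le[OF z]] poisson_def using p by simp
qed

lemma poisson_harnack:
  assumes z: "norm z < 1" and w: "norm w < 1" and \<eta>: "norm \<eta> = 1"
  defines "t \<equiv> norm (blaschke w z)"
  shows "\<bar>poisson z \<eta> - poisson w \<eta>\<bar> \<le> 2 * (t / (1 - t)) * poisson w \<eta>"
proof -
  have t: "0 \<le> t" "t < 1" unfolding t_def using blaschke_ball[OF w z] by auto
  define d where "d = norm (blaschke w \<eta> - blaschke w z)"
  have "norm (blaschke w \<eta>) = 1" using w \<eta> by (rule blaschke_sphere)
  then have d: "1 - t \<le> d" "d \<le> 1 + t" unfolding d_def t_def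
    using norm_triangle_ineq2[of "blaschke w \<eta>" "blaschke w z"] norm_triangle_ineq4[of "blaschke w \<eta>" "blaschke w z"] by auto
  have d0: "d > 0" using d t by simp
  define R where "R = (1 - t\<^sup>2) / d\<^sup>2"
  have "R \<le> (1 - t\<^sup>2) / (1 - t)\<^sup>2" unfolding R_def
    using t d d0 by (intro divide_left_mono power_mono mult_pos_pos) (auto simp: abs_square_le_1)
  also have "(1 - t\<^sup>2) / (1 - t)\<^sup>2 = (1 + t) / (1 - t)"
  proof -
    have "1 - t\<^sup>2 = (1 - t) * (1 + t)" by (simp add: algebra_simps power2_eq_square)
    then show ?thesis using t by (simp add: power2_eq_square)
  qed
  also have "\<dots> = 1 + 2 * (t / (1 - t))" using t by (simp add: field_simps)
  finally have 1: "R \<le> 1 + 2 * (t / (1 - t))" .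
  have "1 - 2 * (t / (1 - t)) \<le> (1 - t\<^sup>2) / (1 + t)\<^sup>2"
  proof -
    have "1 - t\<^sup>2 = (1 - t) * (1 + t)" by (simp add: algebra_simps power2_eq_square)
    then have "(1 - t\<^sup>2) / (1 + t)\<^sup>2 = (1 - t) / (1 + t)" using t by (simp add: power2_eq_square)
    also have "\<dots> = 1 - 2 * (t / (1 + t))" using t by (simp add: field_simps)
    finally have "(1 - t\<^sup>2) / (1 + t)\<^sup>2 = 1 - 2 * (t / (1 + t))" .
    moreover have "t / (1 + t) \<le> t / (1 - t)" using t by (intro divide_left_mono) auto
    ultimately show ?thesis by linarith
  qed
  also have "\<dots> \<le> R" unfolding R_def
    using t d d0 by (intro divide_left_mono power_mono mult_pos_pos zero_less_power) (auto simp: abs_square_le_1)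
  finally have 2: "\<bar>R - 1\<bar> \<le> 2 * (t / (1 - t))" using 1 by linarith
  have P: "poisson w \<eta> > 0" using poisson_pos[OF w] \<eta> by simp
  have "poisson z \<eta> - poisson w \<eta> = poisson w \<eta> * (R - 1)"
    using poisson_ratio[OF z w \<eta>] by (simp add: R_def t_def d_def algebra_simps)
  then have "\<bar>poisson z \<eta> - poisson w \<eta>\<bar> = poisson w \<eta> * \<bar>R - 1\<bar>" using P by (simp add: abs_mult)
  also have "\<dots> \<le> poisson w \<eta> * (2 * (t / (1 - t)))" using P 2 by (intro mult_left_mono) auto
  finally show ?thesis by (simp add: mult.commute)
qed

text \<open>
  The bound is the one that \<open>hyperbolic_contraction_step\<close> contracts, so no separate treatment
  of points near the centre and near the boundary is needed.
\<close>

lemma poisson_integral_near: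
  fixes f :: "complex \<Rightarrow> complex"
  assumes z: "norm z < 1" and w: "norm w < 1"
    and f: "continuous_on (sphere 0 1) f" "\<And>\<eta>. norm \<eta> = 1 \<Longrightarrow> norm (f \<eta>) \<le> A"
  defines "t \<equiv> norm (blaschke w z)"
  shows "norm ((LINT \<eta>|harmonic_measure z. f \<eta>) - (LINT \<eta>|harmonic_measure w. f \<eta>)) \<le> 2 * A * (t / (1 - t))"
proof -
  have fm: "f \<in> borel_measurable circle_measure" by (rule measurable_circle_continuous[OF f(1)])
  have cz: "continuous_on (sphere 0 1) (\<lambda>\<eta>. complex_of_real (poisson z \<eta>) * f \<eta>)"
    and cw: "continuous_on (sphere 0 1) (\<lambda>\<eta>. complex_of_real (poisson w \<eta>) * f \<eta>)"
    by (intro continuous_intros continuous_poisson f z w)+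
  have A: "A \<ge> 0" using f(2)[of 1] norm_ge_zero order_trans by (metis norm_one)
  have "(LINT \<eta>|harmonic_measure z. f \<eta>) - (LINT \<eta>|harmonic_measure w. f \<eta>)
     = (LINT \<eta>|circle_measure. poisson z \<eta> * f \<eta> - poisson w \<eta> * f \<eta>)"
    by (simp add: integral_harmonic[OF z fm] integral_harmonic[OF w fm]
        integrable_circle_continuous[OF cz] integrable_circle_continuous[OF cw])
  also have "norm \<dots> \<le> (LINT \<eta>|circle_measure. 2 * A * (t / (1 - t)) * poisson w \<eta>)"
  proof (rule Bochner_Integration.integral_norm_bound_integral)
    show "integrable circle_measure (\<lambda>\<eta>. poisson z \<eta> * f \<eta> - poisson w \<eta> * f \<eta>)"
      by (intro Bochner_Integration.integrable_diff integrable_circle_continuous cz cw)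
    show "integrable circle_measure (\<lambda>\<eta>. 2 * A * (t / (1 - t)) * poisson w \<eta>)"
      by (intro integrable_circle_continuous continuous_intros continuous_poisson w)
    fix \<eta> assume "\<eta> \<in> space circle_measure"
    then have \<eta>: "norm \<eta> = 1" by (simp add: space_circle)
    have "norm (poisson z \<eta> * f \<eta> - poisson w \<eta> * f \<eta>) = \<bar>poisson z \<eta> - poisson w \<eta>\<bar> * norm (f \<eta>)"
      by (simp only: left_diff_distrib[symmetric] of_real_diff[symmetric] norm_mult norm_of_real)
    also have "\<dots> \<le> (2 * (t / (1 - t)) * poisson w \<eta>) * A"
      unfolding t_def using poisson_harnack[OF z w \<eta>] f(2)[OF \<eta>] by (intro mult_mono) (auto intro: order_trans[OF abs_ge_zero])
    finally show "norm (poisson z \<eta> * f \<eta> - poisson w \<eta> * f \<eta>) \<le> 2 * A * (t / (1 - t)) * poisson w \<eta>"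
      by (simp only: mult_ac)
  qed
  also have "\<dots> = 2 * A * (t / (1 - t))" by (simp add: integral_poisson[OF w])
  finally show ?thesis .
qed

text \<open>
  The function \<open>t / (1 - t)\<close> is comparable to \<open>t\<close> near the fixed point and to the inverse
  boundary distance near the circle. The bound of the Schwarz-Pick lemma multiplies it by exactly
  \<open>(t + l) / (1 + t)\<close>, which increases with \<open>t\<close> to \<open>(1 + l) / 2\<close>.
\<close>

lemma hyperbolic_contraction_step:
  fixes s t l L :: real
  assumes t: "0 \<le> t" "t < 1" and l: "0 \<le> l" "l \<le> L" "L < 1"
    and s: "0 \<le> s" "s \<le> t * (t + l) / (1 + l * t)"
  shows "s < 1" and "s / (1 - s) \<le> (1 + L) / 2 * (t / (1 - t))"
proof -
  have p: "1 + l * t > 0" "1 + L * t > 0" using t l by (auto intro: add_pos_nonneg)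
  define m where "m = t * (t + l) / (1 + l * t)"
  have e: "1 - m = (1 - t) * (1 + t) / (1 + l * t)"
    using p by (simp add: m_def field_simps)
  have m: "m < 1"
  proof -
    have "0 < 1 - m" unfolding e using t p by simp
    then show ?thesis by simp
  qed
  then show "s < 1" using s by (simp add: m_def)
  have "s / (1 - s) \<le> m / (1 - m)"
    using s m by (intro frac_le) (auto simp: m_def)
  also have "\<dots> = (t + l) / (1 + t) * (t / (1 - t))"
    unfolding e using p t by (simp add: m_def mult_ac)
  also have "\<dots> \<le> (1 + L) / 2 * (t / (1 - t))"
  proof (rule mult_right_mono)
    have "(t + l) * 2 \<le> (1 + L) * (1 + t)"
    proof -
      have "0 \<le> (1 - t) * (1 - L)" using t l by simp
      then show ?thesis using l(2) by (simp add: algebra_simps)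
    qed
    then show "(t + l) / (1 + t) \<le> (1 + L) / 2" using t by (simp add: divide_simps)
  qed (use t in auto)
  finally show "s / (1 - s) \<le> (1 + L) / 2 * (t / (1 - t))" .
qed

lemma semigroup_action_contraction:
  assumes \<phi>: "\<And>j. j \<in> set a \<Longrightarrow> disc_map (\<phi> j)" "\<And>j. j \<in> set a \<Longrightarrow> \<phi> j w = w"
    "\<And>j. j \<in> set a \<Longrightarrow> norm (deriv (\<phi> j) w) \<le> L" and L: "0 \<le> L" "L < 1"
    and w: "norm w < 1" and z: "norm z < 1"
  defines "u \<equiv> \<lambda>z. norm (blaschke w z) / (1 - norm (blaschke w z))"
  shows "u (semigroup_action \<phi> a z) \<le> ((1 + L) / 2) ^ length a * u z"
  using \<phi> z
proof (induction a arbitrary: z)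
  case (Cons j a)
  have j: "disc_map (\<phi> j)" "\<phi> j w = w" "norm (deriv (\<phi> j) w) \<le> L" using Cons.prems by auto
  have jz: "norm (\<phi> j z) < 1" by (rule disc_mapD(3)[OF j(1) Cons.prems(4)])
  have "u (semigroup_action \<phi> a (\<phi> j z)) \<le> ((1 + L) / 2) ^ length a * u (\<phi> j z)"
    by (rule Cons.IH) (use Cons.prems jz in auto)
  also have "u (\<phi> j z) \<le> (1 + L) / 2 * u z" unfolding u_def
    by (rule hyperbolic_contraction_step(2)[OF _ _ norm_ge_zero j(3) L(2) norm_ge_zero
          schwarz_pick_fixed_point(2)[OF j(1) w j(2) Cons.prems(4)]])
       (use blaschke_ball[OF w Cons.prems(4)] in auto)
  finally show ?case using L by (simp add: mult_left_mono mult.assoc mult.left_commute)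
qed simp

section \<open>Poisson averages\<close>

text \<open>
  A power below the square is controlled by the second moment; the threshold \<open>d\<close> will
  be the root mean square, up to a constant.
\<close>

lemma powr_le_square_split:
  fixes x d :: real
  assumes "0 \<le> x" "0 < d" "0 < \<alpha>" "\<alpha> \<le> 2"
  shows "x powr \<alpha> \<le> d powr \<alpha> + d powr (\<alpha> - 2) * x\<^sup>2"
proof (cases "x \<le> d")
  case True
  then have "x powr \<alpha> \<le> d powr \<alpha>" using assms by (intro powr_mono2) auto
  moreover have "0 \<le> d powr (\<alpha> - 2) * x\<^sup>2" by simp
  ultimately show ?thesis by linarith
next
  case False
  have x: "x > 0" using False assms by simp
  have "x powr 2 = x\<^sup>2" using x by simp
  moreover have "x powr \<alpha> = x powr (\<alpha> - 2) * x powr 2" by (simp add: powr_add[symmetric])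
  ultimately have "x powr \<alpha> = x powr (\<alpha> - 2) * x\<^sup>2" by (simp only:)
  also have "\<dots> \<le> d powr (\<alpha> - 2) * x\<^sup>2"
    using False assms by (intro mult_right_mono powr_mono2') auto
  finally show ?thesis by (simp add: add_increasing)
qed

text \<open>
  On the circle the integrand \<open>\<bar>\<eta> - \<zeta>\<bar>\<^sup>2\<close> agrees with \<open>2 - 2 Re (\<eta> * cnj \<zeta>)\<close>, which is harmonic in
  \<open>\<eta>\<close>; its Poisson integral is the value of this harmonic function at \<open>r * \<zeta>\<close>.
\<close>

lemma poisson_second_moment:
  fixes \<zeta> :: complex and r :: real
  assumes r: "0 \<le> r" "r < 1" and \<zeta>: "norm \<zeta> = 1"
  shows "(LINT \<eta>|circle_measure. poisson (r * \<zeta>) \<eta> * (norm (\<eta> - \<zeta>))\<^sup>2) = 2 * (1 - r)"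
proof -
  have w: "norm (complex_of_real r * \<zeta>) < 1" using r \<zeta> by (simp add: norm_mult)
  have sq: "(norm (\<eta> - \<zeta>))\<^sup>2 = 2 - 2 * Re (\<eta> * cnj \<zeta>)" if "norm \<eta> = 1" for \<eta>
  proof -
    have "(norm (\<eta> - \<zeta>))\<^sup>2 = (norm \<eta>)\<^sup>2 + (norm \<zeta>)\<^sup>2 - 2 * Re (\<eta> * cnj \<zeta>)"
      unfolding cmod_power2 by (simp add: power2_eq_square algebra_simps)
    then show ?thesis using that \<zeta> by simp
  qed
  have i: "integrable circle_measure (\<lambda>\<eta>. poisson (r * \<zeta>) \<eta>)"
    and i2: "integrable circle_measure (\<lambda>\<eta>. complex_of_real (poisson (r * \<zeta>) \<eta>) * (\<eta> * cnj \<zeta>))"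
    by (intro integrable_circle_continuous continuous_intros continuous_poisson w)+
  have "(LINT \<eta>|circle_measure. poisson (r * \<zeta>) \<eta> * (norm (\<eta> - \<zeta>))\<^sup>2)
     = (LINT \<eta>|circle_measure. 2 * poisson (r * \<zeta>) \<eta> - 2 * Re (complex_of_real (poisson (r * \<zeta>) \<eta>) * (\<eta> * cnj \<zeta>)))"
    by (rule Bochner_Integration.integral_cong) (simp_all add: space_circle sq algebra_simps)
  also have "\<dots> = 2 - 2 * Re (LINT \<eta>|circle_measure. complex_of_real (poisson (r * \<zeta>) \<eta>) * (\<eta> * cnj \<zeta>))"
    using i integrable_Re[OF i2] integral_Re[OF i2] by (simp add: integral_poisson[OF w])
  also have "(LINT \<eta>|circle_measure. complex_of_real (poisson (r * \<zeta>) \<eta>) * (\<eta> * cnj \<zeta>))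
      = (LINT \<eta>|harmonic_measure (r * \<zeta>). \<eta> * cnj \<zeta>)"
    by (rule integral_harmonic[symmetric, OF w measurable_circle_continuous]) (intro continuous_intros)
  also have "\<dots> = (r * \<zeta>) * cnj \<zeta>"
    by (rule poisson_integral_holomorphic[OF _ _ w]) (intro continuous_intros holomorphic_intros)+
  also have "\<dots> = r" using \<zeta> by (simp add: mult.assoc complex_norm_square[symmetric])
  finally show ?thesis by simp
qed

text \<open>
  The harmonic measure with pole \<open>r * \<zeta>\<close> concentrates at \<open>\<zeta>\<close> with mean square distance \<open>2 * (1 - r)\<close>,
  and this second moment controls the Hoelder modulus.
\<close>

lemma poisson_smoothing_error:
  fixes G :: "complex \<Rightarrow> complex" and \<zeta> :: complex and r :: real
  assumes r: "0 \<le> r" "r < 1" and \<zeta>: "norm \<zeta> = 1" and \<alpha>: "0 < \<alpha>" "\<alpha> \<le> 2" and L: "0 \<le> L"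
    and G: "continuous_on (sphere 0 1) G"
      "\<And>\<eta>. norm \<eta> = 1 \<Longrightarrow> norm (G \<eta> - G \<zeta>) \<le> L * norm (\<eta> - \<zeta>) powr \<alpha>"
  shows "norm ((LINT \<eta>|harmonic_measure (r * \<zeta>). G \<eta>) - G \<zeta>) \<le> 3 * L * (1 - r) powr (\<alpha> / 2)"
proof -
  have w: "norm (complex_of_real r * \<zeta>) < 1" using r \<zeta> by (simp add: norm_mult)
  let ?P = "poisson (r * \<zeta>)"
  \<comment> \<open>The root mean square distance from \<open>\<zeta>\<close>, up to a constant factor.\<close>
  define d where "d = sqrt (1 - r)"
  have d: "d > 0" "d\<^sup>2 = 1 - r" using r by (auto simp: d_def)
  have iG: "integrable circle_measure (\<lambda>\<eta>. ?P \<eta> * G \<eta>)"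
    and iP: "integrable circle_measure (\<lambda>\<eta>. ?P \<eta>)"
    and iz: "integrable circle_measure (\<lambda>\<eta>. ?P \<eta> * G \<zeta>)"
    and i2: "integrable circle_measure (\<lambda>\<eta>. ?P \<eta> * (norm (\<eta> - \<zeta>))\<^sup>2)"
    by (intro integrable_circle_continuous continuous_intros continuous_poisson w G)+
  have "(LINT \<eta>|circle_measure. complex_of_real (?P \<eta>)) = 1"
    by (simp add: integral_poisson[OF w])
  then have "(LINT \<eta>|harmonic_measure (r * \<zeta>). G \<eta>) - G \<zeta> = (LINT \<eta>|circle_measure. ?P \<eta> * G \<eta> - ?P \<eta> * G \<zeta>)"
    using iG iz by (simp add: integral_harmonic[OF w measurable_circle_continuous[OF G(1)]] del: integral_complex_of_real)
  also have "norm \<dots> \<le> (LINT \<eta>|circle_measure. L * (d powr \<alpha> * ?P \<eta> + d powr (\<alpha> - 2) * (?P \<eta> * (norm (\<eta> - \<zeta>))\<^sup>2)))"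
  proof (rule Bochner_Integration.integral_norm_bound_integral)
    show "integrable circle_measure (\<lambda>\<eta>. ?P \<eta> * G \<eta> - ?P \<eta> * G \<zeta>)"
      by (rule Bochner_Integration.integrable_diff[OF iG iz])
    show "integrable circle_measure (\<lambda>\<eta>. L * (d powr \<alpha> * ?P \<eta> + d powr (\<alpha> - 2) * (?P \<eta> * (norm (\<eta> - \<zeta>))\<^sup>2)))"
      by (intro integrable_mult_right Bochner_Integration.integrable_add iP i2)
    fix \<eta> assume "\<eta> \<in> space circle_measure"
    then have \<eta>: "norm \<eta> = 1" by (simp add: space_circle)
    have P: "?P \<eta> > 0" using poisson_pos[OF w] \<eta> by simp
    have "norm (?P \<eta> * G \<eta> - ?P \<eta> * G \<zeta>) = ?P \<eta> * norm (G \<eta> - G \<zeta>)"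
      using P by (simp only: right_diff_distrib[symmetric] norm_mult norm_of_real abs_of_pos)
    also have "\<dots> \<le> ?P \<eta> * (L * (d powr \<alpha> + d powr (\<alpha> - 2) * (norm (\<eta> - \<zeta>))\<^sup>2))"
      using P L G(2)[OF \<eta>] powr_le_square_split[of "norm (\<eta> - \<zeta>)" d \<alpha>] d \<alpha>
      by (intro mult_left_mono order_trans[OF G(2)[OF \<eta>]]) auto
    finally show "norm (?P \<eta> * G \<eta> - ?P \<eta> * G \<zeta>) \<le> L * (d powr \<alpha> * ?P \<eta> + d powr (\<alpha> - 2) * (?P \<eta> * (norm (\<eta> - \<zeta>))\<^sup>2))"
      by (simp add: algebra_simps)
  qed
  also have "\<dots> = L * (d powr \<alpha> + d powr (\<alpha> - 2) * (2 * (1 - r)))"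
    using iP i2 by (simp add: integral_poisson[OF w] poisson_second_moment[OF r \<zeta>])
  also have "d powr (\<alpha> - 2) * (2 * (1 - r)) = 2 * d powr \<alpha>"
  proof -
    have "d powr (\<alpha> - 2) * d\<^sup>2 = d powr (\<alpha> - 2) * d powr 2" using d by simp
    also have "\<dots> = d powr \<alpha>" by (simp add: powr_add[symmetric])
    finally have "d powr (\<alpha> - 2) * (1 - r) = d powr \<alpha>" by (simp only: d(2))
    then show ?thesis by (simp only: mult.left_commute[of "d powr (\<alpha> - 2)" 2])
  qed
  also have "d powr \<alpha> = (1 - r) powr (\<alpha> / 2)"
    using r by (simp add: d_def powr_half_sqrt[symmetric] powr_powr)
  finally show ?thesis by simp
qed

text \<open>
  Because \<open>\<bar>\<eta> - r * \<zeta>\<bar> = \<bar>\<zeta> - r * \<eta>\<bar>\<close> on the circle.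
\<close>

lemma poisson_symmetric:
  assumes "norm \<zeta> = 1" "norm \<eta> = 1"
  shows "poisson (complex_of_real r * \<zeta>) \<eta> = poisson (complex_of_real r * \<eta>) \<zeta>"
proof -
  have "(norm (\<eta> - r * \<zeta>))\<^sup>2 = (norm (\<zeta> - r * \<eta>))\<^sup>2"
  proof -
    have "complex_of_real ((norm (\<eta> - r * \<zeta>))\<^sup>2) = complex_of_real ((norm (\<zeta> - r * \<eta>))\<^sup>2)"
    proof -
      have "\<eta> * cnj \<eta> = 1" "\<zeta> * cnj \<zeta> = 1" using assms by (auto simp: complex_norm_square[symmetric])
      then show ?thesis unfolding complex_norm_square by (simp add: algebra_simps)
    qed
    then show ?thesis by (simp only: of_real_eq_iff)
  qed
  then show ?thesis using assms by (simp add: poisson_def norm_mult)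
qed

text \<open>
  By Fubini and symmetry of the kernel an average over radius \<open>r\<close> can be moved from one factor
  to the other, which is how a correlation on the circle becomes an integral over the interior
  circle of radius \<open>r\<close>.
\<close>

lemma poisson_smoothing_selfadjoint:
  fixes h G :: "complex \<Rightarrow> complex" and r :: real
  assumes r: "0 \<le> r" "r < 1" and h: "continuous_on (sphere 0 1) h" and G: "continuous_on (sphere 0 1) G"
  shows "(LINT (\<zeta>::complex)|circle_measure. h \<zeta> * (LINT \<eta>|harmonic_measure (r * \<zeta>). G \<eta>))
       = (LINT \<eta>|circle_measure. G \<eta> * (LINT \<zeta>|harmonic_measure (r * \<eta>). h \<zeta>))"
    and "(\<lambda>\<zeta>. LINT \<eta>|harmonic_measure (r * \<zeta>). G \<eta>) \<in> borel_measurable circle_measure"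
proof -
  interpret P: pair_sigma_finite circle_measure circle_measure
    by (simp add: pair_sigma_finite_def circle.sigma_finite_measure_axioms)
  have w: "norm (complex_of_real r * \<zeta>) < 1" if "norm \<zeta> = 1" for \<zeta> :: complex using r that by (simp add: norm_mult)
  let ?K = "\<lambda>(\<zeta>::complex) \<eta>. complex_of_real (poisson (r * \<zeta>) \<eta>) * G \<eta>"
  let ?F = "\<lambda>(\<zeta>::complex) (\<eta>::complex). h \<zeta> * (poisson (r * \<zeta>) \<eta> * G \<eta>)"
  have hm [measurable]: "h \<in> borel_measurable circle_measure" and Gm [measurable]: "G \<in> borel_measurable circle_measure"
    by (intro measurable_circle_continuous h G)+
  have idm [measurable]: "(\<lambda>z. z) \<in> borel_measurable circle_measure"
    by (intro measurable_circle_continuous continuous_intros)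
  have fs [measurable]: "fst \<in> borel_measurable (circle_measure \<Otimes>\<^sub>M circle_measure)"
    using measurable_compose[OF measurable_fst idm] by simp
  have sn [measurable]: "snd \<in> borel_measurable (circle_measure \<Otimes>\<^sub>M circle_measure)"
    using measurable_compose[OF measurable_snd idm] by simp
  have Pm [measurable]: "(\<lambda>x. poisson (r * fst x) (snd x)) \<in> borel_measurable (circle_measure \<Otimes>\<^sub>M circle_measure)"
    unfolding poisson_def by measurable
  have Km: "(\<lambda>(\<zeta>, \<eta>). ?K \<zeta> \<eta>) \<in> borel_measurable (circle_measure \<Otimes>\<^sub>M circle_measure)"
    unfolding case_prod_unfold by measurable
  have Km1: "(\<lambda>\<zeta>. LINT \<eta>|circle_measure. ?K \<zeta> \<eta>) \<in> borel_measurable circle_measure"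
    by (rule circle.borel_measurable_lebesgue_integral[OF Km])
  have eqK: "(LINT \<eta>|circle_measure. ?K \<zeta> \<eta>) = (LINT \<eta>|harmonic_measure (r * \<zeta>). G \<eta>)" if "\<zeta> \<in> space circle_measure" for \<zeta> :: complex
    by (rule integral_harmonic[OF w Gm, symmetric]) (use that in \<open>simp add: space_circle\<close>)
  show "(\<lambda>\<zeta>. LINT \<eta>|harmonic_measure (r * \<zeta>). G \<eta>) \<in> borel_measurable circle_measure"
    by (rule iffD1[OF measurable_cong[OF eqK] Km1])
  have Fm: "(\<lambda>(\<zeta>, \<eta>). ?F \<zeta> \<eta>) \<in> borel_measurable (circle_measure \<Otimes>\<^sub>M circle_measure)"
    unfolding case_prod_unfold by measurable
  obtain A where A: "\<And>z. norm z = 1 \<Longrightarrow> norm (h z) \<le> A" using continuous_circle_bounded[OF h] by blast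
  obtain B where B: "\<And>z. norm z = 1 \<Longrightarrow> norm (G z) \<le> B" using continuous_circle_bounded[OF G] by blast
  have Pb: "0 \<le> poisson (r * \<zeta>) \<eta> \<and> poisson (r * \<zeta>) \<eta> \<le> 1 / (1 - r)\<^sup>2" if "norm \<zeta> = 1" "norm \<eta> = 1" for \<zeta> \<eta> :: complex
  proof
    show "0 \<le> poisson (r * \<zeta>) \<eta>" using poisson_pos[OF w[OF that(1)]] that(2) by (simp add: less_imp_le)
    have "1 - r \<le> norm (\<eta> - r * \<zeta>)" using norm_triangle_ineq2[of \<eta> "r * \<zeta>"] that r by (simp add: norm_mult)
    then have "(1 - r)\<^sup>2 \<le> (norm (\<eta> - r * \<zeta>))\<^sup>2" using r by (intro power_mono) auto
    then show "poisson (r * \<zeta>) \<eta> \<le> 1 / (1 - r)\<^sup>2"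
      unfolding poisson_def using r that by (intro frac_le) (auto simp: norm_mult)
  qed
  interpret PF: finite_measure "circle_measure \<Otimes>\<^sub>M circle_measure"
    by (rule finite_measure_pair_measure) (rule circle.finite_measure_axioms)+
  have "integrable (circle_measure \<Otimes>\<^sub>M circle_measure) (\<lambda>(\<zeta>, \<eta>). ?F \<zeta> \<eta>)"
  proof (rule PF.integrable_const_bound[where B = "A * (1 / (1 - r)\<^sup>2 * B)", OF _ Fm], rule AE_I2)
    fix x assume "x \<in> space (circle_measure \<Otimes>\<^sub>M circle_measure)"
    then obtain \<zeta> \<eta> where x: "x = (\<zeta>, \<eta>)" "norm \<zeta> = 1" "norm \<eta> = 1"
      by (auto simp: space_pair_measure space_circle)
    have "norm (?F \<zeta> \<eta>) = norm (h \<zeta>) * (poisson (r * \<zeta>) \<eta> * norm (G \<eta>))"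
      using Pb[OF x(2,3)] by (simp add: norm_mult)
    also have "\<dots> \<le> A * (1 / (1 - r)\<^sup>2 * B)"
      using A[OF x(2)] B[OF x(3)] Pb[OF x(2,3)] by (intro mult_mono) (auto intro: order_trans[OF norm_ge_zero])
    finally show "norm (case x of (\<zeta>, \<eta>) \<Rightarrow> ?F \<zeta> \<eta>) \<le> A * (1 / (1 - r)\<^sup>2 * B)" by (simp add: x)
  qed
  then have fub: "(LINT \<eta>|circle_measure. LINT \<zeta>|circle_measure. ?F \<zeta> \<eta>) = (LINT \<zeta>|circle_measure. LINT \<eta>|circle_measure. ?F \<zeta> \<eta>)"
    by (rule P.Fubini_integral)
  have "(LINT (\<zeta>::complex)|circle_measure. h \<zeta> * (LINT \<eta>|harmonic_measure (r * \<zeta>). G \<eta>)) = (LINT \<zeta>|circle_measure. LINT \<eta>|circle_measure. ?F \<zeta> \<eta>)"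
    by (rule Bochner_Integration.integral_cong[OF refl]) (simp add: eqK[symmetric])
  also note fub[symmetric]
  also have "(LINT \<eta>|circle_measure. LINT \<zeta>|circle_measure. ?F \<zeta> \<eta>) = (LINT \<eta>|circle_measure. G \<eta> * (LINT \<zeta>|harmonic_measure (r * \<eta>). h \<zeta>))"
  proof (rule Bochner_Integration.integral_cong[OF refl])
    fix \<eta> assume "\<eta> \<in> space circle_measure"
    then have \<eta>: "norm \<eta> = 1" by (simp add: space_circle)
    have "(LINT \<zeta>|circle_measure. ?F \<zeta> \<eta>) = (LINT \<zeta>|circle_measure. G \<eta> * (poisson (r * \<eta>) \<zeta> * h \<zeta>))"
    proof (rule Bochner_Integration.integral_cong[OF refl])
      fix \<zeta> assume "\<zeta> \<in> space circle_measure"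
      then have "poisson (r * \<zeta>) \<eta> = poisson (r * \<eta>) \<zeta>"
        using \<eta> by (intro poisson_symmetric) (simp_all add: space_circle)
      then show "?F \<zeta> \<eta> = G \<eta> * (poisson (r * \<eta>) \<zeta> * h \<zeta>)" by (simp only: mult_ac)
    qed
    also have "\<dots> = G \<eta> * (LINT \<zeta>|harmonic_measure (r * \<eta>). h \<zeta>)"
      by (simp add: integral_harmonic[OF w[OF \<eta>] hm])
    finally show "(LINT \<zeta>|circle_measure. ?F \<zeta> \<eta>) = \<dots>" .
  qed
  finally show "(LINT (\<zeta>::complex)|circle_measure. h \<zeta> * (LINT \<eta>|harmonic_measure (r * \<zeta>). G \<eta>))
       = (LINT \<eta>|circle_measure. G \<eta> * (LINT \<zeta>|harmonic_measure (r * \<eta>). h \<zeta>))" .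
qed

section \<open>Correlations of Hoelder functions\<close>

lemma holder_continuous:
  fixes g :: "complex \<Rightarrow> complex"
  assumes "\<And>x y. x \<in> S \<Longrightarrow> y \<in> S \<Longrightarrow> norm (g x - g y) \<le> L * dist x y powr \<alpha>" "0 < \<alpha>"
  shows "continuous_on S g"
  unfolding continuous_on_def
proof
  fix x assume x: "x \<in> S"
  have "((\<lambda>y. L * dist y x powr \<alpha>) \<longlongrightarrow> L * dist x x powr \<alpha>) (at x within S)"
    using assms(2) by (intro tendsto_intros tendsto_powr') auto
  then have "((\<lambda>y. L * dist y x powr \<alpha>) \<longlongrightarrow> 0) (at x within S)" using assms(2) by simp
  moreover have "\<forall>\<^sub>F y in at x within S. norm (g y - g x) \<le> L * dist y x powr \<alpha>"
    using assms(1)[OF _ x] by (auto simp: eventually_at_filter)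
  ultimately have "((\<lambda>y. g y - g x) \<longlongrightarrow> 0) (at x within S)"
    by (rule Lim_null_comparison[rotated])
  then show "(g \<longlongrightarrow> g x) (at x within S)" by (rule Lim_null[THEN iffD2])
qed

lemma poisson_bounds:
  fixes x y w :: complex
  assumes w: "norm w < 1" and x: "norm x = 1" and y: "norm y = 1"
  shows "poisson w x \<le> 1 / (1 - norm w)\<^sup>2"
    and "\<bar>poisson w x - poisson w y\<bar> \<le> 4 / (1 - norm w) ^ 4 * norm (x - y)"
proof -
  define e where "e = 1 - norm w"
  have e: "0 < e" using w by (simp add: e_def)
  have p: "0 < 1 - (norm w)\<^sup>2" "1 - (norm w)\<^sup>2 \<le> 1" using w by (auto simp: abs_square_less_1)
  have d: "e \<le> norm (u - w)" "norm (u - w) \<le> 2" if "norm u = 1" for u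
    using norm_triangle_ineq2[of u w] norm_triangle_ineq4[of u w] that w by (auto simp: e_def)
  have "e\<^sup>2 \<le> (norm (x - w))\<^sup>2" using d[OF x] e by (intro power_mono) auto
  then show "poisson w x \<le> 1 / (1 - norm w)\<^sup>2"
    unfolding poisson_def e_def[symmetric] using e p by (intro frac_le) auto
  define a b where "a = norm (x - w)" and "b = norm (y - w)"
  have a: "e \<le> a" "a \<le> 2" and b: "e \<le> b" "b \<le> 2" using d[OF x] d[OF y] by (auto simp: a_def b_def)
  have ab: "\<bar>b - a\<bar> \<le> norm (x - y)"
    using norm_triangle_ineq3[of "y - w" "x - w"] by (simp add: a_def b_def norm_minus_commute)
  have pos: "0 < a" "0 < b" using a b e by auto
  have "poisson w x - poisson w y = (1 - (norm w)\<^sup>2) * ((b - a) * (a + b) / (a\<^sup>2 * b\<^sup>2))"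
    unfolding poisson_def a_def[symmetric] b_def[symmetric] using pos
    by (simp add: field_simps power2_eq_square)
  then have "\<bar>poisson w x - poisson w y\<bar> = (1 - (norm w)\<^sup>2) * (\<bar>b - a\<bar> * (a + b) / (a\<^sup>2 * b\<^sup>2))"
    using p pos by (simp add: abs_mult)
  also have "\<dots> \<le> 1 * (norm (x - y) * 4 / (e\<^sup>2 * e\<^sup>2))"
    using p pos a b ab e by (intro mult_mono frac_le power_mono mult_pos_pos mult_nonneg_nonneg divide_nonneg_nonneg) auto
  also have "\<dots> = 4 / (1 - norm w) ^ 4 * norm (x - y)"
    by (simp add: e_def power_mult[symmetric] power_add[symmetric])
  finally show "\<bar>poisson w x - poisson w y\<bar> \<le> 4 / (1 - norm w) ^ 4 * norm (x - y)" .
qed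

lemma norm_le_holder_on_circle:
  fixes x y :: complex
  assumes "norm x = 1" "norm y = 1" "0 < \<alpha>" "\<alpha> \<le> 1"
  shows "norm (x - y) \<le> 2 * norm (x - y) powr \<alpha>"
proof (cases "x = y")
  case False
  have 2: "norm (x - y) \<le> 2" using norm_triangle_ineq4[of x y] assms by simp
  have "norm (x - y) = norm (x - y) powr (1 - \<alpha>) * norm (x - y) powr \<alpha>"
    using False by (simp add: powr_add[symmetric])
  also have "norm (x - y) powr (1 - \<alpha>) \<le> 2 powr (1 - \<alpha>)" using 2 assms by (intro powr_mono2) auto
  also have "2 powr (1 - \<alpha>) \<le> 2 powr 1" using assms by (intro powr_mono) auto
  finally show ?thesis by (simp add: mult_right_mono)
qed simp

lemma blaschke_radial_bound:
  assumes w: "norm w < 1" and r: "0 \<le> r" "r < 1" and z: "norm z = r"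
  shows "norm (blaschke w z) / (1 - norm (blaschke w z)) \<le> 8 / ((1 - (norm w)\<^sup>2) * (1 - r))"
proof -
  define t where "t = norm (blaschke w z)"
  have z1: "norm z < 1" using z r by simp
  have t: "0 \<le> t" "t < 1" unfolding t_def using blaschke_ball[OF w z1] by auto
  have p: "0 < 1 - (norm w)\<^sup>2" using w by (simp add: abs_square_less_1)
  have d: "norm (1 - cnj w * z) \<le> 2"
  proof -
    have "norm (cnj w * z) \<le> 1 * 1" unfolding norm_mult using w z1 by (intro mult_mono) auto
    then show ?thesis using norm_triangle_ineq4[of 1 "cnj w * z"] by simp
  qed
  have d0: "norm (1 - cnj w * z) > 0" using blaschke_denominator(2)[OF w, of z] z1 by simp
  have "(norm (1 - cnj w * z))\<^sup>2 \<le> 2\<^sup>2" using d by (intro power_mono) auto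
  then have d4: "(norm (1 - cnj w * z))\<^sup>2 \<le> 4" by simp
  have "(1 - (norm w)\<^sup>2) * (1 - r) / 4 \<le> (1 - (norm w)\<^sup>2) * (1 - (norm z)\<^sup>2) / (norm (1 - cnj w * z))\<^sup>2"
  proof (rule frac_le)
    have "r\<^sup>2 \<le> r" using r by (simp add: power2_eq_square mult_left_le)
    then show "(1 - (norm w)\<^sup>2) * (1 - r) \<le> (1 - (norm w)\<^sup>2) * (1 - (norm z)\<^sup>2)"
      using p z by (intro mult_left_mono) auto
    show "0 \<le> (1 - (norm w)\<^sup>2) * (1 - (norm z)\<^sup>2)"
      using p z1 by (intro mult_nonneg_nonneg less_imp_le[OF p]) (auto simp: abs_square_le_1)
  qed (use d4 d0 in auto)
  also have "\<dots> = 1 - t\<^sup>2" using norm_blaschke[OF w, of z] z1 by (simp add: t_def)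
  also have "\<dots> = (1 - t) * (1 + t)" by (simp add: algebra_simps power2_eq_square)
  also have "\<dots> \<le> (1 - t) * 2" using t by (intro mult_left_mono) auto
  finally have l: "(1 - (norm w)\<^sup>2) * (1 - r) / 8 \<le> 1 - t" by simp
  have q: "0 < (1 - (norm w)\<^sup>2) * (1 - r)" using p r by simp
  have "t / (1 - t) \<le> 1 / ((1 - (norm w)\<^sup>2) * (1 - r) / 8)"
    using t l q by (intro frac_le) auto
  then show ?thesis by (simp add: t_def)
qed

text \<open>
  The product of means is absorbed by subtracting from \<open>f\<close> its mean, which is the form in which
  the correlation can be estimated.
\<close>

lemma correlation_eq_centred:
  assumes T: "disc_map (semigroup_action \<phi> a)" and w: "norm w < 1"
    and f: "continuous_on (sphere 0 1) f" and g: "continuous_on (sphere 0 1) g"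
  shows "correlation \<phi> w f g a =
    norm (LINT z|harmonic_measure w. (f (semigroup_action \<phi> a z) - (LINT u|harmonic_measure w. f u)) * cnj (g z))"
proof -
  let ?T = "semigroup_action \<phi> a"
  define c where "c = (LINT u|harmonic_measure w. f u)"
  have i: "integrable (harmonic_measure w) F" if "continuous_on (sphere 0 1) F" for F :: "complex \<Rightarrow> complex"
    by (rule integrable_continuous_on_circle[OF finite_measure_harmonic[OF w] sets_harmonic that])
  have cfT: "continuous_on (sphere 0 1) (\<lambda>z. f (?T z))"
    by (rule continuous_on_compose2[OF f continuous_on_subset[OF disc_mapD(1)[OF T]]])
       (use disc_mapD(4)[OF T] in auto)
  have "(LINT z|harmonic_measure w. f (?T z) * cnj (g z)) - c * (LINT z|harmonic_measure w. cnj (g z))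
     = (LINT z|harmonic_measure w. f (?T z) * cnj (g z) - c * cnj (g z))"
    by (subst Bochner_Integration.integral_diff) (auto intro!: i continuous_intros cfT g)
  then show ?thesis by (simp add: correlation_def c_def left_diff_distrib)
qed

text \<open>
  The first term is the cost of averaging over radius \<open>r\<close>, the second one the size of the
  centred harmonic extension on the image of the circle of radius \<open>r\<close>. The averaging
  is paid for by the Hoelder modulus of \<open>g\<close>, while \<open>f\<close> enters through its bound \<open>A\<close>.
\<close>

lemma correlation_semigroup_bound:
  fixes f g :: "complex \<Rightarrow> complex" and r :: real
  assumes \<phi>: "\<And>j. j \<in> set a \<Longrightarrow> disc_map (\<phi> j)" "\<And>j. j \<in> set a \<Longrightarrow> \<phi> j w = w"
    "\<And>j. j \<in> set a \<Longrightarrow> norm (deriv (\<phi> j) w) \<le> \<Lambda>" and \<Lambda>: "0 \<le> \<Lambda>" "\<Lambda> < 1"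
    and w: "norm w < 1" and r: "0 \<le> r" "r < 1" and \<alpha>: "0 < \<alpha>" "\<alpha> \<le> 1" and L: "0 \<le> L"
    and f: "continuous_on (sphere 0 1) f" "\<And>z. norm z = 1 \<Longrightarrow> norm (f z) \<le> A"
    and g: "\<And>z. norm z = 1 \<Longrightarrow> norm (g z) \<le> B"
      "\<And>x y. norm x = 1 \<Longrightarrow> norm y = 1 \<Longrightarrow> norm (g x - g y) \<le> L * dist x y powr \<alpha>"
  shows "correlation \<phi> w f g a \<le>
    2 * A * (3 * ((L + 8 * B) / (1 - norm w) ^ 4) * (1 - r) powr (\<alpha> / 2)) +
    B / (1 - norm w)\<^sup>2 * (2 * A * (((1 + \<Lambda>) / 2) ^ length a * (8 / ((1 - (norm w)\<^sup>2) * (1 - r)))))"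
proof -
  let ?T = "semigroup_action \<phi> a"
  let ?K = "((1 + \<Lambda>) / 2) ^ length a * (8 / ((1 - (norm w)\<^sup>2) * (1 - r)))"
  let ?LG = "(L + 8 * B) / (1 - norm w) ^ 4"
  have T: "disc_map ?T" by (rule disc_map_semigroup_action[OF \<phi>(1)])
  have Tw: "?T w = w" by (rule semigroup_action_fixes) (rule \<phi>(2))
  have A: "0 \<le> A" by (rule order_trans[OF norm_ge_zero f(2)[of 1]]) simp
  have B: "0 \<le> B" by (rule order_trans[OF norm_ge_zero g(1)[of 1]]) simp
  have cg: "continuous_on (sphere 0 1) g"
    by (rule holder_continuous[OF _ \<alpha>(1)]) (use g(2) in auto)
  have cT: "continuous_on (sphere 0 1) ?T"
    by (rule continuous_on_subset[OF disc_mapD(1)[OF T]]) auto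
  have cfT: "continuous_on (sphere 0 1) (\<lambda>z. f (?T z))"
    by (rule continuous_on_compose2[OF f(1) cT]) (use disc_mapD(4)[OF T] in auto)
  define c where "c = (LINT z|harmonic_measure w. f z)"
  define h where "h = (\<lambda>z. f (?T z) - c)"
  \<comment> \<open>The density of the harmonic measure is absorbed into \<open>G\<close>, so that averaging takes place with respect to the
    rotation invariant measure.\<close>
  define G where "G = (\<lambda>z. complex_of_real (poisson w z) * cnj (g z))"
  have ch: "continuous_on (sphere 0 1) h" unfolding h_def by (intro continuous_intros cfT)
  have cG: "continuous_on (sphere 0 1) G" unfolding G_def by (intro continuous_intros continuous_poisson w cg)
  interpret nw: finite_measure "harmonic_measure w" by (rule finite_measure_harmonic[OF w])
  have ii: "integrable (harmonic_measure w) F" if "continuous_on (sphere 0 1) F" for F :: "complex \<Rightarrow> complex"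
    by (rule integrable_continuous_on_circle[OF finite_measure_harmonic[OF w] sets_harmonic that])
  have c: "norm c \<le> A"
  proof -
    have "norm c \<le> (LINT z|harmonic_measure w. A)" unfolding c_def
      by (rule Bochner_Integration.integral_norm_bound_integral) (use f ii[OF f(1)] in \<open>auto simp: space_harmonic\<close>)
    then show ?thesis by (simp add: space_harmonic measure_harmonic[OF w])
  qed
  have corr: "correlation \<phi> w f g a = norm (LINT z|circle_measure. h z * G z)"
  proof -
    have "(LINT z|harmonic_measure w. h z * cnj (g z)) = (LINT z|circle_measure. poisson w z * (h z * cnj (g z)))"
      by (rule integral_harmonic[OF w measurable_circle_continuous]) (intro continuous_intros ch cg)
    then show ?thesis
      unfolding correlation_eq_centred[OF T w f(1) cg] by (simp add: h_def c_def G_def mult_ac)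
  qed
  have hb: "norm (h z) \<le> 2 * A" if "norm z = 1" for z
    using f(2)[OF disc_mapD(4)[OF T that]] c norm_triangle_ineq4[of "f (?T z)" c] by (simp add: h_def)
  have Gb: "norm (G z) \<le> B / (1 - norm w)\<^sup>2" if z: "norm z = 1" for z
  proof -
    have "norm (G z) = poisson w z * norm (g z)" using poisson_pos[OF w, of z] z by (simp add: G_def norm_mult)
    also have "\<dots> \<le> 1 / (1 - norm w)\<^sup>2 * B"
      using poisson_bounds(1)[OF w z z] g(1)[OF z] by (intro mult_mono) auto
    finally show ?thesis by simp
  qed
  have GL: "norm (G x - G y) \<le> ?LG * norm (x - y) powr \<alpha>" if x: "norm x = 1" and y: "norm y = 1" for x y
  proof -
    have e: "0 < 1 - norm w" "1 - norm w \<le> 1" using w by auto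
    then have e42: "(1 - norm w) ^ 4 \<le> (1 - norm w)\<^sup>2" by (intro power_decreasing) auto
    have "G x - G y = complex_of_real (poisson w x) * cnj (g x - g y) + complex_of_real (poisson w x - poisson w y) * cnj (g y)"
      by (simp add: G_def algebra_simps)
    also have "norm \<dots> \<le> norm (complex_of_real (poisson w x) * cnj (g x - g y)) + norm (complex_of_real (poisson w x - poisson w y) * cnj (g y))"
      by (rule norm_triangle_ineq)
    also have "\<dots> = poisson w x * norm (g x - g y) + \<bar>poisson w x - poisson w y\<bar> * norm (g y)"
      unfolding norm_mult complex_mod_cnj norm_of_real using poisson_pos[OF w, of x] x by simp
    also have "\<dots> \<le> 1 / (1 - norm w)\<^sup>2 * (L * norm (x - y) powr \<alpha>) + (4 / (1 - norm w) ^ 4 * (2 * norm (x - y) powr \<alpha>)) * B"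
      using poisson_bounds[OF w x y] g(1)[OF y] g(2)[OF x y] norm_le_holder_on_circle[OF x y \<alpha>] e
      by (intro add_mono mult_mono order_trans[OF poisson_bounds(2)[OF w x y]] mult_left_mono) (auto simp: dist_norm)
    also have "\<dots> \<le> 1 / (1 - norm w) ^ 4 * (L * norm (x - y) powr \<alpha>) + (4 / (1 - norm w) ^ 4 * (2 * norm (x - y) powr \<alpha>)) * B"
      using e e42 L by (intro add_right_mono mult_right_mono divide_left_mono mult_pos_pos zero_less_power) auto
    also have "\<dots> = ?LG * norm (x - y) powr \<alpha>" by (simp add: add_divide_distrib algebra_simps)
    finally show ?thesis .
  qed
  have LG: "0 \<le> ?LG" using L B w by auto
  let ?Gr = "\<lambda>z. LINT \<eta>|harmonic_measure (complex_of_real r * z). G \<eta>"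
  have Grm: "?Gr \<in> borel_measurable circle_measure"
    by (rule poisson_smoothing_selfadjoint(2)[OF r ch cG])
  have err: "norm (?Gr z - G z) \<le> 3 * ?LG * (1 - r) powr (\<alpha> / 2)" if z: "norm z = 1" for z
    by (rule poisson_smoothing_error[OF r z \<alpha>(1) _ LG cG GL[OF _ z]]) (use \<alpha> in auto)
  have Grb: "norm (?Gr z) \<le> B / (1 - norm w)\<^sup>2 + 3 * ?LG * (1 - r) powr (\<alpha> / 2)" if z: "norm z = 1" for z
    using err[OF z] Gb[OF z] norm_triangle_ineq[of "?Gr z - G z" "G z"] by simp
  have hm: "h \<in> borel_measurable circle_measure" by (rule measurable_circle_continuous[OF ch])
  have ihG: "integrable circle_measure (\<lambda>z. h z * G z)"
    by (intro integrable_circle_continuous continuous_intros ch cG)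
  have ihGr: "integrable circle_measure (\<lambda>z. h z * ?Gr z)"
  proof (rule circle.integrable_const_bound[where B = "2 * A * (B / (1 - norm w)\<^sup>2 + 3 * ?LG * (1 - r) powr (\<alpha> / 2))"])
    show "(\<lambda>z. h z * ?Gr z) \<in> borel_measurable circle_measure" by (intro borel_measurable_times hm Grm)
    show "AE z in circle_measure. norm (h z * ?Gr z) \<le> 2 * A * (B / (1 - norm w)\<^sup>2 + 3 * ?LG * (1 - r) powr (\<alpha> / 2))"
      unfolding norm_mult by (intro AE_I2 mult_mono hb Grb) (use A in \<open>auto simp: space_circle\<close>)
  qed
  have 1: "norm (LINT z|circle_measure. h z * G z - h z * ?Gr z) \<le> 2 * A * (3 * ?LG * (1 - r) powr (\<alpha> / 2))"
  proof -
    have "norm (LINT z|circle_measure. h z * G z - h z * ?Gr z) \<le> (LINT z|circle_measure. 2 * A * (3 * ?LG * (1 - r) powr (\<alpha> / 2)))"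
    proof (rule Bochner_Integration.integral_norm_bound_integral)
      show "integrable circle_measure (\<lambda>z. h z * G z - h z * ?Gr z)"
        by (rule Bochner_Integration.integrable_diff[OF ihG ihGr])
      fix z assume "z \<in> space circle_measure"
      then have z: "norm z = 1" by (simp add: space_circle)
      show "norm (h z * G z - h z * ?Gr z) \<le> 2 * A * (3 * ?LG * (1 - r) powr (\<alpha> / 2))"
        unfolding right_diff_distrib[symmetric] norm_mult norm_minus_commute[of "G z"]
        using A by (intro mult_mono hb err z) auto
    qed auto
    then show ?thesis by (simp add: space_circle measure_circle)
  qed
  have 2: "norm (LINT z|circle_measure. h z * ?Gr z) \<le> B / (1 - norm w)\<^sup>2 * (2 * A * ?K)"
  proof -
    have "(LINT z|circle_measure. h z * ?Gr z) = (LINT \<eta>|circle_measure. G \<eta> * (LINT \<zeta>|harmonic_measure (r * \<eta>). h \<zeta>))"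
      by (rule poisson_smoothing_selfadjoint(1)[OF r ch cG])
    also have "norm \<dots> \<le> (LINT \<eta>|circle_measure. B / (1 - norm w)\<^sup>2 * (2 * A * ?K))"
    proof (rule Bochner_Integration.integral_norm_bound_integral)
      have Ib: "norm (LINT \<zeta>|harmonic_measure (r * \<eta>). h \<zeta>) \<le> 2 * A * ?K" if \<eta>: "norm \<eta> = 1" for \<eta> :: complex
      proof -
        define z where "z = complex_of_real r * \<eta>"
        have z: "norm z = r" "norm z < 1" using r \<eta> by (auto simp: z_def norm_mult)
        interpret nz: finite_measure "harmonic_measure z" by (rule finite_measure_harmonic[OF z(2)])
        have "(LINT \<zeta>|harmonic_measure z. h \<zeta>) = (LINT \<zeta>|harmonic_measure z. f (?T \<zeta>)) - (LINT \<zeta>|harmonic_measure z. c)"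
          unfolding h_def
          by (rule Bochner_Integration.integral_diff)
             (auto intro!: integrable_continuous_on_circle[OF finite_measure_harmonic[OF z(2)] sets_harmonic] cfT)
        also have "\<dots> = (LINT \<zeta>|harmonic_measure (?T z). f \<zeta>) - (LINT \<zeta>|harmonic_measure w. f \<zeta>)"
          by (simp add: c_def integral_disc_map[OF T z(2) measurable_circle_continuous[OF f(1)]] space_harmonic measure_harmonic[OF z(2)])
        also have "norm \<dots> \<le> 2 * A * (norm (blaschke w (?T z)) / (1 - norm (blaschke w (?T z))))"
          by (rule poisson_integral_near[OF disc_mapD(3)[OF T z(2)] w f])
        also have "\<dots> \<le> 2 * A * (((1 + \<Lambda>) / 2) ^ length a * (norm (blaschke w z) / (1 - norm (blaschke w z))))"
          using A by (intro mult_left_mono semigroup_action_contraction[OF \<phi> \<Lambda> w z(2)]) auto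
        also have "\<dots> \<le> 2 * A * ?K"
          using A \<Lambda> by (intro mult_left_mono blaschke_radial_bound[OF w r z(1)]) auto
        finally show ?thesis by (simp add: z_def)
      qed
      fix \<eta> assume "\<eta> \<in> space circle_measure"
      then have \<eta>: "norm \<eta> = 1" by (simp add: space_circle)
      show "norm (G \<eta> * (LINT \<zeta>|harmonic_measure (r * \<eta>). h \<zeta>)) \<le> B / (1 - norm w)\<^sup>2 * (2 * A * ?K)"
        unfolding norm_mult using B by (intro mult_mono Gb Ib \<eta>) auto
    next
      show "integrable circle_measure (\<lambda>\<eta>. G \<eta> * (LINT \<zeta>|harmonic_measure (r * \<eta>). h \<zeta>))"
      proof (rule circle.integrable_const_bound[where B = "B / (1 - norm w)\<^sup>2 * (2 * A)"])
        show "(\<lambda>\<eta>. G \<eta> * (LINT \<zeta>|harmonic_measure (r * \<eta>). h \<zeta>)) \<in> borel_measurable circle_measure"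
          by (intro borel_measurable_times measurable_circle_continuous[OF cG] poisson_smoothing_selfadjoint(2)[OF r cG ch])
        have Ih: "norm (LINT \<zeta>|harmonic_measure (r * \<eta>). h \<zeta>) \<le> 2 * A" if \<eta>: "norm \<eta> = 1" for \<eta> :: complex
        proof -
          have z: "norm (complex_of_real r * \<eta>) < 1" using r \<eta> by (auto simp: norm_mult)
          interpret nz: finite_measure "harmonic_measure (r * \<eta>)" by (rule finite_measure_harmonic[OF z])
          have "norm (LINT \<zeta>|harmonic_measure (r * \<eta>). h \<zeta>) \<le> (LINT \<zeta>|harmonic_measure (r * \<eta>). 2 * A)"
            by (rule Bochner_Integration.integral_norm_bound_integral)
               (use hb integrable_continuous_on_circle[OF finite_measure_harmonic[OF z] sets_harmonic ch] in \<open>auto simp: space_harmonic\<close>)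
          then show ?thesis by (simp add: space_harmonic measure_harmonic[OF z])
        qed
        show "AE \<eta> in circle_measure. norm (G \<eta> * (LINT \<zeta>|harmonic_measure (r * \<eta>). h \<zeta>)) \<le> B / (1 - norm w)\<^sup>2 * (2 * A)"
          unfolding norm_mult by (intro AE_I2 mult_mono Gb Ih) (use B in \<open>auto simp: space_circle\<close>)
      qed
    qed auto
    also have "\<dots> = B / (1 - norm w)\<^sup>2 * (2 * A * ?K)" by (simp add: space_circle measure_circle)
    finally show ?thesis .
  qed
  have split: "(LINT z|circle_measure. h z * G z) = (LINT z|circle_measure. h z * G z - h z * ?Gr z) + (LINT z|circle_measure. h z * ?Gr z)"
    using ihG ihGr by simp
  show ?thesis unfolding corr split
    by (rule order_trans[OF norm_triangle_ineq add_mono[OF 1 2]])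
qed

text \<open>
  The two summands of the Hoelder norm serve as \<open>A\<close> and \<open>L\<close>: both suprema run over bounded sets, the
  first one because a Hoelder function is continuous on the compact circle.
\<close>

lemma holder_norm_bounds:
  fixes f :: "complex \<Rightarrow> complex"
  assumes f: "f \<in> holder_space \<alpha>" and \<alpha>: "0 < \<alpha>"
  obtains A L where "0 \<le> A" "0 \<le> L" "holder_norm \<alpha> f = A + L"
    "\<And>z. norm z = 1 \<Longrightarrow> norm (f z) \<le> A"
    "\<And>x y. norm x = 1 \<Longrightarrow> norm y = 1 \<Longrightarrow> norm (f x - f y) \<le> L * dist x y powr \<alpha>"
proof -
  let ?S = "sphere 0 1 :: complex set"
  let ?D = "{(x, y). x \<in> ?S \<and> y \<in> ?S \<and> x \<noteq> y}"
  let ?q = "\<lambda>(x, y). norm (f x - f y) / dist x y powr \<alpha>"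
  define A where "A = (SUP x\<in>?S. norm (f x))"
  define L where "L = (SUP p\<in>?D. ?q p)"
  obtain M where M: "\<And>x y. x \<in> ?S \<Longrightarrow> y \<in> ?S \<Longrightarrow> norm (f x - f y) \<le> M * dist x y powr \<alpha>"
    using f unfolding holder_space_def by blast
  have "continuous_on ?S (\<lambda>x. norm (f x))"
    by (intro continuous_intros holder_continuous[OF M \<alpha>])
  then have bA: "bdd_above ((\<lambda>x. norm (f x)) ` ?S)"
    by (intro bounded_imp_bdd_above compact_imp_bounded compact_continuous_image) auto
  have fA: "norm (f z) \<le> A" if "norm z = 1" for z
    unfolding A_def by (rule cSUP_upper[OF _ bA]) (use that in simp)
  have bL: "bdd_above (?q ` ?D)"
  proof (rule bdd_aboveI2[where M = M], clarify)
    fix x y :: complex assume xy: "x \<in> ?S" "y \<in> ?S" "x \<noteq> y"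
    then have "0 < dist x y powr \<alpha>" by simp
    then show "norm (f x - f y) / dist x y powr \<alpha> \<le> M"
      using M[OF xy(1,2)] by (simp add: divide_le_eq)
  qed
  have fL: "norm (f x - f y) \<le> L * dist x y powr \<alpha>" if x: "norm x = 1" and y: "norm y = 1" for x y
  proof (cases "x = y")
    case False
    then have p: "0 < dist x y powr \<alpha>" by simp
    have "?q (x, y) \<le> L" unfolding L_def
      by (rule cSUP_upper[OF _ bL]) (use x y False in simp)
    then show ?thesis using p by (simp add: divide_le_eq)
  qed simp
  have A0: "0 \<le> A" by (rule order_trans[OF norm_ge_zero fA[of 1]]) simp
  have L0: "0 \<le> L"
  proof -
    have "0 \<le> L * dist (1::complex) (-1) powr \<alpha>" by (rule order_trans[OF norm_ge_zero fL]) auto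
    moreover have "0 < dist (1::complex) (-1) powr \<alpha>" by (simp add: dist_norm)
    ultimately show ?thesis by (simp add: zero_le_mult_iff)
  qed
  have "holder_norm \<alpha> f = A + L" by (simp add: holder_norm_def A_def L_def)
  then show thesis using that A0 L0 fA fL by blast
qed

text \<open>
  With contraction factor \<open>k\<close> the choice \<open>1 - r = k powr (n / 2)\<close> makes the averaging error
  \<open>k powr (n * \<alpha> / 4)\<close> and the interior term \<open>k powr (n / 2)\<close>, both exponentially small in \<open>n\<close>.
\<close>

lemma exponentially_mixing_if_contracting:
  assumes \<phi>: "\<And>j. j \<in> {1..N} \<Longrightarrow> disc_map (\<phi> j)" "\<And>j. j \<in> {1..N} \<Longrightarrow> \<phi> j w = w"
    "\<And>j. j \<in> {1..N} \<Longrightarrow> norm (deriv (\<phi> j) w) < 1"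
    and w: "norm w < 1" and \<alpha>: "0 < \<alpha>" "\<alpha> \<le> 1"
  shows "exponentially_mixing \<alpha> N \<phi> w"
proof -
  define \<Lambda> where "\<Lambda> = Max (insert 0 ((\<lambda>j. norm (deriv (\<phi> j) w)) ` {1..N}))"
  have \<Lambda>: "0 \<le> \<Lambda>" "\<Lambda> < 1" unfolding \<Lambda>_def using \<phi>(3) by (auto simp: Max_ge_iff)
  have d: "norm (deriv (\<phi> j) w) \<le> \<Lambda>" if "j \<in> {1..N}" for j
    unfolding \<Lambda>_def using that by (intro Max_ge) auto
  define k where "k = (1 + \<Lambda>) / 2"
  have k: "0 < k" "k < 1" using \<Lambda> by (auto simp: k_def)
  define e where "e = 1 - norm w"
  define p where "p = 1 - (norm w)\<^sup>2"
  have e: "0 < e" and p: "0 < p" using w by (auto simp: e_def p_def abs_square_less_1)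
  define C where "C = 48 / e ^ 4 + 16 / (e\<^sup>2 * p)"
  define K where "K = - (\<alpha> / 4) * ln k"
  have K: "0 < K" using k \<alpha> by (simp add: K_def mult_pos_neg)
  have C: "0 < C" using e p by (simp add: C_def add_pos_pos)
  show ?thesis unfolding exponentially_mixing_def
  proof (rule exI[of _ K], rule conjI[OF K], rule exI[of _ C], rule conjI[OF C], intro ballI)
    fix f g a assume f: "f \<in> holder_space \<alpha>" and g: "g \<in> holder_space \<alpha>" and a: "a \<in> free_semigroup N"
    obtain A LA where A: "0 \<le> A" "0 \<le> LA" "holder_norm \<alpha> f = A + LA"
      "\<And>z. norm z = 1 \<Longrightarrow> norm (f z) \<le> A"
      "\<And>x y. norm x = 1 \<Longrightarrow> norm y = 1 \<Longrightarrow> norm (f x - f y) \<le> LA * dist x y powr \<alpha>"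
      using holder_norm_bounds[OF f \<alpha>(1)] by blast
    obtain B L where B: "0 \<le> B" "0 \<le> L" "holder_norm \<alpha> g = B + L"
      "\<And>z. norm z = 1 \<Longrightarrow> norm (g z) \<le> B"
      "\<And>x y. norm x = 1 \<Longrightarrow> norm y = 1 \<Longrightarrow> norm (g x - g y) \<le> L * dist x y powr \<alpha>"
      using holder_norm_bounds[OF g \<alpha>(1)] by blast
    have cf: "continuous_on (sphere 0 1) f" by (rule holder_continuous[OF _ \<alpha>(1)]) (use A(5) in auto)
    have aJ: "j \<in> {1..N}" if "j \<in> set a" for j using a that by (auto simp: free_semigroup_def)
    define n where "n = length a"
    have n: "n \<ge> 1" using a by (cases a) (auto simp: n_def free_semigroup_def)
    \<comment> \<open>The value of \<open>1 - r\<close>: it makes both error terms exponentially small.\<close>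
    define s where "s = k powr (n / 2)"
    have s: "0 < s" "s < 1" using k n powr_less_mono'[of k 0 "n / 2"] by (auto simp: s_def)
    have "s \<le> s powr (\<alpha> / 2)" using powr_mono'[of "\<alpha> / 2" 1 s] s \<alpha> by simp
    have "correlation \<phi> w f g a \<le>
      2 * A * (3 * ((L + 8 * B) / (1 - norm w) ^ 4) * (1 - (1 - s)) powr (\<alpha> / 2)) +
      B / (1 - norm w)\<^sup>2 * (2 * A * (((1 + \<Lambda>) / 2) ^ length a * (8 / ((1 - (norm w)\<^sup>2) * (1 - (1 - s))))))"
      by (rule correlation_semigroup_bound[where \<Lambda> = \<Lambda>])
         (use aJ \<phi> d \<Lambda> w s \<alpha> A B cf in auto)
    also have "\<dots> = 6 * A * (L + 8 * B) / e ^ 4 * s powr (\<alpha> / 2) + 16 * A * B / (e\<^sup>2 * p) * (k ^ n / s)"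
      by (simp add: e_def p_def k_def n_def add_divide_distrib algebra_simps)
    also have "k ^ n / s = s"
    proof -
      have "k ^ n = k powr n" using k by (simp add: powr_realpow)
      also have "\<dots> = s * s" by (simp add: s_def powr_add[symmetric])
      finally show ?thesis using s by simp
    qed
    also have "6 * A * (L + 8 * B) / e ^ 4 * s powr (\<alpha> / 2) + 16 * A * B / (e\<^sup>2 * p) * s
        \<le> 48 * A * (B + L) / e ^ 4 * s powr (\<alpha> / 2) + 16 * A * (B + L) / (e\<^sup>2 * p) * s powr (\<alpha> / 2)"
    proof (rule add_mono)
      have "6 * A * (L + 8 * B) = A * (6 * L + 48 * B)" by (simp add: algebra_simps)
      also have "\<dots> \<le> A * (48 * (B + L))" using A B by (intro mult_left_mono) auto
      finally have "6 * A * (L + 8 * B) \<le> 48 * A * (B + L)" by (simp add: algebra_simps)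
      then show "6 * A * (L + 8 * B) / e ^ 4 * s powr (\<alpha> / 2) \<le> 48 * A * (B + L) / e ^ 4 * s powr (\<alpha> / 2)"
        using e by (intro mult_right_mono divide_right_mono) auto
      show "16 * A * B / (e\<^sup>2 * p) * s \<le> 16 * A * (B + L) / (e\<^sup>2 * p) * s powr (\<alpha> / 2)"
        using A B e p s \<open>s \<le> s powr (\<alpha> / 2)\<close>
        by (intro mult_mono divide_right_mono mult_left_mono) auto
    qed
    also have "\<dots> = C * s powr (\<alpha> / 2) * A * (B + L)" by (simp add: C_def field_simps)
    also have "\<dots> \<le> C * s powr (\<alpha> / 2) * (A + LA) * (B + L)"
      using C A B by (intro mult_right_mono mult_left_mono) auto
    also have "s powr (\<alpha> / 2) = exp (- K * real (length a))"
    proof -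
      have "s powr (\<alpha> / 2) = k powr (n / 2 * (\<alpha> / 2))" by (simp add: s_def powr_powr)
      also have "\<dots> = exp (n / 2 * (\<alpha> / 2) * ln k)" using k by (simp add: powr_def)
      also have "n / 2 * (\<alpha> / 2) * ln k = - K * real (length a)" by (simp add: K_def n_def)
      finally show ?thesis .
    qed
    finally show "correlation \<phi> w f g a \<le> C * exp (- K * real (length a)) * holder_norm \<alpha> f * holder_norm \<alpha> g"
      by (simp only: A(3) B(3))
  qed
qed

section \<open>Mixing\<close>

definition L2_norm_on :: "complex measure \<Rightarrow> (complex \<Rightarrow> complex) \<Rightarrow> real" where
  "L2_norm_on M f = sqrt (LINT z|M. (norm (f z))\<^sup>2)"

lemma L2_norm_nonneg: "0 \<le> L2_norm_on M f"
  by (simp add: L2_norm_on_def integral_nonneg_AE)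

lemma norm_integral_le_L2_norm:
  assumes w: "norm w < 1" and f: "f \<in> L2_functions (harmonic_measure w)"
  shows "norm (LINT z|harmonic_measure w. f z) \<le> L2_norm_on (harmonic_measure w) f"
proof -
  interpret finite_measure "harmonic_measure w" by (rule finite_measure_harmonic[OF w])
  have "(\<lambda>_. 1) \<in> L2_functions (harmonic_measure w)"
    by (rule L2_bounded[OF finite_measure_harmonic[OF w], where B = 1]) auto
  from L2_Cauchy_Schwarz[OF f this] show ?thesis
    by (simp add: L2_norm_on_def space_harmonic measure_harmonic[OF w])
qed

context
  fixes \<phi> :: "nat \<Rightarrow> complex \<Rightarrow> complex" and w :: complex and a :: "nat list"
  assumes T: "disc_map (semigroup_action \<phi> a)" "semigroup_action \<phi> a w = w" and w: "norm w < 1"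
begin

lemma correlation_le_L2:
  assumes f: "f \<in> L2_functions (harmonic_measure w)" and g: "g \<in> L2_functions (harmonic_measure w)"
  shows "correlation \<phi> w f g a \<le> 2 * L2_norm_on (harmonic_measure w) f * L2_norm_on (harmonic_measure w) g"
proof -
  let ?N = "L2_norm_on (harmonic_measure w)"
  note fT = L2_disc_map[OF T(1) w T(2) f]
  have cg: "(\<lambda>z. cnj (g z)) \<in> L2_functions (harmonic_measure w)" by (rule L2_cnj[OF g])
  have Ncg: "?N (\<lambda>z. cnj (g z)) = ?N g" by (simp add: L2_norm_on_def)
  have "norm (LINT z|harmonic_measure w. f (semigroup_action \<phi> a z) * cnj (g z)) \<le> ?N f * ?N g"
    using L2_Cauchy_Schwarz[OF fT(1) cg] by (simp add: L2_norm_on_def fT(2))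
  moreover have "norm ((LINT z|harmonic_measure w. f z) * (LINT z|harmonic_measure w. cnj (g z))) \<le> ?N f * ?N g"
    unfolding norm_mult using norm_integral_le_L2_norm[OF w f] norm_integral_le_L2_norm[OF w cg] unfolding Ncg
    by (intro mult_mono L2_norm_nonneg) auto
  ultimately show ?thesis unfolding correlation_def
    by (intro order_trans[OF norm_triangle_ineq4]) linarith
qed

lemma correlation_diff_left:
  assumes f: "f \<in> L2_functions (harmonic_measure w)" and p: "p \<in> L2_functions (harmonic_measure w)"
    and g: "g \<in> L2_functions (harmonic_measure w)"
  shows "correlation \<phi> w f g a \<le> correlation \<phi> w (\<lambda>z. f z - p z) g a + correlation \<phi> w p g a"
proof -
  let ?T = "semigroup_action \<phi> a" and ?I = "\<lambda>F. LINT z|harmonic_measure w. F z"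
  have cg: "(\<lambda>z. cnj (g z)) \<in> L2_functions (harmonic_measure w)" by (rule L2_cnj[OF g])
  have i: "integrable (harmonic_measure w) (\<lambda>z. f (?T z) * cnj (g z))"
    "integrable (harmonic_measure w) (\<lambda>z. p (?T z) * cnj (g z))"
    by (intro L2_mult_integrable[OF _ cg] L2_disc_map(1)[OF T(1) w T(2)] f p)+
  have i2: "integrable (harmonic_measure w) f" "integrable (harmonic_measure w) p"
    by (intro L2_imp_integrable[OF finite_measure_harmonic[OF w]] f p)+
  have "?I (\<lambda>z. f (?T z) * cnj (g z)) - ?I f * ?I (\<lambda>z. cnj (g z)) =
     (?I (\<lambda>z. (f (?T z) - p (?T z)) * cnj (g z)) - ?I (\<lambda>z. f z - p z) * ?I (\<lambda>z. cnj (g z)))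
     + (?I (\<lambda>z. p (?T z) * cnj (g z)) - ?I p * ?I (\<lambda>z. cnj (g z)))"
    using i i2 by (simp add: left_diff_distrib)
  then show ?thesis unfolding correlation_def by (simp only: norm_triangle_ineq)
qed

lemma correlation_diff_right:
  assumes f: "f \<in> L2_functions (harmonic_measure w)" and q: "q \<in> L2_functions (harmonic_measure w)"
    and g: "g \<in> L2_functions (harmonic_measure w)"
  shows "correlation \<phi> w f g a \<le> correlation \<phi> w f (\<lambda>z. g z - q z) a + correlation \<phi> w f q a"
proof -
  let ?T = "semigroup_action \<phi> a" and ?I = "\<lambda>F. LINT z|harmonic_measure w. F z"
  have cg: "(\<lambda>z. cnj (g z)) \<in> L2_functions (harmonic_measure w)" "(\<lambda>z. cnj (q z)) \<in> L2_functions (harmonic_measure w)"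
    by (intro L2_cnj g q)+
  have i: "integrable (harmonic_measure w) (\<lambda>z. f (?T z) * cnj (g z))"
    "integrable (harmonic_measure w) (\<lambda>z. f (?T z) * cnj (q z))"
    by (intro L2_mult_integrable cg L2_disc_map(1)[OF T(1) w T(2)] f)+
  have i2: "integrable (harmonic_measure w) (\<lambda>z. cnj (g z))" "integrable (harmonic_measure w) (\<lambda>z. cnj (q z))"
    by (intro L2_imp_integrable[OF finite_measure_harmonic[OF w]] cg)+
  have "?I (\<lambda>z. f (?T z) * cnj (g z)) - ?I f * ?I (\<lambda>z. cnj (g z)) =
     (?I (\<lambda>z. f (?T z) * cnj (g z - q z)) - ?I f * ?I (\<lambda>z. cnj (g z - q z)))
     + (?I (\<lambda>z. f (?T z) * cnj (q z)) - ?I f * ?I (\<lambda>z. cnj (q z)))"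
    unfolding complex_cnj_diff right_diff_distrib Bochner_Integration.integral_diff[OF i] Bochner_Integration.integral_diff[OF i2]
    by (simp add: algebra_simps)
  then show ?thesis unfolding correlation_def by (simp only: norm_triangle_ineq)
qed

text \<open>
  Correlations are continuous in both functions for the mean-square norm, uniformly over words,
  because composition with an action element is an isometry of that norm.
\<close>

lemma correlation_approx:
  assumes f: "f \<in> L2_functions (harmonic_measure w)" and g: "g \<in> L2_functions (harmonic_measure w)"
    and p: "p \<in> L2_functions (harmonic_measure w)" and q: "q \<in> L2_functions (harmonic_measure w)"
  shows "correlation \<phi> w f g a \<le>
    2 * L2_norm_on (harmonic_measure w) (\<lambda>z. f z - p z) * L2_norm_on (harmonic_measure w) g
    + 2 * L2_norm_on (harmonic_measure w) p * L2_norm_on (harmonic_measure w) (\<lambda>z. g z - q z)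
    + correlation \<phi> w p q a"
  using correlation_diff_left[OF f p g] correlation_diff_right[OF p q g]
    correlation_le_L2[OF L2_diff[OF f p] g] correlation_le_L2[OF p L2_diff[OF g q]]
  by linarith

end

lemma powi_lipschitz_circle:
  fixes x y :: complex
  assumes "norm x = 1" "norm y = 1"
  shows "norm (x powi k - y powi k) \<le> real_of_int \<bar>k\<bar> * norm (x - y)"
proof -
  have n: "norm (x ^ m - y ^ m) \<le> real m * norm (x - y)" for m
    using norm_power_diff[of x y m] assms by simp
  show ?thesis
  proof (cases "0 \<le> k")
    case True
    then show ?thesis using n[of "nat k"] by (simp add: power_int_def)
  next
    case False
    then have "x powi k - y powi k = cnj (x ^ nat (- k) - y ^ nat (- k))"
      using cnj_powi_circle[of x "- k"] cnj_powi_circle[of y "- k"] assms by (simp add: power_int_def)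
    then have "norm (x powi k - y powi k) = norm (x ^ nat (- k) - y ^ nat (- k))" by (simp only: complex_mod_cnj)
    then show ?thesis using n[of "nat (- k)"] False by simp
  qed
qed

lemma lipschitz_imp_holder:
  assumes "0 < \<alpha>" "\<alpha> \<le> 1" "0 \<le> K" "\<And>x y. norm x = 1 \<Longrightarrow> norm y = 1 \<Longrightarrow> norm (f x - f y) \<le> K * norm (x - y)"
  shows "f \<in> holder_space \<alpha>"
  unfolding holder_space_def
proof (intro CollectI exI[of _ "2 * K"] ballI)
  fix x y :: complex assume "x \<in> sphere 0 1" "y \<in> sphere 0 1"
  then have xy: "norm x = 1" "norm y = 1" by auto
  have "norm (f x - f y) \<le> K * (2 * norm (x - y) powr \<alpha>)"
    using assms(4)[OF xy] norm_le_holder_on_circle[OF xy assms(1,2)] assms(3)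
    by (meson mult_left_mono order_trans)
  then show "norm (f x - f y) \<le> 2 * K * dist x y powr \<alpha>" by (simp add: dist_norm)
qed

lemma laurent_holder:
  assumes "p \<in> laurent_polynomials" "0 < \<alpha>" "\<alpha> \<le> 1"
  shows "p \<in> holder_space \<alpha>"
proof -
  obtain c K where p: "p = (\<lambda>z. \<Sum>k\<in>K. c k * z powi k)"
    using assms unfolding laurent_polynomials_def by blast
  show ?thesis
  proof (rule lipschitz_imp_holder[OF assms(2,3)])
    show "0 \<le> (\<Sum>k\<in>K. norm (c k) * real_of_int \<bar>k\<bar>)" by (intro sum_nonneg) auto
    fix x y :: complex assume xy: "norm x = 1" "norm y = 1"
    have "norm (p x - p y) = norm (\<Sum>k\<in>K. c k * (x powi k - y powi k))"
      by (simp add: p sum_subtractf right_diff_distrib)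
    also have "\<dots> \<le> (\<Sum>k\<in>K. norm (c k) * (real_of_int \<bar>k\<bar> * norm (x - y)))"
      by (rule sum_norm_le) (use powi_lipschitz_circle[OF xy] in \<open>auto simp: norm_mult intro!: mult_left_mono\<close>)
    also have "\<dots> = (\<Sum>k\<in>K. norm (c k) * real_of_int \<bar>k\<bar>) * norm (x - y)"
      by (simp add: sum_distrib_right mult.assoc)
    finally show "norm (p x - p y) \<le> (\<Sum>k\<in>K. norm (c k) * real_of_int \<bar>k\<bar>) * norm (x - y)" .
  qed
qed

text \<open>
  Laurent polynomials are Lipschitz on the circle, so their correlations decay; density and
  \<open>correlation_approx\<close> extend this to all square-integrable functions. The second approximant is
  chosen after the first one, because its accuracy depends on the norm of the first.
\<close>

lemma mixing_if_exponentially_mixing: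
  assumes \<phi>: "\<And>j. j \<in> {1..N} \<Longrightarrow> disc_map (\<phi> j)" "\<And>j. j \<in> {1..N} \<Longrightarrow> \<phi> j w = w"
    and w: "norm w < 1" and \<alpha>: "0 < \<alpha>" "\<alpha> \<le> 1" and ex: "exponentially_mixing \<alpha> N \<phi> w"
  shows "mixing N \<phi> w"
  unfolding mixing_def
proof (intro ballI allI impI)
  let ?M = "harmonic_measure w" and ?N = "L2_norm_on (harmonic_measure w)"
  fix f g and \<epsilon> :: real
  assume f: "f \<in> L2_functions ?M" and g: "g \<in> L2_functions ?M" and \<epsilon>: "0 < \<epsilon>"
  note fin = finite_measure_harmonic[OF w]
  have dense: "\<exists>p\<in>laurent_polynomials. ?N (\<lambda>z. h z - p z) < d" if h: "h \<in> L2_functions ?M" and d: "0 < d" for h d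
  proof -
    obtain p where p: "p \<in> laurent_polynomials" "(LINT z|?M. (norm (h z - p z))\<^sup>2) < d\<^sup>2"
      using laurent_L2_dense[OF fin sets_harmonic h, of "d\<^sup>2"] d by auto
    have "?N (\<lambda>z. h z - p z) < sqrt (d\<^sup>2)" unfolding L2_norm_on_def using p(2) by (rule real_sqrt_less_mono)
    then show ?thesis using p(1) d by auto
  qed
  have cancel: "\<epsilon> / (6 * m) * m = \<epsilon> / 6" if "0 < m" for m :: real
    using that by simp
  have d1: "0 < \<epsilon> / (6 * (?N g + 1))" using \<epsilon> L2_norm_nonneg[of ?M g] by (simp add: divide_pos_pos)
  obtain p where p: "p \<in> laurent_polynomials" "?N (\<lambda>z. f z - p z) < \<epsilon> / (6 * (?N g + 1))"
    using dense[OF f d1] by blast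
  have d2: "0 < \<epsilon> / (6 * (?N p + 1))" using \<epsilon> L2_norm_nonneg[of ?M p] by (simp add: divide_pos_pos)
  obtain q where q: "q \<in> laurent_polynomials" "?N (\<lambda>z. g z - q z) < \<epsilon> / (6 * (?N p + 1))"
    using dense[OF g d2] by blast
  have pL: "p \<in> L2_functions ?M" and qL: "q \<in> L2_functions ?M"
    by (intro L2_continuous[OF fin sets_harmonic] laurent_continuous p q)+
  have 1: "2 * ?N (\<lambda>z. f z - p z) * ?N g \<le> \<epsilon> / 3"
  proof -
    have "?N (\<lambda>z. f z - p z) * ?N g \<le> \<epsilon> / (6 * (?N g + 1)) * (?N g + 1)"
      using p(2) L2_norm_nonneg d1 by (intro mult_mono) (auto simp: less_imp_le)
    also have "\<dots> = \<epsilon> / 6" by (rule cancel) (use L2_norm_nonneg[of ?M g] in simp)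
    finally show ?thesis by simp
  qed
  have 2: "2 * ?N p * ?N (\<lambda>z. g z - q z) \<le> \<epsilon> / 3"
  proof -
    have "?N (\<lambda>z. g z - q z) * ?N p \<le> \<epsilon> / (6 * (?N p + 1)) * (?N p + 1)"
      using q(2) L2_norm_nonneg d2 by (intro mult_mono) (auto simp: less_imp_le)
    also have "\<dots> = \<epsilon> / 6" by (rule cancel) (use L2_norm_nonneg[of ?M p] in simp)
    finally show ?thesis by (simp add: mult.commute)
  qed
  obtain \<kappa> C where kC: "\<kappa> > 0" "C > 0" and decay: "\<And>f g a. f \<in> holder_space \<alpha> \<Longrightarrow> g \<in> holder_space \<alpha> \<Longrightarrow> a \<in> free_semigroup N \<Longrightarrow>
      correlation \<phi> w f g a \<le> C * exp (- \<kappa> * real (length a)) * holder_norm \<alpha> f * holder_norm \<alpha> g"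
    using ex unfolding exponentially_mixing_def by blast
  define D where "D = C * holder_norm \<alpha> p * holder_norm \<alpha> q"
  have "(\<lambda>n. exp (- \<kappa> * real n) * D) \<longlonglongrightarrow> 0"
    using kC by real_asymp
  then have "\<forall>\<^sub>F n in sequentially. exp (- \<kappa> * real n) * D < \<epsilon> / 3"
    using \<epsilon> by (intro order_tendstoD) auto
  then obtain n where n: "\<And>m. m \<ge> n \<Longrightarrow> exp (- \<kappa> * real m) * D < \<epsilon> / 3"
    by (auto simp: eventually_sequentially)
  show "\<exists>n. \<forall>a\<in>free_semigroup N. n \<le> length a \<longrightarrow> correlation \<phi> w f g a < \<epsilon>"
  proof (intro exI[of _ n] ballI impI)
    fix a assume a: "a \<in> free_semigroup N" "n \<le> length a"
    have aJ: "j \<in> {1..N}" if "j \<in> set a" for j using a that by (auto simp: free_semigroup_def)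
    have T: "disc_map (semigroup_action \<phi> a)" "semigroup_action \<phi> a w = w"
      using aJ \<phi> by (auto intro: disc_map_semigroup_action semigroup_action_fixes)
    have "correlation \<phi> w p q a \<le> C * exp (- \<kappa> * real (length a)) * holder_norm \<alpha> p * holder_norm \<alpha> q"
      by (intro decay laurent_holder p q \<alpha> a)
    also have "\<dots> = exp (- \<kappa> * real (length a)) * D" by (simp add: D_def)
    also have "\<dots> < \<epsilon> / 3" by (rule n[OF a(2)])
    finally show "correlation \<phi> w f g a < \<epsilon>"
      using correlation_approx[OF T w f g pL qL] 1 2 by linarith
  qed
qed

section \<open>Rotations\<close>

text \<open>
  In the equality case of the Schwarz lemma \<open>\<phi> j\<close> acts as multiplication by a unimodular \<open>c\<close> in
  the coordinate \<open>blaschke w\<close>. On the circle this coordinate is unimodular and it has mean \<open>0\<close>.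
\<close>

lemma correlation_rotation:
  assumes \<phi>: "disc_map (\<phi> j)" "\<phi> j w = w" and w: "norm w < 1" and d: "norm (deriv (\<phi> j) w) = 1"
  shows "correlation \<phi> w (blaschke w) (blaschke w) (replicate n j) = 1"
proof -
  obtain c where c: "norm c = 1" "\<And>z. norm z < 1 \<Longrightarrow> blaschke w (\<phi> j z) = c * blaschke w z"
    using schwarz_pick_fixed_point(3)[OF \<phi>(1) w \<phi>(2) d] by blast
  \<comment> \<open>The Schwarz lemma speaks about the open disc; the identity extends to the circle by continuity.\<close>
  have ext: "blaschke w (\<phi> j z) = c * blaschke w z" if "norm z \<le> 1" for z
  proof -
    have "continuous_on (cball 0 1) (\<lambda>z. blaschke w (\<phi> j z) - c * blaschke w z)"
      by (intro continuous_intros blaschke_continuous w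
          continuous_on_compose2[OF blaschke_continuous[OF w] disc_mapD(1)[OF \<phi>(1)]])
         (use disc_mapD(5)[OF \<phi>(1)] in auto)
    then have cont: "continuous_on (closure (ball 0 1)) (\<lambda>z. blaschke w (\<phi> j z) - c * blaschke w z)" by simp
    have "z \<in> closure (ball 0 1)" using that by simp
    from continuous_constant_on_closure[OF cont _ this, of 0] c
    have "blaschke w (\<phi> j z) - c * blaschke w z = 0" by auto
    then show ?thesis by simp
  qed
  have it: "blaschke w (semigroup_action \<phi> (replicate n j) z) = c ^ n * blaschke w z" if "norm z \<le> 1" for z
    using that
  proof (induction n arbitrary: z)
    case (Suc n)
    then show ?case using disc_mapD(5)[OF \<phi>(1) Suc.prems] ext[OF Suc.prems] by simp
  qed simp
  interpret finite_measure "harmonic_measure w" by (rule finite_measure_harmonic[OF w])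
  have "(LINT z|harmonic_measure w. blaschke w (semigroup_action \<phi> (replicate n j) z) * cnj (blaschke w z)) = (LINT z|harmonic_measure w. c ^ n)"
  proof (rule Bochner_Integration.integral_cong[OF refl])
    fix z assume "z \<in> space (harmonic_measure w)"
    then have z: "norm z = 1" by (simp add: space_harmonic)
    have "blaschke w z * cnj (blaschke w z) = 1"
      using blaschke_sphere[OF w z] by (simp add: complex_norm_square[symmetric])
    then show "blaschke w (semigroup_action \<phi> (replicate n j) z) * cnj (blaschke w z) = c ^ n"
      using it[of z] z by (simp add: mult.assoc)
  qed
  also have "\<dots> = c ^ n" by (simp add: space_harmonic measure_harmonic[OF w])
  finally have 1: "(LINT z|harmonic_measure w. blaschke w (semigroup_action \<phi> (replicate n j) z) * cnj (blaschke w z)) = c ^ n" .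
  have "(LINT z|harmonic_measure w. blaschke w z) = 0"
    using poisson_integral_holomorphic[OF blaschke_continuous[OF w] blaschke_holomorphic[OF w] w] by simp
  then show ?thesis using 1 c(1) by (simp add: correlation_def norm_power)
qed

lemma blaschke_lipschitz:
  assumes w: "norm w < 1" and x: "norm x = 1" and y: "norm y = 1"
  shows "norm (blaschke w x - blaschke w y) \<le> 1 / (1 - norm w)\<^sup>2 * norm (x - y)"
proof -
  have b: "1 - norm w \<le> norm (1 - cnj w * x)" "1 - norm w \<le> norm (1 - cnj w * y)"
    using blaschke_denominator(1)[OF w] x y by auto
  have p: "0 < 1 - norm w" using w by simp
  have "(norm w)\<^sup>2 \<le> 1" using w by (simp add: abs_square_le_1)
  then have "norm (x - y) * (1 - (norm w)\<^sup>2) / (norm (1 - cnj w * x) * norm (1 - cnj w * y))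
      \<le> norm (x - y) * 1 / ((1 - norm w) * (1 - norm w))"
    using b p by (intro frac_le mult_mono mult_pos_pos mult_nonneg_nonneg) auto
  then show ?thesis using norm_blaschke_diff[OF w, of x y] x y by (simp add: power2_eq_square)
qed

lemma rotation_not_mixing:
  assumes \<phi>: "disc_map (\<phi> j)" "\<phi> j w = w" and w: "norm w < 1" and d: "norm (deriv (\<phi> j) w) = 1" and j: "j \<in> {1..N}"
  shows "\<not> mixing N \<phi> w"
proof
  assume "mixing N \<phi> w"
  moreover have "blaschke w \<in> L2_functions (harmonic_measure w)"
    by (rule L2_continuous[OF finite_measure_harmonic[OF w] sets_harmonic])
       (rule continuous_on_subset[OF blaschke_continuous[OF w]], auto)
  ultimately obtain n where n: "\<And>a. a \<in> free_semigroup N \<Longrightarrow> n \<le> length a \<Longrightarrow> correlation \<phi> w (blaschke w) (blaschke w) a < 1"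
    unfolding mixing_def by (metis zero_less_one)
  have "replicate (Suc n) j \<in> free_semigroup N" using j by (auto simp: free_semigroup_def)
  from n[OF this] correlation_rotation[where \<phi> = \<phi> and j = j, OF \<phi> w d, of "Suc n"] show False by simp
qed

lemma rotation_not_exponentially_mixing:
  assumes \<phi>: "disc_map (\<phi> j)" "\<phi> j w = w" and w: "norm w < 1" and d: "norm (deriv (\<phi> j) w) = 1" and j: "j \<in> {1..N}"
    and \<alpha>: "0 < \<alpha>" "\<alpha> \<le> 1"
  shows "\<not> exponentially_mixing \<alpha> N \<phi> w"
proof
  assume "exponentially_mixing \<alpha> N \<phi> w"
  then obtain \<kappa> C where kC: "\<kappa> > 0" "C > 0" and decay: "\<And>f g a. f \<in> holder_space \<alpha> \<Longrightarrow> g \<in> holder_space \<alpha> \<Longrightarrow> a \<in> free_semigroup N \<Longrightarrow>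
      correlation \<phi> w f g a \<le> C * exp (- \<kappa> * real (length a)) * holder_norm \<alpha> f * holder_norm \<alpha> g"
    unfolding exponentially_mixing_def by blast
  have bH: "blaschke w \<in> holder_space \<alpha>"
    by (rule lipschitz_imp_holder[OF \<alpha> _ blaschke_lipschitz[OF w]]) auto
  define D where "D = C * holder_norm \<alpha> (blaschke w) * holder_norm \<alpha> (blaschke w)"
  have "(\<lambda>n. exp (- \<kappa> * real (Suc n)) * D) \<longlonglongrightarrow> 0" using kC by real_asymp
  then have "\<forall>\<^sub>F n in sequentially. exp (- \<kappa> * real (Suc n)) * D < 1" by (intro order_tendstoD) auto
  then obtain n where n: "exp (- \<kappa> * real (Suc n)) * D < 1"
    by (auto simp: eventually_sequentially)
  have "replicate (Suc n) j \<in> free_semigroup N" using j by (auto simp: free_semigroup_def)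
  from decay[OF bH bH this] have "1 \<le> exp (- \<kappa> * real (Suc n)) * D"
    by (simp only: correlation_rotation[where \<phi> = \<phi> and j = j, OF \<phi> w d] length_replicate D_def mult_ac)
  with n show False by simp
qed

section \<open>Fourier coefficients and weighted norms\<close>

lemma fourier_coeff_laurent:
  assumes "finite K"
  shows "fourier_coeff (\<lambda>z. \<Sum>k\<in>K. c k * z powi k) l = (if l \<in> K then c l else 0)"
proof -
  have mono: "(LINT z|circle_measure. z powi k) = (if k = 0 then 1 else 0)" for k
    using integral_powi_disc_map[OF disc_map_id, of 0 k] by (auto simp: circle_eq_harmonic[symmetric])
  have "fourier_coeff (\<lambda>z. \<Sum>k\<in>K. c k * z powi k) l = (LINT z|circle_measure. (\<Sum>k\<in>K. c k * z powi (k - l)))"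
    unfolding fourier_coeff_def
  proof (rule Bochner_Integration.integral_cong[OF refl])
    fix z assume "z \<in> space circle_measure"
    then have "z \<noteq> 0" by (auto simp: space_circle)
    then show "(\<Sum>k\<in>K. c k * z powi k) * z powi - l = (\<Sum>k\<in>K. c k * z powi (k - l))"
      by (simp add: sum_distrib_right power_int_diff power_int_minus divide_inverse mult.assoc)
  qed
  also have "\<dots> = (\<Sum>k\<in>K. LINT z|circle_measure. c k * z powi (k - l))"
    by (rule Bochner_Integration.integral_sum)
       (intro integrable_mult_right integrable_circle_continuous continuous_powi)
  also have "\<dots> = (\<Sum>k\<in>K. if k = l then c k else 0)"
    by (intro sum.cong refl) (simp add: mono)
  also have "\<dots> = (if l \<in> K then c l else 0)" using assms by (simp add: sum.delta)
  finally show ?thesis .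
qed

lemma theta_term_nonneg: "0 < \<theta> \<Longrightarrow> 0 \<le> theta_term \<theta> f k"
  by (simp add: theta_term_def)

lemma theta_norm_nonneg: "0 < \<theta> \<Longrightarrow> 0 \<le> theta_norm \<theta> f"
  unfolding theta_norm_def by (auto intro!: infsum_nonneg theta_term_nonneg)

lemma theta_norm_square:
  "0 < \<theta> \<Longrightarrow> (theta_norm \<theta> f)\<^sup>2 = (\<Sum>\<^sub>\<infinity>k. theta_term \<theta> f k)"
  unfolding theta_norm_def by (rule real_sqrt_pow2) (auto intro!: infsum_nonneg theta_term_nonneg)

lemma theta_term_laurent:
  fixes c :: "int \<Rightarrow> complex"
  assumes "finite K"
  defines "p \<equiv> \<lambda>z. \<Sum>k\<in>K. c k * z powi k"
  shows "theta_term \<theta> p summable_on UNIV"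
    and "(\<Sum>\<^sub>\<infinity>k. theta_term \<theta> p k) = (\<Sum>k\<in>K. (norm (c k))\<^sup>2 * \<theta> powi (- 2 * \<bar>k\<bar>))"
proof -
  have t: "theta_term \<theta> p k = (if k \<in> K then (norm (c k))\<^sup>2 * \<theta> powi (- 2 * \<bar>k\<bar>) else 0)" for k
    unfolding theta_term_def p_def fourier_coeff_laurent[OF assms(1)] by simp
  have "theta_term \<theta> p summable_on K" using assms(1) by (rule summable_on_finite)
  then show "theta_term \<theta> p summable_on UNIV"
    using summable_on_cong_neutral[of UNIV K "theta_term \<theta> p" "theta_term \<theta> p"] t by auto
  have "(\<Sum>\<^sub>\<infinity>k. theta_term \<theta> p k) = infsum (theta_term \<theta> p) K"
    by (rule infsum_cong_neutral) (auto simp: t)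
  also have "\<dots> = (\<Sum>k\<in>K. (norm (c k))\<^sup>2 * \<theta> powi (- 2 * \<bar>k\<bar>))"
    using assms(1) by (simp add: infsum_finite t)
  finally show "(\<Sum>\<^sub>\<infinity>k. theta_term \<theta> p k) = \<dots>" .
qed

lemma laurent_theta_space:
  assumes "p \<in> laurent_polynomials"
  shows "p \<in> theta_space \<theta>"
proof -
  have "p \<in> L2_functions circle_measure"
    by (rule laurent_L2[OF circle.finite_measure_axioms refl assms])
  moreover have "theta_term \<theta> (\<lambda>z. p z - p z) = (\<lambda>_. 0)"
    by (simp add: theta_term_def fourier_coeff_def fun_eq_iff)
  ultimately show ?thesis
    using assms by (auto simp: theta_space_def theta_norm_def intro!: bexI[of _ p])
qed

lemma theta_norm_monomial:
  assumes "0 < \<theta>"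
  shows "theta_norm \<theta> (\<lambda>z. z powi k) = \<theta> powi (- \<bar>k\<bar>)"
proof -
  have "theta_norm \<theta> (\<lambda>z. \<Sum>i\<in>{k}. 1 * z powi i) = sqrt (\<theta> powi (- 2 * \<bar>k\<bar>))"
    unfolding theta_norm_def theta_term_laurent(2)[OF finite.insertI[OF finite.emptyI]] by simp
  also have "\<theta> powi (- 2 * \<bar>k\<bar>) = (\<theta> powi (- \<bar>k\<bar>))\<^sup>2"
    by (simp add: power_int_power' mult.commute)
  finally show ?thesis using assms by simp
qed

lemma integrable_L2_powi:
  assumes "h \<in> L2_functions circle_measure"
  shows "integrable circle_measure (\<lambda>z. h z * z powi k)"
  by (intro L2_mult_integrable assms L2_continuous[OF circle.finite_measure_axioms refl continuous_powi])

lemma fourier_coeff_diff: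
  assumes "f \<in> L2_functions circle_measure" "g \<in> L2_functions circle_measure"
  shows "fourier_coeff (\<lambda>z. f z - g z) k = fourier_coeff f k - fourier_coeff g k"
  unfolding fourier_coeff_def left_diff_distrib
  by (rule Bochner_Integration.integral_diff) (intro integrable_L2_powi assms)+

lemma integral_times_cnj_laurent:
  assumes h: "h \<in> L2_functions circle_measure"
  shows "(LINT z|circle_measure. h z * cnj (\<Sum>k\<in>K. c k * z powi k)) = (\<Sum>k\<in>K. cnj (c k) * fourier_coeff h k)"
proof -
  have "(LINT z|circle_measure. h z * cnj (\<Sum>k\<in>K. c k * z powi k)) = (LINT z|circle_measure. (\<Sum>k\<in>K. cnj (c k) * (h z * z powi (- k))))"
    by (rule Bochner_Integration.integral_cong[OF refl])
       (simp add: space_circle sum_distrib_left cnj_powi_circle mult_ac del: complex_cnj_power_int)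
  also have "\<dots> = (\<Sum>k\<in>K. LINT z|circle_measure. cnj (c k) * (h z * z powi (- k)))"
    by (rule Bochner_Integration.integral_sum) (intro integrable_mult_right integrable_L2_powi h)
  finally show ?thesis by (simp add: fourier_coeff_def)
qed

lemma one_le_theta_weight:
  assumes "0 < \<theta>" "\<theta> \<le> (1::real)"
  shows "1 \<le> \<theta> powi (- 2 * \<bar>k\<bar>)"
proof -
  have "\<theta> powi (- 2 * \<bar>k\<bar>) = inverse (\<theta> powi (2 * \<bar>k\<bar>))" by (simp add: power_int_minus)
  moreover have "\<theta> powi (2 * \<bar>k\<bar>) \<le> 1" using assms by (intro power_int_le_one) auto
  moreover have "0 < \<theta> powi (2 * \<bar>k\<bar>)" using assms by simp
  ultimately show ?thesis by (simp add: one_le_inverse)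
qed

text \<open>
  This is the nontrivial half of Parseval's identity, with weights at least \<open>1\<close> inserted. If
  \<open>q\<close> is a Laurent polynomial with frequencies in \<open>K\<close>, then \<open>\<integral>\<bar>h - q\<bar>\<^sup>2\<close> is at least \<open>\<integral>\<bar>h\<bar>\<^sup>2\<close> minus the
  squares of the coefficients of \<open>h\<close> in \<open>K\<close>, and by density the left-hand side can be made
  arbitrarily small.
\<close>

lemma integral_square_le_theta_norm:
  assumes h: "h \<in> L2_functions circle_measure" and \<theta>: "0 < \<theta>" "\<theta> \<le> 1"
    and s: "theta_term \<theta> h summable_on UNIV"
  shows "(LINT z|circle_measure. (norm (h z))\<^sup>2) \<le> (theta_norm \<theta> h)\<^sup>2"
proof (rule field_le_epsilon)
  fix e :: real assume e: "0 < e"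
  obtain q where q: "q \<in> laurent_polynomials" "(LINT z|circle_measure. (norm (h z - q z))\<^sup>2) < e"
    using laurent_L2_dense[OF circle.finite_measure_axioms refl h e] by blast
  obtain c K where qd: "q = (\<lambda>z. \<Sum>k\<in>K. c k * z powi k)" and K: "finite (K :: int set)"
    using q(1) unfolding laurent_polynomials_def by blast
  have qL: "q \<in> L2_functions circle_measure"
    by (rule laurent_L2[OF circle.finite_measure_axioms refl q(1)])
  let ?H = "fourier_coeff h"
  have hq: "(LINT z|circle_measure. h z * cnj (q z)) = (\<Sum>k\<in>K. cnj (c k) * ?H k)"
    unfolding qd by (rule integral_times_cnj_laurent[OF h])
  have qq: "(LINT z|circle_measure. q z * cnj (q z)) = (\<Sum>k\<in>K. cnj (c k) * c k)"
    using integral_times_cnj_laurent[OF qL, of c K] fourier_coeff_laurent[OF K, of c]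
    by (simp add: qd cong: sum.cong)
  have iq: "integrable circle_measure (\<lambda>z. (norm (q z))\<^sup>2)" "integrable circle_measure (\<lambda>z. (norm (h z))\<^sup>2)"
    by (intro L2_integrable qL h)+
  have ihq: "integrable circle_measure (\<lambda>z. h z * cnj (q z))"
    by (intro L2_mult_integrable L2_cnj h qL)
  have iqq: "(LINT z|circle_measure. (norm (q z))\<^sup>2) = (\<Sum>k\<in>K. (norm (c k))\<^sup>2)"
  proof -
    have "complex_of_real (LINT z|circle_measure. (norm (q z))\<^sup>2) = (LINT z|circle_measure. q z * cnj (q z))"
      by (simp only: integral_complex_of_real[symmetric] complex_norm_square)
    also have "\<dots> = complex_of_real (\<Sum>k\<in>K. (norm (c k))\<^sup>2)"
      unfolding qq of_real_sum complex_norm_square by (simp add: mult.commute)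
    finally show ?thesis by (simp only: of_real_eq_iff)
  qed
  have sq: "(norm (u - v))\<^sup>2 = (norm u)\<^sup>2 - 2 * Re (u * cnj v) + (norm v)\<^sup>2" for u v :: complex
    unfolding cmod_power2 by (simp add: power2_eq_square algebra_simps)
  have "(LINT z|circle_measure. (norm (h z - q z))\<^sup>2) =
      (LINT z|circle_measure. (norm (h z))\<^sup>2) - 2 * Re (LINT z|circle_measure. h z * cnj (q z)) + (LINT z|circle_measure. (norm (q z))\<^sup>2)"
  proof -
    define R where "R = (\<lambda>z. Re (h z * cnj (q z)))"
    have "integrable circle_measure R" "(LINT z|circle_measure. R z) = Re (LINT z|circle_measure. h z * cnj (q z))"
      unfolding R_def using integrable_Re[OF ihq] integral_Re[OF ihq] by auto
    moreover have "(norm (h z - q z))\<^sup>2 = (norm (h z))\<^sup>2 - 2 * R z + (norm (q z))\<^sup>2" for z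
      unfolding R_def by (rule sq)
    ultimately show ?thesis using iq by simp
  qed
  also have "\<dots> = (LINT z|circle_measure. (norm (h z))\<^sup>2) + (\<Sum>k\<in>K. (norm (?H k - c k))\<^sup>2 - (norm (?H k))\<^sup>2)"
    unfolding hq iqq sq by (simp add: sum_subtractf sum.distrib sum_distrib_left mult.commute)
  also have "\<dots> \<ge> (LINT z|circle_measure. (norm (h z))\<^sup>2) - (\<Sum>k\<in>K. (norm (?H k))\<^sup>2)"
    by (simp add: sum_subtractf sum_nonneg)
  finally have "(LINT z|circle_measure. (norm (h z))\<^sup>2) \<le> (\<Sum>k\<in>K. (norm (?H k))\<^sup>2) + e" using q(2) by linarith
  also have "(\<Sum>k\<in>K. (norm (?H k))\<^sup>2) \<le> (\<Sum>k\<in>K. theta_term \<theta> h k)"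
    unfolding theta_term_def using one_le_theta_weight[OF \<theta>] by (intro sum_mono) (simp add: mult_le_cancel_left1)
  also have "\<dots> \<le> (\<Sum>\<^sub>\<infinity>k. theta_term \<theta> h k)"
    using \<theta> by (intro finite_sum_le_infsum s K) (auto intro: theta_term_nonneg)
  also have "\<dots> = (theta_norm \<theta> h)\<^sup>2" using \<theta> by (simp add: theta_norm_square)
  finally show "(LINT z|circle_measure. (norm (h z))\<^sup>2) \<le> (theta_norm \<theta> h)\<^sup>2 + e" by simp
qed

text \<open>
  The inequality \<open>\<bar>a + b\<bar>\<^sup>2 \<le> 2 \<bar>a\<bar>\<^sup>2 + 2 \<bar>b\<bar>\<^sup>2\<close> replaces the triangle inequality for the weighted norm;
  the lost factor only affects constants.
\<close>

lemma theta_space_approx: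
  assumes f: "f \<in> theta_space \<theta>" and \<theta>: "0 < \<theta>" "\<theta> \<le> 1" and e: "0 < e"
  shows "\<exists>p\<in>laurent_polynomials. (LINT z|circle_measure. (norm (f z - p z))\<^sup>2) \<le> e\<^sup>2 \<and>
     (theta_norm \<theta> p)\<^sup>2 \<le> 2 * (theta_norm \<theta> f)\<^sup>2 + 2 * e\<^sup>2"
proof -
  have fL: "f \<in> L2_functions circle_measure" using f by (simp add: theta_space_def)
  obtain p where p: "p \<in> laurent_polynomials" "theta_term \<theta> (\<lambda>z. f z - p z) summable_on UNIV"
    "theta_norm \<theta> (\<lambda>z. f z - p z) < e" using f e by (auto simp: theta_space_def)
  have pL: "p \<in> L2_functions circle_measure"
    by (rule laurent_L2[OF circle.finite_measure_axioms refl p(1)])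
  have dL: "(\<lambda>z. f z - p z) \<in> L2_functions circle_measure" by (rule L2_diff[OF fL pL])
  have n0: "0 \<le> theta_norm \<theta> (\<lambda>z. f z - p z)"
    by (rule theta_norm_nonneg[OF \<theta>(1)])
  have e2: "(theta_norm \<theta> (\<lambda>z. f z - p z))\<^sup>2 \<le> e\<^sup>2" using n0 p(3) by (intro power_mono) auto
  have 1: "(LINT z|circle_measure. (norm (f z - p z))\<^sup>2) \<le> e\<^sup>2"
    using integral_square_le_theta_norm[OF dL \<theta> p(2)] e2 by linarith
  have W: "0 \<le> \<theta> powi (- 2 * \<bar>k\<bar>)" for k using \<theta> by simp
  have cmp: "(norm (a + b))\<^sup>2 * \<theta> powi (- 2 * \<bar>k\<bar>) \<le> 2 * ((norm a)\<^sup>2 * \<theta> powi (- 2 * \<bar>k\<bar>)) + 2 * ((norm b)\<^sup>2 * \<theta> powi (- 2 * \<bar>k\<bar>))"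
    for a b :: complex and k
    using mult_right_mono[OF norm_add_square_le[of a b] W[of k]] by (simp add: distrib_right)
  have ps: "theta_term \<theta> p summable_on UNIV"
    using p(1) theta_term_laurent(1) unfolding laurent_polynomials_def by blast
  have le: "theta_term \<theta> f k \<le> 2 * theta_term \<theta> p k + 2 * theta_term \<theta> (\<lambda>z. f z - p z) k" for k
    using cmp[of "fourier_coeff p k" "fourier_coeff f k - fourier_coeff p k" k]
    by (simp add: theta_term_def fourier_coeff_diff[OF fL pL])
  have fs: "theta_term \<theta> f summable_on UNIV"
    by (rule summable_on_comparison_test[OF
          summable_on_add[OF summable_on_cmult_right[OF ps] summable_on_cmult_right[OF p(2)]] le])
       (rule theta_term_nonneg[OF \<theta>(1)])
  have "theta_term \<theta> p k \<le> 2 * theta_term \<theta> f k + 2 * theta_term \<theta> (\<lambda>z. f z - p z) k" for k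
    using cmp[of "fourier_coeff f k" "- (fourier_coeff f k - fourier_coeff p k)" k]
    by (simp add: theta_term_def fourier_coeff_diff[OF fL pL] norm_minus_commute)
  then have "(\<Sum>\<^sub>\<infinity>k. theta_term \<theta> p k) \<le> (\<Sum>\<^sub>\<infinity>k. 2 * theta_term \<theta> f k + 2 * theta_term \<theta> (\<lambda>z. f z - p z) k)"
    by (intro infsum_mono ps summable_on_add summable_on_cmult_right fs p(2)) auto
  also have "\<dots> = 2 * (\<Sum>\<^sub>\<infinity>k. theta_term \<theta> f k) + 2 * (\<Sum>\<^sub>\<infinity>k. theta_term \<theta> (\<lambda>z. f z - p z) k)"
    using fs p(2) by (simp add: infsum_add infsum_cmult_right summable_on_cmult_right)
  finally have "(theta_norm \<theta> p)\<^sup>2 \<le> 2 * (theta_norm \<theta> f)\<^sup>2 + 2 * (theta_norm \<theta> (\<lambda>z. f z - p z))\<^sup>2"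
    using \<theta> by (simp add: theta_norm_square)
  then show ?thesis using p(1) 1 e2 by (intro bexI[of _ p]) auto
qed

section \<open>Superattracting fixed points\<close>

text \<open>
  Dividing out the zero at the fixed point keeps continuity up to the circle, which Cauchy's
  formulas on the unit circle require.
\<close>

lemma removable_quotient:
  fixes U :: "complex \<Rightarrow> complex"
  assumes c: "continuous_on (cball 0 1) U" and h: "U holomorphic_on ball 0 1" and w: "norm w < 1" and U0: "U w = 0"
  obtains H where "continuous_on (cball 0 1) H" "H holomorphic_on ball 0 1" "H w = deriv U w"
    "\<And>z. z \<noteq> w \<Longrightarrow> H z = U z / (z - w)"
proof -
  define H where "H = (\<lambda>z. if z = w then deriv U w else (U z - U w) / (z - w))"
  have hol: "H holomorphic_on ball 0 1" unfolding H_def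
    by (rule pole_lemma[OF h]) (use w in auto)
  have c1: "continuous_on (ball 0 1) H" by (rule holomorphic_on_imp_continuous_on[OF hol])
  have "continuous_on (cball 0 1 - {w}) (\<lambda>z. (U z - U w) / (z - w))"
    by (intro continuous_intros continuous_on_subset[OF c]) auto
  then have c2: "continuous_on (cball 0 1 - {w}) H"
    by (rule continuous_on_eq) (auto simp: H_def)
  have un: "ball 0 1 \<union> (cball 0 1 - {w}) = cball 0 1" using w by auto
  have "continuous_on (ball 0 1 \<union> (cball 0 1 - {w})) H"
    by (rule continuous_on_Un_local_open[OF _ _ c1 c2])
       (auto simp: un intro: open_subset openin_delete openin_subtopology_self)
  then have "continuous_on (cball 0 1) H" by (simp only: un)
  then show thesis using that[of H] hol by (auto simp: H_def U0)
qed

text \<open>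
  With multiplier \<open>0\<close> the Schwarz-Pick bound squares \<open>\<bar>blaschke w z\<bar>\<close>, and squaring is
  iterated once for each letter.
\<close>

lemma superattracting_contraction:
  assumes \<phi>: "\<And>j. j \<in> set a \<Longrightarrow> disc_map (\<phi> j)" "\<And>j. j \<in> set a \<Longrightarrow> \<phi> j w = w"
    "\<And>j. j \<in> set a \<Longrightarrow> deriv (\<phi> j) w = 0" and w: "norm w < 1" and z: "norm z < 1"
  shows "norm (blaschke w (semigroup_action \<phi> a z)) \<le> norm (blaschke w z) ^ (2 ^ length a)"
  using \<phi> z
proof (induction a arbitrary: z)
  case (Cons j a)
  have j: "disc_map (\<phi> j)" "\<phi> j w = w" "deriv (\<phi> j) w = 0" using Cons.prems by auto
  have "norm (blaschke w (semigroup_action \<phi> a (\<phi> j z))) \<le> norm (blaschke w (\<phi> j z)) ^ (2 ^ length a)"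
    by (rule Cons.IH) (use Cons.prems disc_mapD(3)[OF j(1) Cons.prems(4)] in auto)
  also have "\<dots> \<le> (norm (blaschke w z) * norm (blaschke w z)) ^ (2 ^ length a)"
    using schwarz_pick_fixed_point(2)[OF j(1) w j(2) Cons.prems(4)] j(3) by (intro power_mono) auto
  also have "\<dots> = norm (blaschke w z) ^ (2 ^ length (j # a))"
    by (simp add: power_mult power2_eq_square[symmetric])
  finally show ?case by simp
qed simp

text \<open>
  On the circle \<open>cnj (z ^ Suc k) = 1 / z ^ Suc k\<close>, so with the rational form of the Poisson kernel
  the correlation is the \<open>k\<close>-th Taylor coefficient at \<open>0\<close> of a function \<open>V\<close>. The pole of the kernel at
  \<open>w\<close> is cancelled by the zero of the centred power. Cauchy's estimate is applied on the circle of
  radius \<open>r\<close>, halfway between \<open>\<bar>w\<bar>\<close> and \<open>1\<close>, on which \<open>\<bar>blaschke w z\<bar> \<le> s\<close>.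
\<close>

lemma correlation_monomials_pos:
  assumes \<phi>: "\<And>j. j \<in> set a \<Longrightarrow> disc_map (\<phi> j)" "\<And>j. j \<in> set a \<Longrightarrow> \<phi> j w = w"
    "\<And>j. j \<in> set a \<Longrightarrow> deriv (\<phi> j) w = 0" and w: "norm w < 1"
  defines "r \<equiv> (1 + norm w) / 2"
  defines "s \<equiv> (r + norm w) / (1 + norm w * r)"
  shows "correlation \<phi> w (\<lambda>z. z powi int m) (\<lambda>z. z powi int (Suc k)) a
    \<le> 8 / (1 - norm w)\<^sup>2 * 2 ^ m * 2 ^ k * s ^ (2 ^ length a)"
proof -
  let ?T = "semigroup_action \<phi> a"
  have T: "disc_map ?T" by (rule disc_map_semigroup_action[OF \<phi>(1)])
  have Tw: "?T w = w" by (rule semigroup_action_fixes) (rule \<phi>(2))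
  have r: "norm w < r" "r < 1" "1 / 2 \<le> r" "0 < r" using w norm_ge_zero[of w] by (auto simp: r_def simp del: norm_ge_zero)
  have s: "0 < s" unfolding s_def using r by (intro divide_pos_pos add_pos_nonneg) auto
  define h where "h = (\<lambda>z. ?T z ^ m - w ^ m)"
  have ch: "continuous_on (cball 0 1) h" and hh: "h holomorphic_on ball 0 1"
    unfolding h_def by (intro continuous_intros holomorphic_intros disc_mapD[OF T])+
  have hw: "h w = 0" by (simp add: h_def Tw)
  have chs: "continuous_on (sphere 0 1) h" by (rule continuous_on_subset[OF ch]) auto
  obtain H where H: "continuous_on (cball 0 1) H" "H holomorphic_on ball 0 1" "\<And>z. z \<noteq> w \<Longrightarrow> H z = h z / (z - w)"
    using removable_quotient[OF ch hh w hw] by metis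
  let ?p = "complex_of_real (1 - (norm w)\<^sup>2)"
  define V where "V = (\<lambda>z. ?p * H z / (1 - cnj w * z))"
  have cV: "continuous_on (cball 0 1) V" and hV: "V holomorphic_on ball 0 1"
    unfolding V_def using blaschke_denominator(2)[OF w]
    by (intro continuous_intros holomorphic_intros H; auto)+
  have int_m: "(LINT z|harmonic_measure w. z ^ m) = w ^ m"
    by (rule poisson_integral_holomorphic[OF _ _ w]) (intro continuous_intros holomorphic_intros)+
  have centred: "correlation \<phi> w (\<lambda>z. z powi int m) (\<lambda>z. z powi int (Suc k)) a = norm (LINT z|harmonic_measure w. h z * cnj (z ^ Suc k))"
    using correlation_eq_centred[OF T w continuous_powi continuous_powi, of "int m" "int (Suc k)"]
    unfolding power_int_of_nat int_m h_def .
  have "(LINT z|harmonic_measure w. h z * cnj (z ^ Suc k)) = (LINT z|circle_measure. poisson w z * (h z * cnj (z ^ Suc k)))"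
    by (rule integral_harmonic[OF w measurable_circle_continuous]) (intro continuous_intros chs)
  also have "\<dots> = (LINT z|circle_measure. V z / z ^ k)"
  proof (rule Bochner_Integration.integral_cong[OF refl])
    fix z assume "z \<in> space circle_measure"
    then have z: "z \<in> sphere 0 1" "norm z = 1" by (auto simp: space_circle)
    have zw: "z \<noteq> w" "z \<noteq> 0" using z w by auto
    have cz: "cnj (z ^ Suc k) = 1 / (z * z ^ k)"
      using cnj_circle[OF z(1)] by (simp add: power_inverse field_simps)
    show "poisson w z * (h z * cnj (z ^ Suc k)) = V z / z ^ k"
      unfolding poisson_circle_eq(2)[OF w z(1)] cz V_def H(3)[OF zw(1)] using zw by simp
  qed
  also have "\<dots> = (deriv ^^ k) V 0 / fact k" by (rule taylor_coeff_circle[OF cV hV])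
  finally have corr: "correlation \<phi> w (\<lambda>z. z powi int m) (\<lambda>z. z powi int (Suc k)) a = norm ((deriv ^^ k) V 0 / fact k)"
    unfolding centred by (simp only:)
  let ?M = "8 / (1 - norm w)\<^sup>2 * 2 ^ m * s ^ (2 ^ length a)"
  have "norm ((deriv ^^ k) V 0) \<le> fact k * ?M / r ^ k"
  proof (rule Cauchy_inequality)
    show "V holomorphic_on ball 0 r" by (rule holomorphic_on_subset[OF hV]) (use r in auto)
    show "continuous_on (cball 0 r) V" by (rule continuous_on_subset[OF cV]) (use r in auto)
    show "0 < r" by (rule r)
    fix z :: complex assume "norm (0 - z) = r"
    then have z: "norm z = r" by simp
    have z1: "norm z < 1" using z r by simp
    have zw: "z \<noteq> w" using z r by auto
    have e: "0 < 1 - norm w" using w by simp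
    have bz: "norm (blaschke w z) \<le> s" using norm_blaschke_le[OF w, of z] z r by (simp add: s_def)
    have Tz: "norm (?T z) < 1" by (rule disc_mapD(3)[OF T z1])
    have "norm (?T z - w) = norm (blaschke w (?T z)) * norm (1 - cnj w * ?T z)"
      using blaschke_denominator(2)[OF w, of "?T z"] Tz by (simp add: blaschke_def norm_divide)
    also have "\<dots> \<le> s ^ (2 ^ length a) * 2"
    proof (intro mult_mono)
      show "norm (blaschke w (?T z)) \<le> s ^ (2 ^ length a)"
        using superattracting_contraction[where a = a and \<phi> = \<phi>, OF \<phi> w z1] power_mono[OF bz norm_ge_zero, of "2 ^ length a"] by linarith
      have "norm (cnj w * ?T z) \<le> 1 * 1" unfolding norm_mult using w Tz by (intro mult_mono) auto
      then show "norm (1 - cnj w * ?T z) \<le> 2" using norm_triangle_ineq4[of 1 "cnj w * ?T z"] by simp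
    qed (use s in auto)
    finally have Tw2: "norm (?T z - w) \<le> 2 * s ^ (2 ^ length a)" by simp
    have "norm (h z) \<le> real m * norm (?T z - w)"
      unfolding h_def using Tz w by (intro norm_power_diff) auto
    also have "\<dots> \<le> 2 ^ m * (2 * s ^ (2 ^ length a))"
      using Tw2 s of_nat_less_two_power[of m, where 'a=real] by (intro mult_mono) auto
    finally have hz: "norm (h z) \<le> 2 * 2 ^ m * s ^ (2 ^ length a)" by simp
    have zw2: "(1 - norm w) / 2 \<le> norm (z - w)"
      using norm_triangle_ineq2[of z w] z by (simp add: r_def field_simps)
    have pn: "norm ?p \<le> 1"
    proof -
      have "(norm w)\<^sup>2 \<le> 1" using w by (simp add: abs_square_le_1)
      then show ?thesis unfolding norm_of_real by simp
    qed
    have d: "1 - norm w \<le> norm (1 - cnj w * z)" using blaschke_denominator(1)[OF w, of z] z1 by simp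
    have "norm (V z) = norm ?p * (norm (h z) / norm (z - w)) / norm (1 - cnj w * z)"
      unfolding V_def H(3)[OF zw] norm_divide norm_mult ..
    also have "\<dots> \<le> 1 * ((2 * 2 ^ m * s ^ (2 ^ length a)) / ((1 - norm w) / 2)) / (1 - norm w)"
      using pn hz zw2 d e s by (intro frac_le mult_mono divide_nonneg_nonneg mult_nonneg_nonneg) auto
    also have "\<dots> = 4 / (1 - norm w)\<^sup>2 * 2 ^ m * s ^ (2 ^ length a)" by (simp add: power2_eq_square)
    also have "\<dots> \<le> ?M" using s e by (intro mult_right_mono divide_right_mono) auto
    finally show "norm (V z) \<le> ?M" .
  qed
  then have "norm ((deriv ^^ k) V 0 / fact k) \<le> ?M / r ^ k"
    by (simp add: norm_divide divide_le_eq mult.commute)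
  also have "?M / r ^ k = ?M * (1 / r) ^ k" by (simp add: power_divide)
  also have "\<dots> \<le> ?M * 2 ^ k"
    using r s by (intro mult_left_mono power_mono) (auto simp: field_simps)
  finally show ?thesis unfolding corr by (simp only: mult_ac)
qed

text \<open>
  Conjugation on the circle inverts monomials, which allows the exponent of the first
  monomial to be taken nonnegative.
\<close>

lemma correlation_monomials_swap:
  assumes T: "disc_map (semigroup_action \<phi> a)"
  shows "correlation \<phi> w (\<lambda>z. z powi j) (\<lambda>z. z powi k) a = correlation \<phi> w (\<lambda>z. z powi (- j)) (\<lambda>z. z powi (- k)) a"
proof -
  let ?I = "\<lambda>F. LINT z|harmonic_measure w. F z" and ?T = "semigroup_action \<phi> a"
  have c: "cnj (z powi i) = z powi (- i)" if "norm z = 1" for z :: complex and i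
    using cnj_powi_circle[of z i] that by simp
  have T1: "norm (?T z) = 1" if "norm z = 1" for z by (rule disc_mapD(4)[OF T that])
  have sw: "(LINT z|harmonic_measure w. F z) = cnj (LINT z|harmonic_measure w. G z)"
    if "\<And>z. norm z = 1 \<Longrightarrow> F z = cnj (G z)" for F G :: "complex \<Rightarrow> complex"
    unfolding Bochner_Integration.integral_cnj[symmetric]
    by (rule Bochner_Integration.integral_cong[OF refl]) (use that in \<open>simp add: space_harmonic\<close>)
  have 1: "?I (\<lambda>z. ?T z powi j * cnj (z powi k)) = cnj (?I (\<lambda>z. ?T z powi (- j) * cnj (z powi (- k))))"
    by (rule sw) (simp add: c T1 del: complex_cnj_power_int)
  have 2: "?I (\<lambda>z. z powi j) = cnj (?I (\<lambda>z. z powi (- j)))"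
    by (rule sw) (simp add: c del: complex_cnj_power_int)
  have 3: "?I (\<lambda>z. cnj (z powi k)) = cnj (?I (\<lambda>z. cnj (z powi (- k))))"
    by (rule sw) (simp add: c del: complex_cnj_power_int)
  show ?thesis unfolding correlation_def 1 2 3 complex_cnj_mult[symmetric] complex_cnj_diff[symmetric] complex_mod_cnj ..
qed

text \<open>
  When the two exponents have opposite signs, the integrand is a product of boundary values of
  holomorphic functions, and Poisson integrals of holomorphic functions are multiplicative.
\<close>

lemma correlation_analytic_zero:
  assumes T: "disc_map (semigroup_action \<phi> a)" "semigroup_action \<phi> a w = w" and w: "norm w < 1"
  shows "correlation \<phi> w (\<lambda>z. z powi int m) (\<lambda>z. z powi (- int l)) a = 0"
proof -
  let ?T = "semigroup_action \<phi> a"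
  have c: "cnj (z powi (- int l)) = z ^ l" if "norm z = 1" for z :: complex
    using cnj_powi_circle[of z "- int l"] that by simp
  have 1: "(LINT z|harmonic_measure w. ?T z ^ m * cnj (z powi (- int l))) = (LINT z|harmonic_measure w. ?T z ^ m * z ^ l)"
    by (rule Bochner_Integration.integral_cong[OF refl]) (simp add: space_harmonic c del: complex_cnj_power_int)
  have 2: "(LINT z|harmonic_measure w. cnj (z powi (- int l))) = (LINT z|harmonic_measure w. z ^ l)"
    by (rule Bochner_Integration.integral_cong[OF refl]) (simp add: space_harmonic c del: complex_cnj_power_int)
  have "(LINT z|harmonic_measure w. ?T z ^ m * z ^ l) = ?T w ^ m * w ^ l"
    by (rule poisson_integral_holomorphic[OF _ _ w]) (intro continuous_intros holomorphic_intros disc_mapD[OF T(1)])+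
  moreover have "(LINT z|harmonic_measure w. z ^ i) = w ^ i" for i
    by (rule poisson_integral_holomorphic[OF _ _ w]) (intro continuous_intros holomorphic_intros)+
  ultimately show ?thesis unfolding correlation_def power_int_of_nat 1 2 by (simp add: T(2))
qed

lemma correlation_monomials:
  assumes \<phi>: "\<And>j. j \<in> set a \<Longrightarrow> disc_map (\<phi> j)" "\<And>j. j \<in> set a \<Longrightarrow> \<phi> j w = w"
    "\<And>j. j \<in> set a \<Longrightarrow> deriv (\<phi> j) w = 0" and w: "norm w < 1"
  defines "r \<equiv> (1 + norm w) / 2"
  defines "s \<equiv> (r + norm w) / (1 + norm w * r)"
  shows "correlation \<phi> w (\<lambda>z. z powi j) (\<lambda>z. z powi k) a
    \<le> 8 / (1 - norm w)\<^sup>2 * s ^ (2 ^ length a) * (2 ^ nat \<bar>j\<bar> * 2 ^ nat \<bar>k\<bar>)"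
proof -
  let ?B = "\<lambda>j k. 8 / (1 - norm w)\<^sup>2 * s ^ (2 ^ length a) * (2 ^ nat \<bar>j\<bar> * 2 ^ nat \<bar>k\<bar>)"
  have T: "disc_map (semigroup_action \<phi> a)" "semigroup_action \<phi> a w = w"
    using \<phi> by (auto intro: disc_map_semigroup_action semigroup_action_fixes)
  have r: "0 < r" by (simp add: r_def add_pos_nonneg)
  have s: "0 < s" unfolding s_def using r by (intro divide_pos_pos add_pos_nonneg) auto
  have nonneg: "0 \<le> ?B j k" for j k :: int using s by simp
  have pos: "correlation \<phi> w (\<lambda>z. z powi int m) (\<lambda>z. z powi k) a \<le> ?B (int m) k" for m k
  proof (cases "0 < k")
    case True
    then obtain l where k: "k = int (Suc l)" by (metis gr0_implies_Suc nat_0_less_mult_iff zero_less_imp_eq_int)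
    have "correlation \<phi> w (\<lambda>z. z powi int m) (\<lambda>z. z powi int (Suc l)) a
        \<le> 8 / (1 - norm w)\<^sup>2 * 2 ^ m * 2 ^ l * s ^ (2 ^ length a)"
      unfolding s_def r_def
      by (rule correlation_monomials_pos) (use \<phi> w in auto)
    also have "\<dots> \<le> 8 / (1 - norm w)\<^sup>2 * 2 ^ m * 2 ^ Suc l * s ^ (2 ^ length a)"
      using s by (intro mult_right_mono mult_left_mono) auto
    also have "\<dots> = ?B (int m) (int (Suc l))"
      unfolding nat_int abs_of_nat by (simp only: mult_ac)
    finally show ?thesis unfolding k .
  next
    case False
    then obtain l where k: "k = - int l" by (metis nonpos_int_cases not_less)
    show ?thesis unfolding k correlation_analytic_zero[OF T w] by (rule nonneg)
  qed
  show ?thesis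
  proof (cases "0 \<le> j")
    case True
    then show ?thesis using pos[of "nat j" k] by simp
  next
    case False
    then show ?thesis using pos[of "nat (- j)" "- k"] correlation_monomials_swap[OF T(1), of w j k] by simp
  qed
qed

lemma correlation_laurent_le:
  assumes T: "disc_map (semigroup_action \<phi> a)" and w: "norm w < 1"
  shows "correlation \<phi> w (\<lambda>z. \<Sum>j\<in>J. c j * z powi j) (\<lambda>z. \<Sum>k\<in>K. d k * z powi k) a
    \<le> (\<Sum>j\<in>J. \<Sum>k\<in>K. norm (c j) * norm (d k) * correlation \<phi> w (\<lambda>z. z powi j) (\<lambda>z. z powi k) a)"
proof -
  let ?I = "\<lambda>F. LINT z|harmonic_measure w. F z" and ?T = "semigroup_action \<phi> a"
  let ?B = "\<lambda>j k. ?I (\<lambda>z. ?T z powi j * cnj (z powi k)) - ?I (\<lambda>z. z powi j) * ?I (\<lambda>z. cnj (z powi k))"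
  have i: "integrable (harmonic_measure w) F" if "continuous_on (sphere 0 1) F" for F :: "complex \<Rightarrow> complex"
    by (rule integrable_continuous_on_circle[OF finite_measure_harmonic[OF w] sets_harmonic that])
  have cT: "continuous_on (sphere 0 1) (\<lambda>z. ?T z powi j)" for j
  proof -
    have "continuous_on (sphere 0 1) ?T" by (rule continuous_on_subset[OF disc_mapD(1)[OF T]]) auto
    then show ?thesis by (rule continuous_on_compose2[OF continuous_powi]) (use disc_mapD(4)[OF T] in auto)
  qed
  have cc: "continuous_on (sphere 0 1) (\<lambda>z::complex. cnj (z powi k))" for k
    by (intro continuous_on_cnj continuous_powi)
  have 1: "?I (\<lambda>z. (\<Sum>j\<in>J. c j * ?T z powi j) * cnj (\<Sum>k\<in>K. d k * z powi k))
     = (\<Sum>j\<in>J. \<Sum>k\<in>K. c j * cnj (d k) * ?I (\<lambda>z. ?T z powi j * cnj (z powi k)))"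
  proof -
    have "?I (\<lambda>z. (\<Sum>j\<in>J. c j * ?T z powi j) * cnj (\<Sum>k\<in>K. d k * z powi k))
       = ?I (\<lambda>z. \<Sum>j\<in>J. \<Sum>k\<in>K. c j * cnj (d k) * (?T z powi j * cnj (z powi k)))"
      unfolding cnj_sum complex_cnj_mult sum_product by (simp only: mult_ac)
    also have "\<dots> = (\<Sum>j\<in>J. ?I (\<lambda>z. \<Sum>k\<in>K. c j * cnj (d k) * (?T z powi j * cnj (z powi k))))"
      by (rule Bochner_Integration.integral_sum) (intro Bochner_Integration.integrable_sum integrable_mult_right i continuous_on_mult cT cc)
    also have "\<dots> = (\<Sum>j\<in>J. \<Sum>k\<in>K. ?I (\<lambda>z. c j * cnj (d k) * (?T z powi j * cnj (z powi k))))"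
      by (intro sum.cong refl Bochner_Integration.integral_sum integrable_mult_right i continuous_on_mult cT cc)
    finally show ?thesis by (simp only: integral_mult_right_zero)
  qed
  have 2: "?I (\<lambda>z. \<Sum>j\<in>J. c j * z powi j) = (\<Sum>j\<in>J. c j * ?I (\<lambda>z. z powi j))"
  proof -
    have "?I (\<lambda>z. \<Sum>j\<in>J. c j * z powi j) = (\<Sum>j\<in>J. ?I (\<lambda>z. c j * z powi j))"
      by (rule Bochner_Integration.integral_sum) (intro integrable_mult_right i continuous_powi)
    then show ?thesis by (simp only: integral_mult_right_zero)
  qed
  have 3: "?I (\<lambda>z. cnj (\<Sum>k\<in>K. d k * z powi k)) = (\<Sum>k\<in>K. cnj (d k) * ?I (\<lambda>z. cnj (z powi k)))"
  proof -
    have "?I (\<lambda>z. \<Sum>k\<in>K. cnj (d k) * cnj (z powi k)) = (\<Sum>k\<in>K. ?I (\<lambda>z. cnj (d k) * cnj (z powi k)))"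
      by (rule Bochner_Integration.integral_sum) (intro integrable_mult_right i cc)
    then show ?thesis by (simp only: cnj_sum complex_cnj_mult integral_mult_right_zero)
  qed
  have "?I (\<lambda>z. (\<Sum>j\<in>J. c j * ?T z powi j) * cnj (\<Sum>k\<in>K. d k * z powi k)) - ?I (\<lambda>z. \<Sum>j\<in>J. c j * z powi j) * ?I (\<lambda>z. cnj (\<Sum>k\<in>K. d k * z powi k))
     = (\<Sum>j\<in>J. \<Sum>k\<in>K. c j * cnj (d k) * ?B j k)"
    unfolding 1 2 3 by (simp only: sum_product right_diff_distrib sum_subtractf mult_ac)
  then have "correlation \<phi> w (\<lambda>z. \<Sum>j\<in>J. c j * z powi j) (\<lambda>z. \<Sum>k\<in>K. d k * z powi k) a = norm (\<Sum>j\<in>J. \<Sum>k\<in>K. c j * cnj (d k) * ?B j k)"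
    unfolding correlation_def by (simp only:)
  also have "\<dots> \<le> (\<Sum>j\<in>J. \<Sum>k\<in>K. norm (c j * cnj (d k) * ?B j k))"
    by (intro order_trans[OF norm_sum] sum_mono norm_sum)
  also have "\<dots> = (\<Sum>j\<in>J. \<Sum>k\<in>K. norm (c j) * norm (d k) * correlation \<phi> w (\<lambda>z. z powi j) (\<lambda>z. z powi k) a)"
    by (simp only: norm_mult complex_mod_cnj correlation_def)
  finally show ?thesis .
qed

lemma sum_quarter_powers_le:
  assumes "finite (K :: int set)"
  shows "(\<Sum>k\<in>K. (1 / 4) ^ nat \<bar>k\<bar>) \<le> (4 :: real)"
proof -
  have half: "(\<Sum>k\<in>K'. (1 / 4) ^ nat \<bar>k\<bar>) \<le> (2 :: real)" if K': "finite K'" "inj_on (\<lambda>k. nat \<bar>k\<bar>) K'" for K' :: "int set"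
  proof -
    have "(\<Sum>k\<in>K'. (1 / 4) ^ nat \<bar>k\<bar>) = (\<Sum>i\<in>(\<lambda>k. nat \<bar>k\<bar>) ` K'. (1 / 4 :: real) ^ i)"
      using sum.reindex[OF K'(2), of "\<lambda>i. (1 / 4 :: real) ^ i"] by simp
    also have "\<dots> \<le> (\<Sum>i. (1 / 4) ^ i)" using K' by (intro sum_le_suminf summable_geometric) auto
    also have "\<dots> = 4 / 3" using suminf_geometric[of "1 / 4 :: real"] by simp
    finally show ?thesis by simp
  qed
  have "(\<Sum>k\<in>K. (1 / 4 :: real) ^ nat \<bar>k\<bar>) = (\<Sum>k\<in>{k\<in>K. 0 \<le> k} \<union> {k\<in>K. k < 0}. (1 / 4) ^ nat \<bar>k\<bar>)"
    by (rule sum.cong) auto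
  also have "\<dots> = (\<Sum>k\<in>{k\<in>K. 0 \<le> k}. (1 / 4) ^ nat \<bar>k\<bar>) + (\<Sum>k\<in>{k\<in>K. k < 0}. (1 / 4) ^ nat \<bar>k\<bar>)"
    using assms by (intro sum.union_disjoint) auto
  also have "\<dots> \<le> 2 + 2" using assms by (intro add_mono half) (auto intro!: inj_onI)
  finally show ?thesis by simp
qed

text \<open>
  Cauchy-Schwarz with weights \<open>4 ^ \<bar>k\<bar>\<close> and \<open>2 ^ (- \<bar>k\<bar>)\<close>. The first ones are those of the
  norm for \<open>\<theta> = 1/4\<close>; this is where the value of \<open>\<theta>\<close> comes from.
\<close>

lemma sum_coeff_le_theta_norm:
  fixes c :: "int \<Rightarrow> complex"
  assumes K: "finite K"
  shows "(\<Sum>k\<in>K. norm (c k) * 2 ^ nat \<bar>k\<bar>) \<le> 2 * theta_norm (1 / 4) (\<lambda>z. \<Sum>k\<in>K. c k * z powi k)"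
proof -
  let ?N = "theta_norm (1 / 4) (\<lambda>z. \<Sum>k\<in>K. c k * z powi k)"
  have N0: "0 \<le> ?N" by (rule theta_norm_nonneg) simp
  have wt: "(1 / 4 :: real) powi (- 2 * \<bar>k\<bar>) = (4 ^ nat \<bar>k\<bar>)\<^sup>2" for k :: int
  proof -
    have "(1 / 4 :: real) powi (- 2 * \<bar>k\<bar>) = 4 powi (int (2 * nat \<bar>k\<bar>))"
      by (simp add: power_int_minus power_int_one_over)
    also have "\<dots> = 4 ^ (2 * nat \<bar>k\<bar>)" by (rule power_int_of_nat)
    finally show ?thesis by (simp add: power_mult power2_eq_square power_mult_distrib[symmetric])
  qed
  have N2: "?N\<^sup>2 = (\<Sum>k\<in>K. (norm (c k) * 4 ^ nat \<bar>k\<bar>)\<^sup>2)"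
  proof -
    have "?N\<^sup>2 = (\<Sum>\<^sub>\<infinity>k. theta_term (1 / 4) (\<lambda>z. \<Sum>k\<in>K. c k * z powi k) k)"
      by (rule theta_norm_square) simp
    then show ?thesis unfolding theta_term_laurent(2)[OF K] wt power_mult_distrib .
  qed
  have e: "norm (c k) * 2 ^ nat \<bar>k\<bar> = (norm (c k) * 4 ^ nat \<bar>k\<bar>) * (1 / 2) ^ nat \<bar>k\<bar>" for k
  proof -
    have "(4::real) ^ n * (1 / 2) ^ n = 2 ^ n" for n by (simp add: power_mult_distrib[symmetric])
    then show ?thesis by simp
  qed
  have "(\<Sum>k\<in>K. norm (c k) * 2 ^ nat \<bar>k\<bar>)\<^sup>2 \<le> ?N\<^sup>2 * (\<Sum>k\<in>K. ((1 / 2) ^ nat \<bar>k\<bar>)\<^sup>2)"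
    unfolding N2 e by (rule Cauchy_Schwarz_ineq_sum)
  also have "(\<Sum>k\<in>K. ((1 / 2 :: real) ^ nat \<bar>k\<bar>)\<^sup>2) = (\<Sum>k\<in>K. (1 / 4) ^ nat \<bar>k\<bar>)"
    by (rule sum.cong) (simp_all add: power2_eq_square power_mult_distrib[symmetric])
  also have "?N\<^sup>2 * \<dots> \<le> ?N\<^sup>2 * 4" using sum_quarter_powers_le[OF K] by (intro mult_left_mono) auto
  finally have "(\<Sum>k\<in>K. norm (c k) * 2 ^ nat \<bar>k\<bar>)\<^sup>2 \<le> (2 * ?N)\<^sup>2" by (simp add: power_mult_distrib)
  then show ?thesis by (rule power2_le_imp_le) (use N0 in simp)
qed

lemma L2_norm_harmonic_le:
  assumes w: "norm w < 1" and f: "f \<in> L2_functions circle_measure"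
  shows "f \<in> L2_functions (harmonic_measure w)"
    and "(LINT z|harmonic_measure w. (norm (f z))\<^sup>2) \<le> 1 / (1 - norm w)\<^sup>2 * (LINT z|circle_measure. (norm (f z))\<^sup>2)"
proof -
  have fm [measurable]: "f \<in> borel_measurable circle_measure" by (rule L2_borel[OF f])
  have Pm [measurable]: "poisson w \<in> borel_measurable circle_measure"
    by (rule measurable_circle_continuous[OF continuous_poisson[OF w]])
  have P0: "0 \<le> poisson w z" "poisson w z \<le> 1 / (1 - norm w)\<^sup>2" if "norm z = 1" for z
    using poisson_pos[OF w, of z] poisson_bounds(1)[OF w that that] that by auto
  have AEP: "AE z in circle_measure. 0 \<le> poisson w z"
    by (rule AE_I2) (simp add: space_circle P0)
  have i0: "integrable circle_measure (\<lambda>z. 1 / (1 - norm w)\<^sup>2 * (norm (f z))\<^sup>2)"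
    using f by (intro integrable_mult_right L2_integrable)
  have le: "poisson w z * (norm (f z))\<^sup>2 \<le> 1 / (1 - norm w)\<^sup>2 * (norm (f z))\<^sup>2" if "norm z = 1" for z
    using P0[OF that] by (intro mult_right_mono) auto
  have i1: "integrable circle_measure (\<lambda>z. poisson w z * (norm (f z))\<^sup>2)"
  proof (rule Bochner_Integration.integrable_bound[OF i0])
    show "AE z in circle_measure. norm (poisson w z * (norm (f z))\<^sup>2) \<le> norm (1 / (1 - norm w)\<^sup>2 * (norm (f z))\<^sup>2)"
    proof (rule AE_I2)
      fix z assume "z \<in> space circle_measure"
      then have z: "norm z = 1" by (simp add: space_circle)
      have "norm (poisson w z * (norm (f z))\<^sup>2) = poisson w z * (norm (f z))\<^sup>2" using P0[OF z] by simp
      also have "\<dots> \<le> norm (1 / (1 - norm w)\<^sup>2 * (norm (f z))\<^sup>2)" using le[OF z] by (simp add: abs_mult)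
      finally show "norm (poisson w z * (norm (f z))\<^sup>2) \<le> norm (1 / (1 - norm w)\<^sup>2 * (norm (f z))\<^sup>2)" .
    qed
  qed measurable
  have "integrable (harmonic_measure w) (\<lambda>z. (norm (f z))\<^sup>2)"
    using integrable_density[OF _ Pm AEP, of "\<lambda>z. (norm (f z))\<^sup>2"] i1
    by (simp add: harmonic_measure_def poisson_def[symmetric])
  then show "f \<in> L2_functions (harmonic_measure w)" using fm by (simp add: L2_functions_def measurable_harmonic)
  have "(LINT z|harmonic_measure w. (norm (f z))\<^sup>2) = (LINT z|circle_measure. poisson w z * (norm (f z))\<^sup>2)"
    using integral_density[OF _ Pm AEP, of "\<lambda>z. (norm (f z))\<^sup>2"]
    by (simp add: harmonic_measure_def poisson_def[symmetric])
  also have "\<dots> \<le> (LINT z|circle_measure. 1 / (1 - norm w)\<^sup>2 * (norm (f z))\<^sup>2)"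
    by (rule integral_mono[OF i1 i0]) (use le in \<open>simp add: space_circle\<close>)
  also have "\<dots> = 1 / (1 - norm w)\<^sup>2 * (LINT z|circle_measure. (norm (f z))\<^sup>2)"
    by (rule integral_mult_right_zero)
  finally show "(LINT z|harmonic_measure w. (norm (f z))\<^sup>2) \<le> 1 / (1 - norm w)\<^sup>2 * (LINT z|circle_measure. (norm (f z))\<^sup>2)" .
qed

text \<open>
  Approximation by Laurent polynomials in the weighted norm is also approximation in mean
  square, so the correlations converge. The factor \<open>2\<close> stems from \<open>theta_space_approx\<close>.
\<close>

lemma correlation_theta_space:
  assumes \<theta>: "0 < \<theta>" "\<theta> \<le> 1" and T: "disc_map (semigroup_action \<phi> a)" "semigroup_action \<phi> a w = w"
    and w: "norm w < 1" and D: "0 \<le> D"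
    and laurent: "\<And>p q. p \<in> laurent_polynomials \<Longrightarrow> q \<in> laurent_polynomials \<Longrightarrow>
      correlation \<phi> w p q a \<le> D * theta_norm \<theta> p * theta_norm \<theta> q"
    and f: "f \<in> theta_space \<theta>" and g: "g \<in> theta_space \<theta>"
  shows "correlation \<phi> w f g a \<le> 2 * D * theta_norm \<theta> f * theta_norm \<theta> g"
proof -
  let ?M = "harmonic_measure w" and ?n = "theta_norm \<theta>"
  have n0: "0 \<le> ?n h" for h by (rule theta_norm_nonneg[OF \<theta>(1)])
  define R where "R = 1 / (1 - norm w)"
  have R: "0 \<le> R" "R\<^sup>2 = 1 / (1 - norm w)\<^sup>2" using w by (auto simp: R_def power_divide)
  have fL: "f \<in> L2_functions circle_measure" and gL: "g \<in> L2_functions circle_measure"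
    using f g by (auto simp: theta_space_def)
  \<comment> \<open>The estimate obtained from approximants at distance \<open>e\<close>; it is continuous at \<open>e = 0\<close>.\<close>
  define bnd where "bnd e = 2 * (R * e) * L2_norm_on ?M g + 2 * (R * sqrt (2 * (?n f)\<^sup>2 + 2 * e\<^sup>2)) * (R * e)
     + D * sqrt (2 * (?n f)\<^sup>2 + 2 * e\<^sup>2) * sqrt (2 * (?n g)\<^sup>2 + 2 * e\<^sup>2)" for e
  have L2le: "L2_norm_on ?M h \<le> R * x" if h: "h \<in> L2_functions circle_measure" and x: "(LINT z|circle_measure. (norm (h z))\<^sup>2) \<le> x\<^sup>2" "0 \<le> x" for h x
  proof -
    have "(LINT z|?M. (norm (h z))\<^sup>2) \<le> R\<^sup>2 * (LINT z|circle_measure. (norm (h z))\<^sup>2)"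
      using L2_norm_harmonic_le(2)[OF w h] R by simp
    also have "\<dots> \<le> R\<^sup>2 * x\<^sup>2" using x by (intro mult_left_mono) auto
    finally have "sqrt (LINT z|?M. (norm (h z))\<^sup>2) \<le> sqrt ((R * x)\<^sup>2)"
      by (intro real_sqrt_le_mono) (simp add: power_mult_distrib)
    then show ?thesis using R x by (simp add: L2_norm_on_def)
  qed
  have le: "correlation \<phi> w f g a \<le> bnd e" if e: "0 < e" for e
  proof -
    obtain p where p: "p \<in> laurent_polynomials" "(LINT z|circle_measure. (norm (f z - p z))\<^sup>2) \<le> e\<^sup>2"
      "(?n p)\<^sup>2 \<le> 2 * (?n f)\<^sup>2 + 2 * e\<^sup>2" using theta_space_approx[OF f \<theta> e] by blast
    obtain q where q: "q \<in> laurent_polynomials" "(LINT z|circle_measure. (norm (g z - q z))\<^sup>2) \<le> e\<^sup>2"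
      "(?n q)\<^sup>2 \<le> 2 * (?n g)\<^sup>2 + 2 * e\<^sup>2" using theta_space_approx[OF g \<theta> e] by blast
    have pL: "p \<in> L2_functions circle_measure" and qL: "q \<in> L2_functions circle_measure"
      by (intro L2_continuous[OF circle.finite_measure_axioms refl] laurent_continuous p q)+
    have np: "?n p \<le> sqrt (2 * (?n f)\<^sup>2 + 2 * e\<^sup>2)" using p(3) by (rule real_le_rsqrt)
    have nq: "?n q \<le> sqrt (2 * (?n g)\<^sup>2 + 2 * e\<^sup>2)" using q(3) by (rule real_le_rsqrt)
    have 1: "L2_norm_on ?M (\<lambda>z. f z - p z) \<le> R * e" by (rule L2le[OF L2_diff[OF fL pL] p(2)]) (use e in simp)
    have 2: "L2_norm_on ?M (\<lambda>z. g z - q z) \<le> R * e" by (rule L2le[OF L2_diff[OF gL qL] q(2)]) (use e in simp)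
    have ps: "theta_term \<theta> p summable_on UNIV"
      using p(1) theta_term_laurent(1) unfolding laurent_polynomials_def by blast
    have 3: "L2_norm_on ?M p \<le> R * sqrt (2 * (?n f)\<^sup>2 + 2 * e\<^sup>2)"
      by (rule order_trans[OF L2le[OF pL integral_square_le_theta_norm[OF pL \<theta> ps] n0] mult_left_mono[OF np R(1)]])
    have "correlation \<phi> w f g a \<le> 2 * L2_norm_on ?M (\<lambda>z. f z - p z) * L2_norm_on ?M g
      + 2 * L2_norm_on ?M p * L2_norm_on ?M (\<lambda>z. g z - q z) + correlation \<phi> w p q a"
      by (rule correlation_approx[OF T w]) (intro L2_norm_harmonic_le(1)[OF w] fL gL pL qL)+
    also have "\<dots> \<le> 2 * (R * e) * L2_norm_on ?M g + 2 * (R * sqrt (2 * (?n f)\<^sup>2 + 2 * e\<^sup>2)) * (R * e)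
      + D * ?n p * ?n q"
      using 1 2 3 R e by (intro add_mono mult_mono laurent p q) (auto simp: L2_norm_nonneg)
    also have "D * ?n p * ?n q \<le> D * sqrt (2 * (?n f)\<^sup>2 + 2 * e\<^sup>2) * sqrt (2 * (?n g)\<^sup>2 + 2 * e\<^sup>2)"
      using np nq D n0 by (intro mult_mono) auto
    finally show ?thesis unfolding bnd_def by simp
  qed
  have "(bnd \<longlongrightarrow> bnd 0) (at_right 0)"
    unfolding bnd_def by (intro tendsto_intros)
  moreover have "bnd 0 = 2 * D * ?n f * ?n g"
    using n0 by (simp add: bnd_def real_sqrt_mult)
  moreover have "\<forall>\<^sub>F e in at_right 0. correlation \<phi> w f g a \<le> bnd e"
    by (rule eventually_at_rightI[of 0 1]) (auto intro: le)
  ultimately show ?thesis by (metis tendsto_lowerbound trivial_limit_at_right_real)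
qed

lemma double_exponentially_mixing_if_superattracting:
  assumes \<phi>: "\<And>j. j \<in> {1..N} \<Longrightarrow> disc_map (\<phi> j)" "\<And>j. j \<in> {1..N} \<Longrightarrow> \<phi> j w = w"
    "\<And>j. j \<in> {1..N} \<Longrightarrow> deriv (\<phi> j) w = 0"
    and w: "norm w < 1"
  shows "double_exponentially_mixing N \<phi> w"
proof -
  define r where "r = (1 + norm w) / 2"
  define s where "s = (r + norm w) / (1 + norm w * r)"
  have r: "0 < r" "r < 1" using w by (auto simp: r_def add_pos_nonneg)
  have s: "0 < s" "s < 1"
  proof -
    have p: "0 < 1 + norm w * r" using r by (simp add: add_pos_nonneg)
    show "0 < s" unfolding s_def using r p by (intro divide_pos_pos add_pos_nonneg) auto
    have "0 < (1 - r) * (1 - norm w)" using r w by simp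
    then have "r + norm w < 1 + norm w * r" by (simp add: algebra_simps)
    then show "s < 1" unfolding s_def using p by simp
  qed
  define E where "E = 8 / (1 - norm w)\<^sup>2"
  have E: "0 < E" using w by (simp add: E_def)
  have \<beta>: "0 < - ln s" using s by simp
  have \<gamma>: "0 < ln (2::real)" by simp
  have C: "0 < 8 * E" using E by simp
  show ?thesis unfolding double_exponentially_mixing_def
  proof (rule exI[of _ "1 / 4"], intro conjI, simp, simp,
      rule exI[of _ "- ln s"], rule conjI[OF \<beta>], rule exI[of _ "ln 2"], rule conjI[OF \<gamma>], rule exI[of _ "8 * E"], rule conjI[OF C], intro ballI)
    fix f g a assume f: "f \<in> theta_space (1 / 4)" and g: "g \<in> theta_space (1 / 4)" and a: "a \<in> free_semigroup N"
    have aJ: "j \<in> {1..N}" if "j \<in> set a" for j using a that by (auto simp: free_semigroup_def)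
    have T: "disc_map (semigroup_action \<phi> a)" "semigroup_action \<phi> a w = w"
      using aJ \<phi> by (auto intro: disc_map_semigroup_action semigroup_action_fixes)
    define \<delta> where "\<delta> = s ^ (2 ^ length a)"
    have \<delta>0: "0 \<le> E * \<delta>" using s E by (simp add: \<delta>_def)
    have L: "correlation \<phi> w p q a \<le> 4 * E * \<delta> * theta_norm (1 / 4) p * theta_norm (1 / 4) q"
      if pq: "p \<in> laurent_polynomials" "q \<in> laurent_polynomials" for p q
    proof -
      obtain c J d K where p: "p = (\<lambda>z. \<Sum>j\<in>J. c j * z powi j)" "finite (J :: int set)"
        and q: "q = (\<lambda>z. \<Sum>k\<in>K. d k * z powi k)" "finite (K :: int set)"
        using pq unfolding laurent_polynomials_def by blast
      have mono: "correlation \<phi> w (\<lambda>z. z powi j) (\<lambda>z. z powi k) a \<le> E * \<delta> * (2 ^ nat \<bar>j\<bar> * 2 ^ nat \<bar>k\<bar>)" for j k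
        unfolding E_def \<delta>_def s_def r_def by (rule correlation_monomials) (use aJ \<phi> w in auto)
      have "correlation \<phi> w p q a \<le> (\<Sum>j\<in>J. \<Sum>k\<in>K. norm (c j) * norm (d k) * correlation \<phi> w (\<lambda>z. z powi j) (\<lambda>z. z powi k) a)"
        unfolding p q by (rule correlation_laurent_le[OF T(1) w])
      also have "\<dots> \<le> (\<Sum>j\<in>J. \<Sum>k\<in>K. norm (c j) * norm (d k) * (E * \<delta> * (2 ^ nat \<bar>j\<bar> * 2 ^ nat \<bar>k\<bar>)))"
        by (intro sum_mono mult_left_mono mono) auto
      also have "\<dots> = E * \<delta> * ((\<Sum>j\<in>J. norm (c j) * 2 ^ nat \<bar>j\<bar>) * (\<Sum>k\<in>K. norm (d k) * 2 ^ nat \<bar>k\<bar>))"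
        unfolding sum_product unfolding sum_distrib_left by (simp only: mult_ac)
      also have "\<dots> \<le> E * \<delta> * ((2 * theta_norm (1 / 4) p) * (2 * theta_norm (1 / 4) q))"
        unfolding p q using sum_coeff_le_theta_norm[OF p(2), of c] sum_coeff_le_theta_norm[OF q(2), of d] \<delta>0
        by (intro mult_left_mono mult_mono) (auto intro!: sum_nonneg theta_norm_nonneg)
      finally show ?thesis by (simp add: mult_ac)
    qed
    have "correlation \<phi> w f g a \<le> 2 * (4 * E * \<delta>) * theta_norm (1 / 4) f * theta_norm (1 / 4) g"
      by (rule correlation_theta_space[OF _ _ T w _ L f g]) (use \<delta>0 in auto)
    also have "\<delta> = exp (- (- ln s) * exp (ln 2 * real (length a)))"
    proof -
      have "exp (ln 2 * real (length a)) = 2 ^ length a" by (simp add: exp_of_nat2_mult)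
      then have "exp (- (- ln s) * exp (ln 2 * real (length a))) = exp (ln s * real (2 ^ length a))" by simp
      also have "\<dots> = exp (ln s) ^ (2 ^ length a)" by (rule exp_of_nat2_mult)
      finally show ?thesis using s by (simp add: \<delta>_def)
    qed
    finally show "correlation \<phi> w f g a \<le> 8 * E * exp (- (- ln s) * exp (ln 2 * real (length a))) * theta_norm (1 / 4) f * theta_norm (1 / 4) g"
      by (simp only: mult.assoc[symmetric])
  qed
qed

section \<open>Multipliers from correlations\<close>

lemma deriv_iterate_fixed_point:
  assumes \<phi>: "disc_map (\<phi> j)" "\<phi> j w = w" and w: "norm w < 1"
  shows "deriv (semigroup_action \<phi> (replicate n j)) w = deriv (\<phi> j) w ^ n"
proof (induction n)
  case (Suc n)
  have T: "disc_map (semigroup_action \<phi> (replicate n j))"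
    by (rule disc_map_semigroup_action) (use \<phi> in auto)
  have d: "(f has_field_derivative deriv f w) (at w)" if "disc_map f" for f
    by (rule holomorphic_derivI[OF disc_mapD(2)[OF that]]) (use w in auto)
  have "((semigroup_action \<phi> (replicate n j) \<circ> \<phi> j) has_field_derivative
      deriv (semigroup_action \<phi> (replicate n j)) w * deriv (\<phi> j) w) (at w)"
    by (rule DERIV_chain[OF _ d[OF \<phi>(1)]]) (use d[OF T] \<phi>(2) in simp)
  then show ?case using Suc.IH by (simp add: DERIV_imp_deriv o_def)
qed simp

text \<open>
  Let \<open>T\<close> be the action of the word and \<open>T z - w = (z - w) * H z\<close>. On the circle the conjugate of the
  Blaschke factor is \<open>(1 - cnj w * z) / (z - w)\<close>, so integrating it against \<open>T - w\<close> evaluates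
  \<open>H z * (1 - cnj w * z)\<close> at \<open>w\<close> and yields \<open>1 - \<bar>w\<bar>\<^sup>2\<close> times the multiplier \<open>H w\<close>. The Blaschke factor equals
  \<open>- w\<close> plus the geometric series of \<open>(1 - \<bar>w\<bar>\<^sup>2) * cnj w ^ k * z ^ Suc k\<close>, and the integrals against
  the powers of \<open>z\<close> are correlations.
\<close>

lemma multiplier_le_correlation_series:
  assumes T: "disc_map (semigroup_action \<phi> a)" "semigroup_action \<phi> a w = w" and w: "norm w < 1"
    and x: "\<And>k. correlation \<phi> w (\<lambda>z. z powi 1) (\<lambda>z. z powi int (Suc k)) a \<le> x k"
    and s: "summable (\<lambda>k. norm w ^ k * x k)"
  shows "norm (deriv (semigroup_action \<phi> a) w) \<le> (\<Sum>k. norm w ^ k * x k)"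
proof -
  let ?T = "semigroup_action \<phi> a" and ?M = "harmonic_measure w"
  define h where "h = (\<lambda>z. ?T z - w)"
  have ch: "continuous_on (cball 0 1) h" and hh: "h holomorphic_on ball 0 1"
    unfolding h_def by (intro continuous_intros holomorphic_intros disc_mapD[OF T(1)])+
  have chs: "continuous_on (sphere 0 1) h" by (rule continuous_on_subset[OF ch]) auto
  have cT: "continuous_on (sphere 0 1) ?T" by (rule continuous_on_subset[OF disc_mapD(1)[OF T(1)]]) auto
  have hw: "h w = 0" by (simp add: h_def T(2))
  have dh: "deriv h w = deriv ?T w"
  proof -
    have "(?T has_field_derivative deriv ?T w) (at w)"
      by (rule holomorphic_derivI[OF disc_mapD(2)[OF T(1)]]) (use w in auto)
    then have "(h has_field_derivative deriv ?T w) (at w)"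
      unfolding h_def by (auto intro!: derivative_eq_intros)
    then show ?thesis by (rule DERIV_imp_deriv)
  qed
  obtain H where H: "continuous_on (cball 0 1) H" "H holomorphic_on ball 0 1" "H w = deriv h w" "\<And>z. z \<noteq> w \<Longrightarrow> H z = h z / (z - w)"
    using removable_quotient[OF ch hh w hw] by metis
  let ?p = "complex_of_real (1 - (norm w)\<^sup>2)"
  have p: "0 < 1 - (norm w)\<^sup>2" using w by (simp add: abs_square_less_1)
  have i: "integrable ?M F" if "continuous_on (sphere 0 1) F" for F :: "complex \<Rightarrow> complex"
    by (rule integrable_continuous_on_circle[OF finite_measure_harmonic[OF w] sets_harmonic that])
  define u where "u k z = h z * (w ^ k * cnj (z ^ Suc k))" for k z
  have cu: "continuous_on (sphere 0 1) (u k)" for k unfolding u_def by (intro continuous_intros chs)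
  have hb: "norm (h z) \<le> 2" if "norm z = 1" for z
    using norm_triangle_ineq4[of "?T z" w] disc_mapD(4)[OF T(1) that] w by (simp add: h_def)
  have ub: "norm (u k z) \<le> 2 * norm w ^ k" if z: "norm z = 1" for k z
    using mult_right_mono[OF hb[OF z], of "norm w ^ k"] z by (simp add: u_def norm_mult norm_power)
  have L: "norm (LINT z|?M. u k z) \<le> norm w ^ k * x k" for k
  proof -
    have int1: "(LINT z|?M. z) = w"
      by (rule poisson_integral_holomorphic[OF _ _ w]) (intro continuous_intros holomorphic_intros)+
    have c: "correlation \<phi> w (\<lambda>z. z powi 1) (\<lambda>z. z powi int (Suc k)) a = norm (LINT z|?M. h z * cnj (z ^ Suc k))"
      using correlation_eq_centred[OF T(1) w continuous_powi continuous_powi, of 1 "int (Suc k)"]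
      unfolding power_int_of_nat power_int_1_right int1 h_def .
    have "(LINT z|?M. u k z) = w ^ k * (LINT z|?M. h z * cnj (z ^ Suc k))"
      unfolding u_def by (simp add: mult.left_commute[of _ "w ^ k"] del: power_Suc)
    then have "norm (LINT z|?M. u k z) = norm w ^ k * correlation \<phi> w (\<lambda>z. z powi 1) (\<lambda>z. z powi int (Suc k)) a"
      unfolding c by (simp only: norm_mult norm_power)
    also have "\<dots> \<le> norm w ^ k * x k" by (intro mult_left_mono x) auto
    finally show ?thesis .
  qed
  have sg: "summable (\<lambda>k. 2 * norm w ^ k)" using w by (intro summable_mult summable_geometric) auto
  have swap: "(LINT z|?M. (\<Sum>k. u k z)) = (\<Sum>k. LINT z|?M. u k z)"
  proof (rule integral_suminf)
    show "integrable ?M (u k)" for k by (rule i[OF cu])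
    show "AE z in ?M. summable (\<lambda>k. norm (u k z))"
      by (rule AE_I2) (auto simp: space_harmonic intro!: summable_comparison_test[OF _ sg] exI[of _ 0] ub)
    interpret finite_measure ?M by (rule finite_measure_harmonic[OF w])
    show "summable (\<lambda>k. LINT z|?M. norm (u k z))"
    proof (rule summable_comparison_test[OF _ sg], intro exI[of _ 0] allI impI)
      fix k
      have "(LINT z|?M. norm (u k z)) \<le> (LINT z|?M. 2 * norm w ^ k)"
        by (rule integral_mono) (use ub in \<open>auto simp: space_harmonic intro!: integrable_norm i cu\<close>)
      also have "\<dots> = 2 * norm w ^ k" by (simp add: space_harmonic measure_harmonic[OF w])
      finally show "norm (LINT z|?M. norm (u k z)) \<le> 2 * norm w ^ k"
        by (simp add: integral_nonneg_AE)
    qed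
  qed
  \<comment> \<open>The geometric series of the conjugate Blaschke factor, multiplied by \<open>h\<close>; its constant term
    \<open>- cnj w\<close> is moved to the right-hand side.\<close>
  have usum: "?p * (\<Sum>k. u k z) = H z * (1 - cnj w * z) + cnj w * h z" if z: "norm z = 1" for z
  proof -
    have zw: "z \<noteq> w" "z \<noteq> 0" using z w by auto
    have nz: "z * cnj z = 1" using z by (simp add: complex_norm_square[symmetric])
    have lt: "norm (w * cnj z) < 1" using z w by (simp add: norm_mult)
    have "(\<Sum>k. u k z) = (\<Sum>k. (h z * cnj z) * (w * cnj z) ^ k)"
      by (simp add: u_def power_mult_distrib mult_ac)
    also have "\<dots> = (h z * cnj z) * (1 / (1 - w * cnj z))"
      by (simp only: suminf_mult[OF summable_geometric[OF lt]] suminf_geometric[OF lt])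
    also have "1 - w * cnj z = (z - w) * cnj z" using nz by (simp add: algebra_simps)
    also have "(h z * cnj z) * (1 / ((z - w) * cnj z)) = H z" using zw by (simp add: H(4))
    finally have e: "(\<Sum>k. u k z) = H z" .
    have hz: "h z = H z * (z - w)" using zw by (simp add: H(4))
    have "?p = 1 - w * cnj w" by (simp only: of_real_diff of_real_1 complex_norm_square)
    then show ?thesis unfolding e hz by (simp add: algebra_simps)
  qed
  have "?p * (\<Sum>k. LINT z|?M. u k z) = (LINT z|?M. ?p * (\<Sum>k. u k z))"
    unfolding swap[symmetric] by (rule integral_mult_right_zero[symmetric])
  also have "\<dots> = (LINT z|?M. H z * (1 - cnj w * z) + cnj w * h z)"
    by (rule Bochner_Integration.integral_cong[OF refl], rule usum) (simp add: space_harmonic)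
  also have "\<dots> = H w * (1 - cnj w * w) + cnj w * h w"
    by (rule poisson_integral_holomorphic[OF _ _ w]) (intro continuous_intros holomorphic_intros H ch hh)+
  also have "\<dots> = ?p * deriv ?T w"
    unfolding hw H(3) dh of_real_diff of_real_1 complex_norm_square by (simp add: mult_ac)
  finally have "deriv ?T w = (\<Sum>k. LINT z|?M. u k z)" using p by (simp del: of_real_diff)
  also have "norm \<dots> \<le> (\<Sum>k. norm w ^ k * x k)"
    by (rule norm_suminf_le[OF L s])
  finally show ?thesis .
qed

text \<open>
  Along the iterates of \<open>\<phi> j\<close> the correlations of \<open>z\<close> with \<open>z ^ Suc k\<close> are at most \<open>2\<close> and at most
  \<open>E n * \<theta> ^ (- (k + 2))\<close>, where \<open>E n\<close> is double exponentially small. Interpolation with an exponent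
  \<open>\<sigma>\<close> for which \<open>\<bar>w\<bar> < \<theta> powr \<sigma>\<close> makes the series in \<open>k\<close> converge and leaves \<open>E n powr \<sigma>\<close>, which is
  smaller than any exponential such as the \<open>n\<close>-th power of a nonzero multiplier.
\<close>

lemma double_exponential_imp_superattracting:
  assumes \<phi>: "disc_map (\<phi> j)" "\<phi> j w = w" and w: "norm w < 1" and j: "j \<in> {1..N}"
    and dm: "double_exponentially_mixing N \<phi> w"
  shows "deriv (\<phi> j) w = 0"
proof (rule ccontr)
  assume nz: "deriv (\<phi> j) w \<noteq> 0"
  define l where "l = norm (deriv (\<phi> j) w)"
  have l: "0 < l" using nz by (simp add: l_def)
  obtain \<theta> \<beta> \<gamma> C where \<theta>: "0 < \<theta>" "\<theta> < 1" and pos: "0 < \<beta>" "0 < \<gamma>" "0 < C"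
    and decay: "\<And>f g a. f \<in> theta_space \<theta> \<Longrightarrow> g \<in> theta_space \<theta> \<Longrightarrow> a \<in> free_semigroup N \<Longrightarrow>
      correlation \<phi> w f g a \<le> C * exp (- \<beta> * exp (\<gamma> * real (length a))) * theta_norm \<theta> f * theta_norm \<theta> g"
    using dm unfolding double_exponentially_mixing_def by blast
  \<comment> \<open>Such an exponent exists because \<open>\<theta> powr \<sigma>\<close> tends to \<open>1 > \<bar>w\<bar>\<close> as \<open>\<sigma>\<close> tends to \<open>0\<close>.\<close>
  obtain \<sigma> where \<sigma>: "0 < \<sigma>" "\<sigma> < 1" "norm w < \<theta> powr \<sigma>"
  proof -
    have "((\<lambda>\<sigma>. \<theta> powr \<sigma>) \<longlongrightarrow> \<theta> powr 0) (at_right 0)" using \<theta> by (intro tendsto_intros) auto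
    then have "((\<lambda>\<sigma>. \<theta> powr \<sigma>) \<longlongrightarrow> 1) (at_right 0)" using \<theta> by simp
    then have "\<forall>\<^sub>F \<sigma> in at_right 0. norm w < \<theta> powr \<sigma>" using w by (rule order_tendstoD)
    moreover have "\<forall>\<^sub>F \<sigma> in at_right 0. \<sigma> < (1::real)" by (rule eventually_at_rightI[of 0 1]) auto
    moreover have "\<forall>\<^sub>F \<sigma> in at_right 0. (0::real) < \<sigma>" by (rule eventually_at_right_less)
    ultimately have "\<forall>\<^sub>F \<sigma> in at_right 0. 0 < \<sigma> \<and> \<sigma> < 1 \<and> norm w < \<theta> powr \<sigma>" by eventually_elim auto
    then show thesis using that eventually_happens'[OF trivial_limit_at_right_real] by blast
  qed
  \<comment> \<open>The growth rate in \<open>k\<close> after interpolation.\<close>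
  define t where "t = \<theta> powr (- \<sigma>)"
  have t: "0 < t" "norm w * t < 1"
  proof -
    show "0 < t" using \<theta> by (simp add: t_def)
    have "norm w * t < \<theta> powr \<sigma> * t" using \<sigma>(3) \<open>0 < t\<close> by (rule mult_strict_right_mono)
    also have "\<dots> = 1" using \<theta> by (simp add: t_def powr_add[symmetric])
    finally show "norm w * t < 1" .
  qed
  define E where "E n = C * exp (- \<beta> * exp (\<gamma> * real n))" for n
  have E: "0 < E n" for n using pos by (simp add: E_def)
  have main: "l ^ n \<le> 2 * (E n) powr \<sigma> * t\<^sup>2 * (1 / (1 - norm w * t))" if n: "0 < n" for n
  proof -
    let ?a = "replicate n j"
    have a: "?a \<in> free_semigroup N" using n j by (auto simp: free_semigroup_def)
    have T: "disc_map (semigroup_action \<phi> ?a)" "semigroup_action \<phi> ?a w = w"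
      using \<phi> by (auto intro!: disc_map_semigroup_action semigroup_action_fixes)
    define x where "x k = 2 * (E n) powr \<sigma> * t ^ (k + 2)" for k
    have x: "correlation \<phi> w (\<lambda>z. z powi 1) (\<lambda>z. z powi int (Suc k)) ?a \<le> x k" for k
    proof -
      define X where "X = E n * (1 / \<theta>) ^ (k + 2)"
      have X: "0 < X" using E \<theta> by (simp add: X_def)
      have mem: "(\<lambda>z. z powi i) \<in> theta_space \<theta>" for i
        using laurent_theta_space[OF laurent_monomial[of 1 i]] by simp
      have tn: "theta_norm \<theta> (\<lambda>z. z powi int i) = (1 / \<theta>) ^ i" for i
        using theta_norm_monomial[OF \<theta>(1), of "int i"] by (simp add: power_int_minus power_one_over inverse_eq_divide)
      have "correlation \<phi> w (\<lambda>z. z powi int 1) (\<lambda>z. z powi int (Suc k)) ?a \<le>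
         E n * theta_norm \<theta> (\<lambda>z. z powi int 1) * theta_norm \<theta> (\<lambda>z. z powi int (Suc k))"
        using decay[OF mem mem a, of "int 1" "int (Suc k)"] by (simp only: E_def length_replicate)
      also have "\<dots> = X" unfolding tn X_def by (simp add: power_add mult_ac)
      finally have 1: "correlation \<phi> w (\<lambda>z. z powi 1) (\<lambda>z. z powi int (Suc k)) ?a \<le> X" by simp
      have mL: "(\<lambda>z. z powi i) \<in> L2_functions (harmonic_measure w)" for i
        by (rule L2_continuous[OF finite_measure_harmonic[OF w] sets_harmonic continuous_powi])
      have mn: "L2_norm_on (harmonic_measure w) (\<lambda>z. z powi i) = 1" for i
      proof -
        have "(LINT z|harmonic_measure w. (norm (z powi i))\<^sup>2) = (LINT z|harmonic_measure w. 1)"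
          by (rule Bochner_Integration.integral_cong[OF refl]) (simp add: space_harmonic norm_power_int)
        then show ?thesis by (simp add: L2_norm_on_def space_harmonic measure_harmonic[OF w])
      qed
      have 2: "correlation \<phi> w (\<lambda>z. z powi 1) (\<lambda>z. z powi int (Suc k)) ?a \<le> 2"
        using correlation_le_L2[OF T w mL mL, of 1 "int (Suc k)"] by (simp only: mn)
      \<comment> \<open>The minimum of \<open>2\<close> and \<open>X\<close> is at most \<open>2 * X powr \<sigma>\<close>.\<close>
      have "correlation \<phi> w (\<lambda>z. z powi 1) (\<lambda>z. z powi int (Suc k)) ?a \<le> 2 * X powr \<sigma>"
      proof (cases "1 \<le> X")
        case True
        then have "1 \<le> X powr \<sigma>" using \<sigma> by (simp add: ge_one_powr_ge_zero)
        then show ?thesis using 2 by linarith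
      next
        case False
        then have "X powr 1 \<le> X powr \<sigma>" using \<sigma> X by (intro powr_mono') auto
        then show ?thesis using 1 X by simp
      qed
      also have "X powr \<sigma> = (E n) powr \<sigma> * t ^ (k + 2)"
      proof -
        have "((1 / \<theta>) ^ (k + 2)) powr \<sigma> = t ^ (k + 2)"
        proof -
          have "((1 / \<theta>) ^ (k + 2)) powr \<sigma> = ((1 / \<theta>) powr real (k + 2)) powr \<sigma>"
            using \<theta> by (simp only: powr_realpow[of "1 / \<theta>" "k + 2"] zero_less_divide_1_iff)
          also have "\<dots> = ((1 / \<theta>) powr \<sigma>) powr real (k + 2)" by (simp only: powr_powr mult.commute)
          also have "(1 / \<theta>) powr \<sigma> = t" using \<theta> by (simp add: t_def powr_minus_divide powr_divide)
          also have "t powr real (k + 2) = t ^ (k + 2)" using t(1) by (rule powr_realpow)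
          finally show ?thesis .
        qed
        moreover have "X powr \<sigma> = (E n) powr \<sigma> * ((1 / \<theta>) ^ (k + 2)) powr \<sigma>"
          unfolding X_def by (rule powr_mult)
        ultimately show ?thesis by (simp only:)
      qed
      finally show ?thesis by (simp add: x_def)
    qed
    have g: "norm (norm w * t) < 1" using t by (simp add: abs_mult)
    have xe: "norm w ^ k * x k = 2 * (E n) powr \<sigma> * t\<^sup>2 * (norm w * t) ^ k" for k
      by (simp add: x_def power_add power_mult_distrib power2_eq_square mult_ac)
    have s: "summable (\<lambda>k. norm w ^ k * x k)" unfolding xe by (intro summable_mult summable_geometric g)
    have "norm (deriv (semigroup_action \<phi> ?a) w) \<le> (\<Sum>k. norm w ^ k * x k)"
      by (rule multiplier_le_correlation_series[OF T w x s])
    also have "\<dots> = 2 * (E n) powr \<sigma> * t\<^sup>2 * (1 / (1 - norm w * t))"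
      unfolding xe suminf_mult[OF summable_geometric[OF g]] suminf_geometric[OF g] ..
    finally show ?thesis
      by (simp add: deriv_iterate_fixed_point[where \<phi> = \<phi> and j = j, OF \<phi> w] norm_power l_def)
  qed
  define D where "D = 2 * C powr \<sigma> * t\<^sup>2 * (1 / (1 - norm w * t))"
  have D: "0 < D" unfolding D_def using pos t by (intro mult_pos_pos divide_pos_pos) auto
  define b where "b = \<beta> * \<sigma>"
  have b: "0 < b" using pos \<sigma> by (simp add: b_def)
  have le: "1 \<le> D * exp (- ln l * real n - b * exp (\<gamma> * real n))" if n: "0 < n" for n
  proof -
    have "(E n) powr \<sigma> = C powr \<sigma> * exp (- b * exp (\<gamma> * real n))"
      using pos by (simp add: E_def powr_mult exp_powr_real b_def mult_ac)
    then have "l ^ n \<le> D * exp (- b * exp (\<gamma> * real n))" using main[OF n] by (simp add: D_def mult_ac)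
    moreover have "l ^ n = exp (ln l * real n)" using l exp_of_nat2_mult[of "ln l" n] by simp
    ultimately have "exp (ln l * real n) \<le> D * exp (- b * exp (\<gamma> * real n))" by simp
    then have "exp (- ln l * real n) * exp (ln l * real n) \<le> exp (- ln l * real n) * (D * exp (- b * exp (\<gamma> * real n)))"
      by (intro mult_left_mono) auto
    then show ?thesis by (simp add: exp_add[symmetric] exp_diff exp_minus field_simps)
  qed
  have "(\<lambda>n. D * exp (- ln l * real n - b * exp (\<gamma> * real n))) \<longlonglongrightarrow> 0"
    using b pos D by real_asymp
  then have "\<forall>\<^sub>F n in sequentially. D * exp (- ln l * real n - b * exp (\<gamma> * real n)) < 1"
    by (rule order_tendstoD) simp
  then obtain n where "\<And>m. m \<ge> n \<Longrightarrow> D * exp (- ln l * real m - b * exp (\<gamma> * real m)) < 1"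
    by (auto simp: eventually_sequentially)
  from this[of "Suc n"] le[of "Suc n"] show False by simp
qed

section \<open>The three mixing rates\<close>

theorem theorem1p4:
  fixes N :: nat and \<phi> :: "nat \<Rightarrow> complex \<Rightarrow> complex" and w :: complex and \<alpha> :: real
  assumes "N \<ge> 1"
    and "\<And>j. j \<in> {1..N} \<Longrightarrow> finite_blaschke (\<phi> j)"
    and "w \<in> ball 0 1"
    and "\<And>j. j \<in> {1..N} \<Longrightarrow> \<phi> j w = w"
    and "0 < \<alpha>" and "\<alpha> \<le> 1"
  shows "(\<not> mixing N \<phi> w \<longleftrightarrow> (\<exists>j\<in>{1..N}. norm (deriv (\<phi> j) w) = 1)) \<and>
         (exponentially_mixing \<alpha> N \<phi> w \<longleftrightarrow> (\<forall>j\<in>{1..N}. norm (deriv (\<phi> j) w) < 1)) \<and>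
         (double_exponentially_mixing N \<phi> w \<longleftrightarrow> (\<forall>j\<in>{1..N}. deriv (\<phi> j) w = 0))"
proof -
  have w: "norm w < 1" using assms(3) by simp
  have \<phi>: "disc_map (\<phi> j)" "\<phi> j w = w" "norm (deriv (\<phi> j) w) \<le> 1" if "j \<in> {1..N}" for j
  proof -
    show 1: "disc_map (\<phi> j)" by (rule disc_map_finite_blaschke[OF assms(2)[OF that]])
    show 2: "\<phi> j w = w" by (rule assms(4)[OF that])
    show "norm (deriv (\<phi> j) w) \<le> 1" by (rule schwarz_pick_fixed_point(1)[OF 1 w 2])
  qed
  have contr: "exponentially_mixing \<alpha> N \<phi> w" if "\<forall>j\<in>{1..N}. norm (deriv (\<phi> j) w) < 1"
    by (rule exponentially_mixing_if_contracting) (use \<phi> that w assms(5,6) in auto)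
  have mix: "mixing N \<phi> w" if "exponentially_mixing \<alpha> N \<phi> w"
    by (rule mixing_if_exponentially_mixing[OF _ _ w assms(5,6) that]) (use \<phi> in auto)
  have dich: "(\<forall>j\<in>{1..N}. norm (deriv (\<phi> j) w) < 1) \<longleftrightarrow> \<not> (\<exists>j\<in>{1..N}. norm (deriv (\<phi> j) w) = 1)"
    using \<phi>(3) by (auto simp: order_less_le)
  have rot: "\<not> mixing N \<phi> w" if "\<exists>j\<in>{1..N}. norm (deriv (\<phi> j) w) = 1"
    using that \<phi> rotation_not_mixing[where \<phi> = \<phi>, OF _ _ w] by blast
  have rot2: "\<not> exponentially_mixing \<alpha> N \<phi> w" if "\<exists>j\<in>{1..N}. norm (deriv (\<phi> j) w) = 1"
    using that \<phi> rotation_not_exponentially_mixing[where \<phi> = \<phi>, OF _ _ w _ _ assms(5,6)] by blast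
  have dbl1: "double_exponentially_mixing N \<phi> w" if "\<forall>j\<in>{1..N}. deriv (\<phi> j) w = 0"
    by (rule double_exponentially_mixing_if_superattracting) (use \<phi> that w in auto)
  have dbl2: "deriv (\<phi> j) w = 0" if "double_exponentially_mixing N \<phi> w" "j \<in> {1..N}" for j
    by (rule double_exponential_imp_superattracting[where \<phi> = \<phi> and j = j, OF _ _ w that(2,1)]) (use \<phi> that in auto)
  show ?thesis using contr mix dich rot rot2 dbl1 dbl2 by blast
qed

end
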